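(* Let $f$ be a non-constant Dirichlet series with a meromorphic extension of finite order to $\mathbb{C}$ (as in the context), with Newton-Cramer distribution $W(f)$ and coefficients $b_{\mathbf{k}}$ ($\mathbf{k}\in\Lambda$) of $-\log f$. Then, as distributions on $\mathbb{R}_+^*=(0,\infty)$, $$W(f)|_{\mathbb{R}_+^*}=\sum_{\mathbf{k}\in\Lambda}\langle\boldsymbol{\lambda},\mathbf{k}\rangle\,b_{\mathbf{k}}\,\delta_{\langle\boldsymbol{\lambda},\mathbf{k}\rangle}.$$
   Context: Dirichlet series: $f(s)=1+\sum_{n\ge1}a_ne^{-\lambda_ns}$, non-constant, with $a_n\in\mathbb{C}$, $0<\lambda_1<\lambda_2<\cdots$, where $(\lambda_n)$ is finite or $\lambda_n\to+\infty$, and $\sum_n|a_n|e^{-\lambda_n\bar\sigma}<\infty$ for some $\bar\sigma\in\mathbb{R}$. It is assumed that $f$ extends to a meromorphic function of finite order on $\mathbb{C}$. Divisor: $\rho$ runs over zeros and poles of $f$, with multiplicity $n_\rho\in\mathbb{Z}$ (positive for zeros, negative for poles; $n_\rho=0$ otherwise). The convergence exponent $d$ is the least integer $d\ge0$ with $\sum_{\rho\ne0}|n_\rho||\rho|^{-d}<\infty$ (one has $d\ge1$ here). $\sigma_1=\sup_\rho\Re\rho<+\infty$. Newton-Cramer distribution: with $\mathbf{1}_{\mathbb{R}_+}$ the indicator of $[0,\infty)$, $$K_d(t)=\Big(n_{\sigma_1}\frac{t^d}{d!}+\sum_{\rho\ne\sigma_1}\frac{n_\rho}{(\rho-\sigma_1)^d}e^{(\rho-\sigma_1)t}\Big)\mathbf{1}_{\mathbb{R}_+},\qquad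 W(f)=e^{\sigma_1t}\frac{D^d}{Dt^d}\big((K_d(t)-K_d(0))\mathbf{1}_{\mathbb{R}_+}\big),$$ with $D/Dt$ the distributional derivative on $\mathbb{R}$. (On $\mathbb{R}_+^*$, $W(f)$ is the distributional sum $\sum_\rho n_\rho e^{\rho t}$.) Coefficients: $\Lambda$ is the set of non-zero sequences $\mathbf{k}=(k_n)_{n\ge1}$ of non-negative integers with finitely many non-zero entries, $\|\mathbf{k}\|=\sum k_n$, $\langle\boldsymbol{\lambda},\mathbf{k}\rangle=\sum\lambda_nk_n$, and $b_{\mathbf{k}}=\frac{(-1)^{\|\mathbf{k}\|}}{\|\mathbf{k}\|}\frac{\|\mathbf{k}\|!}{\prod_jk_j!}\prod_ja_j^{k_j}$, so that $-\log f(s)=\sum_{\mathbf{k}\in\Lambda}b_{\mathbf{k}}e^{-\langle\boldsymbol{\lambda},\mathbf{k}\rangle s}$ for $\Re s$ large. $\delta_a$ is the Dirac mass at $a$. *)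

theory Defs
  imports "HOL-Complex_Analysis.Complex_Analysis"
begin

section \<open>Distributions on open subsets of the real line\<close>

definition tderiv :: "(real \<Rightarrow> complex) \<Rightarrow> real \<Rightarrow> complex" where
  "tderiv \<phi> = (\<lambda>t. vector_derivative \<phi> (at t))"

definition smooth_fun :: "(real \<Rightarrow> complex) \<Rightarrow> bool" where
  "smooth_fun \<phi> \<longleftrightarrow> (\<forall>n t. (tderiv ^^ n) \<phi> differentiable (at t))"

definition test_functions :: "real set \<Rightarrow> (real \<Rightarrow> complex) set" where
  "test_functions U =
     {\<phi>. smooth_fun \<phi> \<and> compact (closure {t. \<phi> t \<noteq> 0}) \<and> closure {t. \<phi> t \<noteq> 0} \<subseteq> U}"

text \<open>
  Distributions are represented by functionals on all functions of type
  \<^typ>\<open>real \<Rightarrow> complex\<close>; only their values on test functions are meaningful. The restriction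
  of a distribution to a smaller open set is the same functional, tested against fewer functions.
\<close>

type_synonym functional = "(real \<Rightarrow> complex) \<Rightarrow> complex"

definition distribution_on :: "real set \<Rightarrow> functional \<Rightarrow> bool" where
  "distribution_on U T \<longleftrightarrow>
     (\<forall>\<phi>\<in>test_functions U. \<forall>\<psi>\<in>test_functions U. T (\<lambda>t. \<phi> t + \<psi> t) = T \<phi> + T \<psi>) \<and>
     (\<forall>c. \<forall>\<phi>\<in>test_functions U. T (\<lambda>t. c * \<phi> t) = c * T \<phi>) \<and>
     (\<forall>K. compact K \<and> K \<subseteq> U \<longrightarrow>
        (\<exists>(C::real) m. \<forall>\<phi>\<in>test_functions U. (\<forall>t. t \<notin> K \<longrightarrow> \<phi> t = 0) \<longrightarrow>
           norm (T \<phi>) \<le> C * (\<Sum>j\<le>m. SUP t. norm ((tderiv ^^ j) \<phi> t))))"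

definition distribution_of_fun :: "(real \<Rightarrow> complex) \<Rightarrow> functional" where
  "distribution_of_fun g = (\<lambda>\<phi>. LINT t|lborel. g t * \<phi> t)"

definition distribution_deriv :: "functional \<Rightarrow> functional" where
  "distribution_deriv T = (\<lambda>\<phi>. - T (tderiv \<phi>))"

definition distribution_mult :: "(real \<Rightarrow> complex) \<Rightarrow> functional \<Rightarrow> functional" where
  "distribution_mult h T = (\<lambda>\<phi>. T (\<lambda>t. h t * \<phi> t))"

definition dirac :: "real \<Rightarrow> functional" where
  "dirac x = (\<lambda>\<phi>. \<phi> x)"


section \<open>Meromorphic functions of finite order\<close>

definition entire_finite_order :: "(complex \<Rightarrow> complex) \<Rightarrow> bool" where
  "entire_finite_order g \<longleftrightarrow>
     g holomorphic_on UNIV \<and>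
     (\<exists>\<alpha>::real. \<forall>\<^sub>F z in at_infinity. norm (g z) \<le> exp (norm z powr \<alpha>))"

text \<open>
  A meromorphic function has finite order if it is a quotient of two entire functions of finite
  order. Being nicely meromorphic normalises the values of \<^term>\<open>f\<close> (removable singularities are
  removed, the value at a pole is 0).
\<close>

definition meromorphic_finite_order :: "(complex \<Rightarrow> complex) \<Rightarrow> bool" where
  "meromorphic_finite_order f \<longleftrightarrow>
     f nicely_meromorphic_on UNIV \<and>
     (\<exists>g h. entire_finite_order g \<and> entire_finite_order h \<and> (\<exists>z. h z \<noteq> 0) \<and>
            (\<forall>z. h z \<noteq> 0 \<longrightarrow> f z = g z / h z))"


section \<open>The divisor and the Newton-Cramer distribution\<close>

text \<open>
  The multiplicity of \<open>\<rho>\<close> is \<^term>\<open>zorder f \<rho>\<close>: positive at zeros, negative at poles,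
  and 0 at every other point when \<^term>\<open>f\<close> is nicely meromorphic and not identically 0.
\<close>

definition divisor_support :: "(complex \<Rightarrow> complex) \<Rightarrow> complex set" where
  "divisor_support f = {\<rho>. zorder f \<rho> \<noteq> 0}"

definition convergence_exponent :: "(complex \<Rightarrow> complex) \<Rightarrow> nat" where
  "convergence_exponent f =
     (LEAST d. (\<lambda>\<rho>. \<bar>real_of_int (zorder f \<rho>)\<bar> / norm \<rho> ^ d) summable_on (divisor_support f - {0}))"

definition sigma1 :: "(complex \<Rightarrow> complex) \<Rightarrow> real" where
  "sigma1 f = Sup (Re ` divisor_support f)"

definition Kd :: "(complex \<Rightarrow> complex) \<Rightarrow> real \<Rightarrow> complex" where
  "Kd f t =
     (let d = convergence_exponent f; \<sigma> = complex_of_real (sigma1 f) in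
        (of_int (zorder f \<sigma>) * of_real (t ^ d / fact d) +
         (\<Sum>\<^sub>\<infinity>\<rho>\<in>divisor_support f - {\<sigma>}.
            of_int (zorder f \<rho>) / (\<rho> - \<sigma>) ^ d * exp ((\<rho> - \<sigma>) * of_real t)))
        * indicator {0..} t)"

definition newton_cramer :: "(complex \<Rightarrow> complex) \<Rightarrow> functional" where
  "newton_cramer f =
     distribution_mult (\<lambda>t. of_real (exp (sigma1 f * t)))
       ((distribution_deriv ^^ convergence_exponent f)
          (distribution_of_fun (\<lambda>t. (Kd f t - Kd f 0) * indicator {0..} t)))"


section \<open>Dirichlet series\<close>

text \<open>The frequencies are indexed by $1 \le n \le N$, where \<open>N = \<infinity>\<close> is allowed.\<close>

definition indices :: "enat \<Rightarrow> nat set" where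
  "indices N = {n. 1 \<le> n \<and> enat n \<le> N}"

definition frequencies :: "enat \<Rightarrow> (nat \<Rightarrow> real) \<Rightarrow> bool" where
  "frequencies N l \<longleftrightarrow>
     (\<forall>n\<in>indices N. 0 < l n) \<and> strict_mono_on (indices N) l \<and>
     (N = \<infinity> \<longrightarrow> filterlim l at_top sequentially)"

definition dirichlet_series ::
    "enat \<Rightarrow> (nat \<Rightarrow> real) \<Rightarrow> (nat \<Rightarrow> complex) \<Rightarrow> complex \<Rightarrow> complex" where
  "dirichlet_series N l a s = 1 + (\<Sum>\<^sub>\<infinity>n\<in>indices N. a n * exp (- (of_real (l n) * s)))"

definition supp :: "(nat \<Rightarrow> nat) \<Rightarrow> nat set" where
  "supp k = {n. k n \<noteq> 0}"

definition Lambda :: "enat \<Rightarrow> (nat \<Rightarrow> nat) set" where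
  "Lambda N = {k. supp k \<noteq> {} \<and> finite (supp k) \<and> supp k \<subseteq> indices N}"

definition weight :: "(nat \<Rightarrow> nat) \<Rightarrow> nat" where
  "weight k = (\<Sum>n\<in>supp k. k n)"

definition pairing :: "(nat \<Rightarrow> real) \<Rightarrow> (nat \<Rightarrow> nat) \<Rightarrow> real" where
  "pairing l k = (\<Sum>n\<in>supp k. l n * real (k n))"

definition log_coeff :: "(nat \<Rightarrow> complex) \<Rightarrow> (nat \<Rightarrow> nat) \<Rightarrow> complex" where
  "log_coeff a k =
     (-1) ^ weight k / of_nat (weight k) *
     (fact (weight k) / (\<Prod>n\<in>supp k. fact (k n))) * (\<Prod>n\<in>supp k. a n ^ k n)"

end

theory Submission
  imports Defs
begin

text \<open>
  Write \<open>\<rho>\<close> for the zeros and poles of \<open>f\<close>, \<open>n\<^sub>\<rho>\<close> for their multiplicities and \<open>x\<^sub>k = \<langle>\<lambda>, k\<rangle>\<close>.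
  The two sides of the formula agree because they have the same Laplace transform up to a
  polynomial, namely the logarithmic derivative \<open>f'/f\<close>. Differentiating \<open>-log f = \<Sum> b\<^sub>k e\<^bsup>-x\<^sub>k s\<^esup>\<close> term by term
  gives \<open>f'/f = \<Sum> x\<^sub>k b\<^sub>k e\<^bsup>-x\<^sub>k s\<^esup>\<close>, the transform of the sum of Dirac masses. The transform of
  \<open>\<Sum> n\<^sub>\<rho> e\<^bsup>\<rho>t\<^esup>\<close> is formally \<open>\<Sum> n\<^sub>\<rho> / (s - \<rho>)\<close>, and since \<open>f\<close> has finite order this differs from \<open>f'/f\<close> only by
  a polynomial. A polynomial is the transform of a distribution supported at 0, so it is invisible
  on the open half-line.

  The proof arranges that this polynomial never has to be named: the two distributions are compared
  on the functions \<open>t\<^sup>M e\<^bsup>-st\<^esup>\<close> with \<open>M\<close> large, which amounts to comparing derivatives of order \<open>M\<close> of the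
  transforms. This needs the following.

  \<^item> \<open>meromorphic_finite_order_logderiv\<close>: for large \<open>M\<close> the \<open>M\<close>-th derivative of \<open>f'/f\<close> is the limit of the
    \<open>M\<close>-th derivatives of the partial sums of \<open>\<Sum> n\<^sub>\<rho> / (z - \<rho>)\<close> over discs. For an entire function,
    divide out the zeros in a disc of radius \<open>R\<close>; the quotient is bounded by the maximum principle, its
    logarithm by the Borel-Caratheodory inequality, and the Cauchy estimates for derivatives of high
    order tend to 0 as \<open>R\<close> grows. The same quotient bounds the number of zeros, so the convergence
    exponent exists.

  \<^item> \<open>dirichlet_logderiv_expansion\<close>: the expansion of \<open>f'/f\<close> and its derivatives, from the multinomial theorem
    for infinite families and the series of the logarithm.

  \<^item> \<open>Kd_properties\<close>: integrating by parts \<open>d\<close> times turns the pairing of \<open>K\<^sub>d\<close> with the \<open>d\<close>-th derivative of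
    \<open>t\<^sup>M e\<^bsup>-st\<^esup>\<close> into the limit of the sums of \<open>n\<^sub>\<rho> M! / (s + \<sigma>\<^sub>1 - \<rho>)\<^bsup>M+1\<^esup>\<close>.

  \<^item> \<open>distribution_determined_by_power_exponentials\<close>: agreement on the functions \<open>t\<^sup>M e\<^bsup>-st\<^esup>\<close> implies agreement on
    test functions, by the Weierstrass approximation theorem in the variable \<open>e\<^bsup>-t\<^esup>\<close>.

  The constant \<open>K\<^sub>d(0)\<close> disappears on integration by parts if \<open>d \<ge> 1\<close>. If \<open>d = 0\<close>, the divisor is finite and
  \<open>K\<^sub>d(0) = \<Sum> n\<^sub>\<rho>\<close>; multiplying the identity of transforms by \<open>s\<^bsup>M+1\<^esup>\<close> and letting \<open>s\<close> tend to infinity,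
  the divisor side tends to \<open>M! \<Sum> n\<^sub>\<rho>\<close> while the Dirichlet side decays exponentially, so the constant is 0.
  Once the formula holds, \<open>W(f)\<close> is visibly a distribution of order 0 on the half-line.
\<close>

section \<open>Zeros and logarithmic derivatives of entire functions of finite order\<close>

text \<open>
  A local quotient by \<open>(z - b)\<^sup>n\<close> at \<open>b\<close>, glued to the global quotient away from \<open>b\<close>.
\<close>

lemma divide_out_zero:
  assumes g: "g holomorphic_on UNIV" and nz: "\<exists>z. g z \<noteq> 0"
  obtains r where "r holomorphic_on UNIV" "\<And>z. g z = r z * (z - b) ^ nat (zorder g b)" "r b \<noteq> 0"
proof -
  define n where "n = nat (zorder g b)"
  have "\<exists>w\<in>UNIV. g w \<noteq> 0" using nz by simp
  then obtain e h where e: "e > 0" "h holomorphic_on cball b e"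
    "\<And>w. w \<in> cball b e \<Longrightarrow> g w = h w * (w - b) ^ n \<and> h w \<noteq> 0"
    using zorder_exist_zero[OF g open_UNIV connected_UNIV UNIV_I, of b] unfolding n_def by blast
  define r where "r = (\<lambda>z. if z \<in> ball b e then h z else g z / (z - b) ^ n)"
  have r_eq: "r z = g z / (z - b) ^ n" if "z \<noteq> b" for z
    using e(3)[of z] that by (auto simp: r_def)
  have "r holomorphic_on ball b e"
    using holomorphic_on_subset[OF e(2) ball_subset_cball]
    by (rule holomorphic_transform) (auto simp: r_def)
  moreover have "r holomorphic_on -{b}"
  proof (rule holomorphic_transform)
    show "(\<lambda>z. g z / (z - b) ^ n) holomorphic_on - {b}"
      using g by (intro holomorphic_intros) (auto intro: holomorphic_on_subset)
  qed (use r_eq in auto)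
  ultimately have "r holomorphic_on ball b e \<union> -{b}"
    by (intro holomorphic_on_Un) auto
  moreover have "ball b e \<union> -{b} = UNIV" using e(1) by auto
  ultimately have "r holomorphic_on UNIV" by simp
  moreover have "g z = r z * (z - b) ^ n" for z
    using e(1) e(3)[of z] r_eq[of z] by (cases "z = b") (auto simp: r_def)
  moreover have "r b \<noteq> 0" using e(1) e(3)[of b] by (auto simp: r_def)
  ultimately show ?thesis using that unfolding n_def by blast
qed

text \<open>
  The factors are normalised to be 1 at the centre \<open>c\<close>, so that dividing them out does not change the
  value there; on a large circle around \<open>c\<close> each of them has modulus at least 1.
\<close>

lemma divide_out_zeros:
  assumes g: "g holomorphic_on UNIV" and nz: "g c \<noteq> 0" and A: "finite A" "c \<notin> A"
  obtains q where "q holomorphic_on UNIV"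
    "\<And>z. g z = q z * (\<Prod>a\<in>A. ((z - a) / (c - a)) ^ nat (zorder g a))" "\<And>a. a \<in> A \<Longrightarrow> q a \<noteq> 0"
proof -
  have "\<exists>q. q holomorphic_on UNIV \<and> (\<forall>z. g z = q z * (\<Prod>a\<in>A. ((z - a) / (c - a)) ^ nat (zorder g a)))
         \<and> (\<forall>a\<in>A. q a \<noteq> 0)"
    using A
  proof (induction A rule: finite_induct)
    case empty
    show ?case using g by (intro exI[of _ g]) auto
  next
    case (insert b A)
    define P where "P = (\<lambda>z. \<Prod>a\<in>A. ((z - a) / (c - a)) ^ nat (zorder g a))"
    from insert obtain q where q: "q holomorphic_on UNIV" "\<And>z. g z = q z * P z" "\<And>a. a \<in> A \<Longrightarrow> q a \<noteq> 0"
      unfolding P_def by auto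
    have q_nz: "\<exists>z. q z \<noteq> 0" using q(2)[of c] nz by auto
    obtain r where r: "r holomorphic_on UNIV" "\<And>z. q z = r z * (z - b) ^ nat (zorder q b)" "r b \<noteq> 0"
      using divide_out_zero[OF q(1) q_nz, where b = b] by metis
    have "P b \<noteq> 0" using insert by (auto simp: P_def prod_zero_iff)
    have "P holomorphic_on UNIV" unfolding P_def
      using insert by (intro holomorphic_intros) auto
    define j where "j = nat (zorder q b)"
    have "zorder g b = int j"
      by (intro zorder_eqI[where S = UNIV and g = "\<lambda>z. r z * P z"] holomorphic_intros)
         (use r \<open>P b \<noteq> 0\<close> q(2) \<open>P holomorphic_on UNIV\<close> in \<open>simp_all add: j_def mult_ac power_int_def\<close>)
    hence n: "nat (zorder q b) = nat (zorder g b)" by (simp add: j_def)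
    define k where "k = (c - b) ^ nat (zorder g b)"
    have k: "k \<noteq> 0" using insert by (auto simp: k_def)
    show ?case
    proof (intro exI[of _ "\<lambda>z. k * r z"] conjI allI ballI)
      show "(\<lambda>z. k * r z) holomorphic_on UNIV" using r by (intro holomorphic_intros) auto
      show "g z = k * r z * (\<Prod>a\<in>insert b A. ((z - a) / (c - a)) ^ nat (zorder g a))" for z
        using insert.hyps insert.prems k q(2)[of z] r(2)[of z] n
        by (simp add: P_def power_divide k_def)
      show "k * r a \<noteq> 0" if "a \<in> insert b A" for a
        using that k r(2,3) q(3)[of a] by auto
    qed
  qed
  thus ?thesis using that by blast
qed

text \<open>
  Finite order, in a form that is stable under moving the centre \<open>c\<close>: a natural exponent \<open>p\<close>, and a
  bound for all radii from 1 on instead of for large ones.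
\<close>

definition exp_power_growth :: "(complex \<Rightarrow> complex) \<Rightarrow> complex \<Rightarrow> real \<Rightarrow> nat \<Rightarrow> bool" where
  "exp_power_growth g c B p \<longleftrightarrow> (\<forall>r\<ge>1. \<forall>z. norm (z - c) \<le> r \<longrightarrow> norm (g z) \<le> exp (B * r ^ p))"

text \<open>
  On the circle of radius \<open>(K + 1) R\<close> every factor \<open>(z - a) / (c - a)\<close> with \<open>a\<close> in the disc of radius \<open>R\<close> has
  modulus at least \<open>K\<close>; the maximum principle carries the bound inside. The case \<open>K = 2\<close> counts zeros,
  the case \<open>K = 1\<close> bounds the quotient.
\<close>

lemma quotient_growth:
  assumes g: "exp_power_growth g c B p" and q: "q holomorphic_on UNIV"
    and eq: "\<And>z. g z = q z * (\<Prod>a\<in>A. ((z - a) / (c - a)) ^ m a)"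
    and A: "finite A" "A \<subseteq> cball c R" "c \<notin> A" and R: "R \<ge> 1" and K: "K \<ge> 1"
    and z: "norm (z - c) \<le> (K + 1) * R"
  shows "norm (q z) * K ^ (\<Sum>a\<in>A. m a) \<le> exp (B * ((K + 1) * R) ^ p)"
proof -
  define T where "T = (K + 1) * R"
  have "1 * 1 \<le> (K + 1) * R" using R K by (intro mult_mono) auto
  hence T: "T \<ge> 1" "T > 0" unfolding T_def by auto
  have bd: "norm (q w * of_real (K ^ (\<Sum>a\<in>A. m a))) \<le> exp (B * T ^ p)" if w: "w \<in> frontier (cball c T)" for w
  proof -
    have wT: "norm (w - c) = T" using w T by (simp add: dist_norm norm_minus_commute)
    have "K ^ m a \<le> norm (((w - a) / (c - a)) ^ m a)" if "a \<in> A" for a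
    proof -
      have "norm (c - a) \<le> R" "c \<noteq> a" using A that by (auto simp: dist_norm)
      moreover have "norm (w - a) \<ge> norm (w - c) - norm (c - a)"
        using norm_triangle_ineq4[of "w - a" "c - a"] by simp
      ultimately have "norm (w - a) \<ge> K * R" unfolding wT T_def by (simp add: algebra_simps)
      moreover have "K * R \<ge> K * norm (c - a)" using K \<open>norm (c - a) \<le> R\<close> by simp
      ultimately have "norm ((w - a) / (c - a)) \<ge> K"
        using \<open>c \<noteq> a\<close> by (simp add: norm_divide field_simps)
      thus ?thesis unfolding norm_power using K by (intro power_mono) auto
    qed
    hence "(\<Prod>a\<in>A. K ^ m a) \<le> (\<Prod>a\<in>A. norm (((w - a) / (c - a)) ^ m a))"
      using K by (intro prod_mono) auto
    hence "norm (q w) * K ^ (\<Sum>a\<in>A. m a) \<le> norm (q w) * (\<Prod>a\<in>A. norm (((w - a) / (c - a)) ^ m a))"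
      by (intro mult_left_mono) (simp_all add: power_sum)
    also have "\<dots> = norm (g w)" by (simp add: eq norm_mult prod_norm)
    also have "\<dots> \<le> exp (B * T ^ p)"
      using g wT T unfolding exp_power_growth_def by auto
    finally show ?thesis using K by (simp add: norm_mult norm_power)
  qed
  have "norm (q z * of_real (K ^ (\<Sum>a\<in>A. m a))) \<le> exp (B * T ^ p)"
  proof (rule maximum_modulus_frontier[where S = "cball c T" and f = "\<lambda>z. q z * of_real (K ^ (\<Sum>a\<in>A. m a))"])
    show "(\<lambda>z. q z * of_real (K ^ (\<Sum>a\<in>A. m a))) holomorphic_on interior (cball c T)"
      using q by (intro holomorphic_intros) (auto intro: holomorphic_on_subset)
    show "continuous_on (closure (cball c T)) (\<lambda>z. q z * of_real (K ^ (\<Sum>a\<in>A. m a)))"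
      using q by (intro continuous_intros holomorphic_on_imp_continuous_on) (auto intro: holomorphic_on_subset)
    show "z \<in> cball c T" using z by (simp add: T_def dist_norm norm_minus_commute)
  qed (use bd in auto)
  thus ?thesis using K by (simp add: T_def norm_mult norm_power)
qed

lemma finite_zeros_cball:
  assumes "g holomorphic_on UNIV" "g c \<noteq> 0"
  shows "finite {a \<in> cball b R. g a = 0}"
proof (rule ccontr)
  assume inf: "infinite {a \<in> cball b R. g a = 0}"
  obtain l where "l islimpt {a \<in> cball b R. g a = 0}"
    using inf compact_cball[of b R, unfolded compact_eq_Bolzano_Weierstrass]
    by (elim allE[of _ "{a \<in> cball b R. g a = 0}"]) auto
  hence "l islimpt {a. g a = 0}" by (rule islimpt_subset) auto
  hence "g c = 0"
    by (intro analytic_continuation[OF assms(1) open_UNIV connected_UNIV, of "{a. g a = 0}" l c]) auto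
  with assms show False by simp
qed

text \<open>
  Evaluate the bound on the quotient at the centre, where it takes the non-zero value \<open>g c\<close>: each zero
  in the disc contributes a factor 2. This replaces Jensen's formula.
\<close>

lemma zero_counting_bound:
  assumes "g holomorphic_on UNIV" "g c \<noteq> 0" "exp_power_growth g c B p"
  obtains C where "C \<ge> 0" "\<And>R. R \<ge> 1 \<Longrightarrow> (\<Sum>a | a \<in> cball c R \<and> g a = 0. real (nat (zorder g a))) \<le> C * R ^ p"
proof
  define C where "C = (\<bar>B\<bar> * 3 ^ p + \<bar>ln (norm (g c))\<bar>) / ln 2"
  show "C \<ge> 0" by (simp add: C_def)
  fix R :: real assume R: "R \<ge> 1"
  define A where "A = {a. a \<in> cball c R \<and> g a = 0}"
  have A: "finite A" "A \<subseteq> cball c R" "c \<notin> A"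
    using finite_zeros_cball[OF assms(1,2), of c R] assms by (auto simp: A_def)
  obtain q where q: "q holomorphic_on UNIV"
    "\<And>z. g z = q z * (\<Prod>a\<in>A. ((z - a) / (c - a)) ^ nat (zorder g a))"
    using divide_out_zeros[OF assms(1,2) A(1,3)] by metis
  have "q c = g c" using q(2)[of c] A(3) by (simp add: prod.neutral)
  define n where "n = (\<Sum>a\<in>A. nat (zorder g a))"
  have "norm (g c) * 2 ^ n \<le> exp (B * (3 * R) ^ p)"
    using quotient_growth[OF assms(3) q A R, of 2 c] R \<open>q c = g c\<close> unfolding n_def by simp
  hence "ln (norm (g c) * 2 ^ n) \<le> B * (3 * R) ^ p"
    using assms(2) ln_mono[of "norm (g c) * 2 ^ n" "exp (B * (3 * R) ^ p)"] by simp
  hence "ln (norm (g c)) + real n * ln 2 \<le> B * (3 * R) ^ p"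
    using assms(2) by (simp add: ln_mult ln_realpow)
  hence "real n * ln 2 \<le> B * (3 * R) ^ p + \<bar>ln (norm (g c))\<bar>" by linarith
  also have "\<dots> \<le> \<bar>B\<bar> * (3 * R) ^ p + \<bar>ln (norm (g c))\<bar> * R ^ p"
  proof (rule add_mono)
    show "B * (3 * R) ^ p \<le> \<bar>B\<bar> * (3 * R) ^ p" using R by (intro mult_right_mono) auto
    show "\<bar>ln (norm (g c))\<bar> \<le> \<bar>ln (norm (g c))\<bar> * R ^ p"
      using mult_left_mono[OF one_le_power[OF R, of p], of "\<bar>ln (norm (g c))\<bar>"] by simp
  qed
  also have "\<dots> = (\<bar>B\<bar> * 3 ^ p + \<bar>ln (norm (g c))\<bar>) * R ^ p"
    by (simp only: power_mult_distrib distrib_right mult.assoc)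
  finally have "real n \<le> (\<bar>B\<bar> * 3 ^ p + \<bar>ln (norm (g c))\<bar>) * R ^ p / ln 2"
    by (subst pos_le_divide_eq) auto
  hence "real n \<le> C * R ^ p"
    unfolding C_def by simp
  thus "(\<Sum>a | a \<in> cball c R \<and> g a = 0. real (nat (zorder g a))) \<le> C * R ^ p"
    unfolding n_def A_def by simp
qed

text \<open>
  The map \<open>v \<mapsto> v / (2 K - v)\<close> sends the half-plane \<open>Re v < K\<close> into the unit disc and 0 to 0, so the
  Schwarz lemma applies to its composition with \<open>L\<close>.
\<close>

lemma borel_caratheodory:
  assumes L: "L holomorphic_on ball c R" and L0: "L c = 0" and R: "R > 0"
    and re: "\<And>z. z \<in> ball c R \<Longrightarrow> Re (L z) < K" and z: "norm (z - c) \<le> R / 2"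
  shows "norm (L z) \<le> 2 * K"
proof -
  have K: "K > 0" using re[of c] L0 R by simp
  have ne: "2 * of_real K - L z \<noteq> 0" if "z \<in> ball c R" for z
    using re[OF that] K by (auto simp: complex_eq_iff)
  define w where "w = (\<lambda>u. L (c + of_real R * u) / (2 * of_real K - L (c + of_real R * u)))"
  have sub: "c + of_real R * u \<in> ball c R" if "u \<in> ball 0 1" for u
    using that R by (simp add: dist_norm norm_mult)
  have comp: "(\<lambda>u. L (c + of_real R * u)) holomorphic_on ball 0 1"
  proof (rule holomorphic_on_compose_gen[OF _ L, of "\<lambda>u. c + of_real R * u" "ball 0 1", unfolded o_def])
    show "(\<lambda>u. c + of_real R * u) holomorphic_on ball 0 1" by (intro holomorphic_intros)
    show "(\<lambda>u. c + of_real R * u) ` ball 0 1 \<subseteq> ball c R" using sub by blast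
  qed
  have holw: "w holomorphic_on ball 0 1" unfolding w_def
    using comp ne sub by (intro holomorphic_intros) auto
  have norm_w: "norm (w u) < 1" if "norm u < 1" for u
  proof -
    define v where "v = L (c + of_real R * u)"
    have v: "Re v < K" "2 * of_real K - v \<noteq> 0" using re[of "c + of_real R * u"] ne[OF sub, of u] sub[of u] that
      by (auto simp: v_def)
    have "K * Re v < K * K" using v K by simp
    hence "(norm v)\<^sup>2 < (norm (2 * of_real K - v))\<^sup>2"
      unfolding cmod_power2 by (simp add: power2_eq_square algebra_simps)
    hence "norm v < norm (2 * of_real K - v)" by (rule power2_less_imp_less) simp
    thus ?thesis using v by (simp add: w_def norm_divide flip: v_def)
  qed
  define u where "u = (z - c) / of_real R"
  have u: "norm u \<le> 1/2" "c + of_real R * u = z" using z R by (auto simp: u_def norm_divide field_simps)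
  have zb: "z \<in> ball c R" using z R by (simp add: dist_norm norm_minus_commute)
  have "norm (w u) \<le> norm u"
    using Schwarz_Lemma(1)[OF holw _ norm_w, of u] u L0 by (simp add: w_def)
  hence "norm (L z) \<le> norm u * norm (2 * of_real K - L z)"
    using u(2) ne[OF zb] by (simp add: w_def norm_divide field_simps)
  also have "\<dots> \<le> 1/2 * norm (2 * of_real K - L z)"
    using u(1) by (rule mult_right_mono) simp
  finally have "norm (L z) \<le> 1/2 * norm (2 * of_real K - L z)" .
  also have "\<dots> \<le> 1/2 * (2 * K + norm (L z))"
    using norm_triangle_ineq4[of "2 * of_real K" "L z"] K by simp
  finally show ?thesis by simp
qed

text \<open>
  A zero-free function on a disc has a holomorphic logarithm there. Its real part is bounded above by
  assumption, hence the logarithm is bounded on the half-size disc, and the Cauchy estimates bound the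
  derivatives of its derivative \<open>q'/q\<close>.
\<close>

lemma higher_deriv_logderiv_bound:
  assumes q: "q holomorphic_on ball c R" and nz: "\<And>z. z \<in> ball c R \<Longrightarrow> q z \<noteq> 0" and R: "R > 0"
    and bd: "\<And>z. z \<in> ball c R \<Longrightarrow> norm (q z) < exp K * norm (q c)"
    and z: "norm (z - c) \<le> R / 8"
  shows "norm ((deriv ^^ m) (\<lambda>w. deriv q w / q w) z) \<le> fact (Suc m) * (2 * K) / (R / 4) ^ Suc m"
proof -
  obtain L0 where L0: "L0 holomorphic_on ball c R" "\<And>z. z \<in> ball c R \<Longrightarrow> q z = exp (L0 z)"
    using contractible_imp_holomorphic_log[OF q convex_imp_contractible nz] by auto
  define L where "L = (\<lambda>z. L0 z - L0 c)"
  have L: "L holomorphic_on ball c R" unfolding L_def using L0 by (intro holomorphic_intros)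
  have re: "Re (L z) < K" if "z \<in> ball c R" for z
  proof -
    have "exp (Re (L z)) = norm (q z) / norm (q c)"
      using L0(2)[OF that] L0(2)[of c] R by (simp add: L_def exp_diff)
    also have "\<dots> < exp K" using bd[OF that] nz[of c] R by (simp add: field_simps)
    finally show ?thesis by simp
  qed
  have dL: "deriv L w = deriv q w / q w" if "w \<in> ball c R" for w
  proof -
    have dL0: "(L0 has_field_derivative deriv L0 w) (at w)"
      using L0(1) that by (meson holomorphic_derivI open_ball)
    hence "((\<lambda>z. exp (L0 z)) has_field_derivative exp (L0 w) * deriv L0 w) (at w)"
      by (auto intro!: derivative_eq_intros)
    hence "(q has_field_derivative exp (L0 w) * deriv L0 w) (at w)"
      by (rule has_field_derivative_transform_within_open[of _ _ _ "ball c R"]) (use that L0 in auto)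
    hence dq: "deriv q w = exp (L0 w) * deriv L0 w" by (rule DERIV_imp_deriv)
    have "(L has_field_derivative deriv L0 w) (at w)"
      unfolding L_def using dL0 by (auto intro!: derivative_eq_intros)
    hence "deriv L w = deriv L0 w" by (rule DERIV_imp_deriv)
    with dq show ?thesis using L0(2)[OF that] by simp
  qed
  have zb: "z \<in> ball c R" using z R by (simp add: dist_norm norm_minus_commute)
  have "(deriv ^^ m) (\<lambda>w. deriv q w / q w) z = (deriv ^^ m) (deriv L) z"
    by (rule higher_deriv_cong_ev[OF _ refl])
       (use dL zb eventually_nhds_in_open[OF open_ball zb] in \<open>auto elim!: eventually_mono\<close>)
  also have "\<dots> = (deriv ^^ Suc m) L z" by (simp add: funpow_swap1)
  also have "norm \<dots> \<le> fact (Suc m) * (2 * K) / (R / 4) ^ Suc m"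
  proof (rule Cauchy_inequality)
    have sub: "cball z (R / 4) \<subseteq> ball c R"
    proof
      fix x assume "x \<in> cball z (R / 4)"
      hence "dist c x \<le> R / 8 + R / 4"
        using dist_triangle[of c x z] z by (simp add: dist_norm norm_minus_commute)
      thus "x \<in> ball c R" using R by simp
    qed
    show "L holomorphic_on ball z (R/4)"
      using L sub by (meson ball_subset_cball holomorphic_on_subset subset_trans)
    show "continuous_on (cball z (R/4)) L"
      using L sub by (meson holomorphic_on_subset holomorphic_on_imp_continuous_on)
    show "norm (L x) \<le> 2 * K" if "norm (z - x) = R / 4" for x
    proof (rule borel_caratheodory[OF L _ R re])
      have "norm (x - c) \<le> norm (z - x) + norm (z - c)"
        using norm_triangle_ineq4[of "z - c" "z - x"] by simp
      thus "norm (x - c) \<le> R / 2" using that z R by simp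
    qed (auto simp: L_def)
  qed (use R in auto)
  finally show ?thesis .
qed

lemma exp_power_growth_mono:
  assumes "exp_power_growth g c B p" "B \<le> B'" "0 \<le> B'" "p \<le> p'"
  shows "exp_power_growth g c B' p'"
  unfolding exp_power_growth_def
proof safe
  fix r z assume r: "(1::real) \<le> r" and z: "norm (z - c) \<le> r"
  have "norm (g z) \<le> exp (B * r ^ p)" using assms(1) r z unfolding exp_power_growth_def by blast
  also have "B * r ^ p \<le> B' * r ^ p'"
    using assms r by (intro mult_mono power_increasing) auto
  finally show "norm (g z) \<le> exp (B' * r ^ p')" by simp
qed

lemma entire_finite_order_imp_growth:
  assumes "entire_finite_order g"
  obtains B p where "B \<ge> 0" "exp_power_growth g c B p"
proof -
  from assms obtain \<alpha> R0 where hol: "g holomorphic_on UNIV"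
    and \<alpha>: "\<And>z. norm z \<ge> R0 \<Longrightarrow> norm (g z) \<le> exp (norm z powr \<alpha>)"
    unfolding entire_finite_order_def eventually_at_infinity by auto
  define p where "p = nat \<lceil>\<alpha>\<rceil>"
  define R1 where "R1 = max R0 1"
  have "compact (g ` cball 0 R1)"
    using hol by (intro compact_continuous_image holomorphic_on_imp_continuous_on)
                 (auto intro: holomorphic_on_subset)
  then obtain M where M: "M > 0" "\<And>z. z \<in> cball 0 R1 \<Longrightarrow> norm (g z) \<le> M"
    by (metis compact_imp_bounded bounded_pos imageI)
  define K where "K = max 0 (ln M)"
  have KM: "M \<le> exp K" unfolding K_def using M(1) by (metis exp_le_cancel_iff exp_ln max.cobounded2)
  have bd: "norm (g z) \<le> exp (K + norm z ^ p)" for z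
  proof (cases "norm z \<le> R1")
    case True
    hence "norm (g z) \<le> exp K" using M(2)[of z] KM by simp
    also have "\<dots> \<le> exp (K + norm z ^ p)" by simp
    finally show ?thesis .
  next
    case False
    hence z: "norm z \<ge> 1" "norm z \<ge> R0" by (auto simp: R1_def)
    have "norm (g z) \<le> exp (norm z powr \<alpha>)" using \<alpha> z by simp
    also have "norm z powr \<alpha> \<le> norm z powr real p"
      using z unfolding p_def by (intro powr_mono) linarith+
    also have "\<dots> = norm z ^ p" using z by (intro powr_realpow) auto
    finally have "norm (g z) \<le> exp (norm z ^ p)" by simp
    also have "\<dots> \<le> exp (K + norm z ^ p)" by (simp add: K_def)
    finally show ?thesis .
  qed
  have "exp_power_growth g c (K + (1 + norm c) ^ p) p"
    unfolding exp_power_growth_def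
  proof safe
    fix r z assume r: "(1::real) \<le> r" and z: "norm (z - c) \<le> r"
    have "norm z \<le> r + norm c" using z norm_triangle_ineq[of "z - c" c] by simp
    also have "\<dots> \<le> (1 + norm c) * r"
      using mult_left_mono[OF r, of "norm c"] by (simp add: algebra_simps)
    finally have "norm z ^ p \<le> (1 + norm c) ^ p * r ^ p"
      unfolding power_mult_distrib[symmetric] by (intro power_mono) auto
    moreover have "K * 1 \<le> K * r ^ p" using r by (intro mult_left_mono) (auto simp: K_def)
    ultimately have "K + norm z ^ p \<le> (K + (1 + norm c) ^ p) * r ^ p" by (simp add: distrib_right)
    thus "norm (g z) \<le> exp ((K + (1 + norm c) ^ p) * r ^ p)"
      using bd[of z] by (meson exp_le_cancel_iff order_trans)
  qed
  moreover have "K + (1 + norm c) ^ p \<ge> 0" by (simp add: K_def)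
  ultimately show ?thesis using that by blast
qed

text \<open>
  Logarithmic differentiation of the factorisation from \<open>divide_out_zeros\<close>.
\<close>

lemma deriv_prod_linear_powers:
  assumes q: "q holomorphic_on UNIV" and A: "finite A" "c \<notin> A"
    and eq: "\<And>z. g z = q z * (\<Prod>a\<in>A. ((z - a) / (c - a)) ^ m a)"
    and w: "w \<notin> A" "q w \<noteq> 0"
  shows "deriv g w = g w * (deriv q w / q w + (\<Sum>a\<in>A. of_nat (m a) / (w - a)))"
proof -
  have P: "((\<lambda>z. \<Prod>a\<in>A. ((z - a) / (c - a)) ^ m a) has_field_derivative
          (\<Prod>a\<in>A. ((w - a) / (c - a)) ^ m a) * (\<Sum>a\<in>A. of_nat (m a) / (w - a))) (at w)"
    using A w(1)
  proof (induction A rule: finite_induct)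
    case (insert b A)
    define P where "P = (\<lambda>z. \<Prod>a\<in>A. ((z - a) / (c - a)) ^ m a)"
    define S where "S = (\<Sum>a\<in>A. of_nat (m a) / (w - a))"
    have ne: "c - b \<noteq> 0" "w - b \<noteq> 0" using insert by auto
    have IH: "(P has_field_derivative P w * S) (at w)"
      unfolding P_def S_def using insert by auto
    have "((\<lambda>z. ((z - b) / (c - b)) ^ m b) has_field_derivative
            of_nat (m b) * ((w - b) / (c - b)) ^ (m b - 1) * (1 / (c - b))) (at w)"
      using DERIV_power[OF DERIV_cdivide[OF DERIV_diff[OF DERIV_ident DERIV_const[of b]], of "c - b"], where n = "m b" and x = w and s = UNIV]
      by (simp add: mult_ac)
    also have "of_nat (m b) * ((w - b) / (c - b)) ^ (m b - 1) * (1 / (c - b)) =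
                ((w - b) / (c - b)) ^ m b * (of_nat (m b) / (w - b))"
    proof -
      define x where "x = (w - b) / (c - b)"
      have "1 / (c - b) = x * (1 / (w - b))" using ne by (simp add: x_def)
      hence "of_nat (m b) * x ^ (m b - 1) * (1 / (c - b)) = of_nat (m b) * x ^ (m b - 1) * (x * (1 / (w - b)))"
        by (rule arg_cong)
      also have "\<dots> = x ^ m b * (of_nat (m b) / (w - b))"
        by (cases "m b") (simp_all del: of_nat_Suc)
      finally show ?thesis unfolding x_def .
    qed
    finally have D: "((\<lambda>z. ((z - b) / (c - b)) ^ m b) has_field_derivative
       ((w - b) / (c - b)) ^ m b * (of_nat (m b) / (w - b))) (at w)" .
    have "((\<lambda>z. ((z - b) / (c - b)) ^ m b * P z) has_field_derivative
       (((w - b) / (c - b)) ^ m b * P w) * (of_nat (m b) / (w - b) + S)) (at w)"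
      by (rule DERIV_cong[OF DERIV_mult[OF D IH]]) (simp only: distrib_left distrib_right mult_ac add_ac)
    thus ?case using insert.hyps by (simp add: P_def S_def)
  qed auto
  have "(q has_field_derivative deriv q w) (at w)"
    using q by (auto intro: holomorphic_derivI)
  from DERIV_mult[OF this P] have "(g has_field_derivative
      g w * (deriv q w / q w + (\<Sum>a\<in>A. of_nat (m a) / (w - a)))) (at w)"
    unfolding eq[abs_def] using w by (simp add: algebra_simps)
  thus ?thesis by (rule DERIV_imp_deriv)
qed

text \<open>
  The error \<open>E n\<close> is the logarithmic derivative of the quotient of \<open>g\<close> by its zeros in the disc of
  radius \<open>n\<close>. The logarithm of that quotient is of size \<open>O(n\<^sup>p)\<close>, so its derivative of order \<open>m + 1 > p\<close> is
  \<open>O(1/n)\<close>. For smaller \<open>m\<close> there need not be convergence, since \<open>E n\<close> may keep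
  a polynomial part of degree less than \<open>p\<close>.
\<close>

lemma entire_logderiv_partial_fractions:
  assumes g: "g holomorphic_on UNIV" "g c \<noteq> 0" and gr: "exp_power_growth g c B p" "B \<ge> 0"
  obtains E :: "nat \<Rightarrow> complex \<Rightarrow> complex" where
    "\<And>n. n \<ge> 1 \<Longrightarrow> E n holomorphic_on ball c (real n)"
    "\<And>n w. n \<ge> 1 \<Longrightarrow> w \<in> ball c (real n) \<Longrightarrow> g w \<noteq> 0 \<Longrightarrow>
        deriv g w / g w = E n w + (\<Sum>a | a \<in> cball c (real n) \<and> g a = 0. of_int (zorder g a) / (w - a))"
    "\<And>m z. m \<ge> p \<Longrightarrow> (\<lambda>n. (deriv ^^ m) (E n) z) \<longlonglongrightarrow> 0"
proof -
  define A where "A = (\<lambda>n. {a. a \<in> cball c (real n) \<and> g a = 0})"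
  have A: "finite (A n)" "A n \<subseteq> cball c (real n)" "c \<notin> A n" for n
    using finite_zeros_cball[OF g, of c "real n"] g by (auto simp: A_def)
  have "\<forall>n. \<exists>q. q holomorphic_on UNIV \<and>
    (\<forall>z. g z = q z * (\<Prod>a\<in>A n. ((z - a) / (c - a)) ^ nat (zorder g a))) \<and> (\<forall>a\<in>A n. q a \<noteq> 0)"
    using divide_out_zeros[OF g A(1,3)] by metis
  then obtain q where q: "\<And>n. q n holomorphic_on UNIV"
    "\<And>n z. g z = q n z * (\<Prod>a\<in>A n. ((z - a) / (c - a)) ^ nat (zorder g a))" "\<And>n a. a \<in> A n \<Longrightarrow> q n a \<noteq> 0"
    by metis
  have qc: "q n c = g c" for n
    using q(2)[of c n] A(3)[of n] by (simp add: prod.neutral)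
  have q_nz: "q n w \<noteq> 0" if "w \<in> ball c (real n)" for n w
  proof (cases "g w = 0")
    case True
    thus ?thesis using that q(3)[of w n] by (auto simp: A_def)
  qed (use q(2)[of w n] in auto)
  define E where "E = (\<lambda>n w. deriv (q n) w / q n w)"
  have g_nat: "of_nat (nat (zorder g a)) = (of_int (zorder g a) :: complex)" for a
  proof -
    have "frequently (\<lambda>z. g z \<noteq> 0) (at a)"
      using non_zero_neighbour_alt[OF g(1) open_UNIV connected_UNIV UNIV_I UNIV_I g(2), of a]
      by (intro eventually_frequently) auto
    hence "zorder g a \<ge> 0" using g(1) by (intro zorder_ge_0) (auto simp: analytic_on_open holomorphic_on_imp_analytic_at)
    thus ?thesis by simp
  qed
  show ?thesis
  proof (rule that[of E])
    show "E n holomorphic_on ball c (real n)" for n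
      unfolding E_def using q(1)[of n] q_nz
      by (intro holomorphic_intros) (auto intro: holomorphic_on_subset)
    show "deriv g w / g w = E n w + (\<Sum>a | a \<in> cball c (real n) \<and> g a = 0. of_int (zorder g a) / (w - a))"
      if "w \<in> ball c (real n)" "g w \<noteq> 0" for n w
      using deriv_prod_linear_powers[OF q(1) A(1,3) q(2), of w n] that q_nz[OF that(1)]
      by (auto simp: E_def A_def g_nat)
    fix m z assume m: "m \<ge> p"
    define D where "D = fact (Suc m) * 2 * (B * 2 ^ p + \<bar>ln (norm (g c))\<bar> + 1) * 4 ^ Suc m"
    show "(\<lambda>n. (deriv ^^ m) (E n) z) \<longlonglongrightarrow> 0"
    proof (rule Lim_null_comparison)
      show "(\<lambda>n. D / real n) \<longlonglongrightarrow> 0" by real_asymp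
      have "eventually (\<lambda>n. real n \<ge> max 1 (8 * norm (z - c))) sequentially" by real_asymp
      thus "eventually (\<lambda>n. norm ((deriv ^^ m) (E n) z) \<le> D / real n) sequentially"
      proof eventually_elim
        case (elim n)
        define R where "R = real n"
        have R: "R \<ge> 1" "norm (z - c) \<le> R / 8" using elim by (auto simp: R_def)
        define K where "K = B * (2 * R) ^ p + \<bar>ln (norm (g c))\<bar> + 1"
        have "norm ((deriv ^^ m) (E n) z) \<le> fact (Suc m) * (2 * K) / (R / 4) ^ Suc m"
          unfolding E_def
        proof (rule higher_deriv_logderiv_bound)
          show "q n holomorphic_on ball c R" using q(1) holomorphic_on_subset by blast
          show "q n w \<noteq> 0" if "w \<in> ball c R" for w using that q_nz by (simp add: R_def)
          fix w assume w: "w \<in> ball c R"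
          have "norm (q n w) \<le> exp (B * (2 * R) ^ p)"
            using quotient_growth[OF gr(1) q(1) q(2) A(1) A(2)[of n, folded R_def] A(3) R(1), of 1 w] w R
            by (simp add: dist_norm norm_minus_commute)
          also have "\<dots> = exp (B * (2 * R) ^ p - ln (norm (g c))) * norm (g c)"
            using g by (simp add: exp_diff)
          also have "\<dots> < exp K * norm (g c)"
            using g by (intro mult_strict_right_mono) (auto simp: K_def)
          finally show "norm (q n w) < exp K * norm (q n c)" by (simp add: qc)
        qed (use R in auto)
        also have "K \<le> (B * 2 ^ p + \<bar>ln (norm (g c))\<bar> + 1) * R ^ p"
        proof -
          have "(\<bar>ln (norm (g c))\<bar> + 1) * 1 \<le> (\<bar>ln (norm (g c))\<bar> + 1) * R ^ p"
            using R by (intro mult_left_mono) auto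
          thus ?thesis unfolding K_def by (simp add: algebra_simps power_mult_distrib)
        qed
        also have "R ^ p \<le> R ^ m" using m R by (intro power_increasing) auto
        finally have "norm ((deriv ^^ m) (E n) z) \<le>
           fact (Suc m) * (2 * ((B * 2 ^ p + \<bar>ln (norm (g c))\<bar> + 1) * R ^ m)) / (R / 4) ^ Suc m"
          using gr(2) R by (simp add: divide_right_mono mult_left_mono)
        also have "\<dots> = D / R"
          using R by (simp add: D_def power_divide)
        finally show ?case by (simp add: R_def)
      qed
    qed
  qed
qed

section \<open>The logarithmic derivative of a meromorphic function of finite order\<close>

abbreviation logderiv :: "(complex \<Rightarrow> complex) \<Rightarrow> complex \<Rightarrow> complex" where
  "logderiv f \<equiv> \<lambda>w. deriv f w / f w"

lemma higher_deriv_partial_fractions: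
  fixes k :: "complex \<Rightarrow> complex"
  assumes "finite A" "z \<notin> A"
  shows "(deriv ^^ m) (\<lambda>w. \<Sum>a\<in>A. k a / (w - a)) z
           = (\<Sum>a\<in>A. k a * ((-1) ^ m * fact m / (z - a) ^ Suc m))"
  using assms(2)
proof (induction m arbitrary: z)
  case (Suc m)
  have "(deriv ^^ Suc m) (\<lambda>w. \<Sum>a\<in>A. k a / (w - a)) z
        = deriv (\<lambda>z. \<Sum>a\<in>A. k a * ((-1) ^ m * fact m / (z - a) ^ Suc m)) z"
    unfolding funpow.simps o_def
  proof (rule deriv_cong_ev[OF _ refl])
    have "eventually (\<lambda>w. w \<in> -A) (nhds z)"
      using assms(1) Suc.prems by (intro eventually_nhds_in_open) (auto intro: finite_imp_closed)
    thus "\<forall>\<^sub>F w in nhds z. (deriv ^^ m) (\<lambda>w. \<Sum>a\<in>A. k a / (w - a)) w =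
            (\<Sum>a\<in>A. k a * ((-1) ^ m * fact m / (w - a) ^ Suc m))"
      by eventually_elim (use Suc.IH in auto)
  qed
  also have "\<dots> = (\<Sum>a\<in>A. k a * ((-1) ^ Suc m * fact (Suc m) / (z - a) ^ Suc (Suc m)))"
  proof (rule DERIV_imp_deriv, rule DERIV_sum)
    fix a assume "a \<in> A"
    hence ne: "z - a \<noteq> 0" using Suc.prems by auto
    have "((\<lambda>z. (z - a) ^ Suc m) has_field_derivative of_nat (Suc m) * (z - a) ^ m) (at z)"
      by (rule derivative_eq_intros refl | simp del: of_nat_Suc power_Suc)+
    from DERIV_inverse_fun[OF this] ne
    have "((\<lambda>z. inverse ((z - a) ^ Suc m)) has_field_derivative
        - (inverse ((z - a) ^ Suc m) * (of_nat (Suc m) * (z - a) ^ m) * inverse ((z - a) ^ Suc m))) (at z)"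
      by (simp add: mult_ac numeral_2_eq_2[symmetric] power2_eq_square del: power_Suc of_nat_Suc)
    from DERIV_cmult[OF this, of "k a * ((-1) ^ m * fact m)"]
    have "((\<lambda>z. k a * ((-1) ^ m * fact m / (z - a) ^ Suc m)) has_field_derivative
         k a * ((-1) ^ m * fact m) *
          (- (inverse ((z - a) ^ Suc m) * (of_nat (Suc m) * (z - a) ^ m) * inverse ((z - a) ^ Suc m)))) (at z)"
      by (simp only: divide_inverse mult.assoc)
    also have "k a * ((-1) ^ m * fact m) *
          (- (inverse ((z - a) ^ Suc m) * (of_nat (Suc m) * (z - a) ^ m) * inverse ((z - a) ^ Suc m)))
        = k a * ((-1) ^ Suc m * fact (Suc m) / (z - a) ^ Suc (Suc m))"
      using ne by (simp add: divide_inverse)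
    finally show "((\<lambda>z. k a * ((-1) ^ m * fact m / (z - a) ^ Suc m)) has_field_derivative
       k a * ((-1) ^ Suc m * fact (Suc m) / (z - a) ^ Suc (Suc m))) (at z)" .
  qed
  finally show ?case .
qed simp

text \<open>
  Apply the expansion to the numerator \<open>g\<close> and the denominator \<open>h\<close> of \<open>f\<close> and subtract. Common zeros of
  \<open>g\<close> and \<open>h\<close> cancel in the multiplicities, but the identity between the logarithmic derivatives is at first
  only available away from them; it extends to all of \<open>V\<close> by continuity.
\<close>

lemma meromorphic_finite_order_logderiv:
  assumes mf: "meromorphic_finite_order f" and V: "open V" "V \<noteq> {}" "f holomorphic_on V"
    and nz: "\<And>w. w \<in> V \<Longrightarrow> f w \<noteq> 0"
  obtains c p where "\<And>R. finite (divisor_support f \<inter> cball c R)"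
    "\<exists>C\<ge>0. \<forall>R\<ge>1. (\<Sum>\<rho>\<in>divisor_support f \<inter> cball c R. \<bar>real_of_int (zorder f \<rho>)\<bar>) \<le> C * R ^ p"
    "\<And>m z. m \<ge> p \<Longrightarrow> z \<in> V \<Longrightarrow>
      (\<lambda>n. \<Sum>\<rho>\<in>divisor_support f \<inter> cball c (real n).
          of_int (zorder f \<rho>) * ((-1) ^ m * fact m / (z - \<rho>) ^ Suc m))
       \<longlonglongrightarrow> (deriv ^^ m) (logderiv f) z"
proof -
  from mf obtain g h where fg: "f nicely_meromorphic_on UNIV" "entire_finite_order g" "entire_finite_order h"
    "\<exists>z. h z \<noteq> 0" "\<And>z. h z \<noteq> 0 \<Longrightarrow> f z = g z / h z"
    unfolding meromorphic_finite_order_def by blast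
  have hol: "g holomorphic_on UNIV" "h holomorphic_on UNIV"
    using fg by (auto simp: entire_finite_order_def)
  obtain z0 where z0: "z0 \<in> V" using V by auto
  obtain zh where zh: "h zh \<noteq> 0" using fg by auto
  have h_ev: "eventually (\<lambda>w. h w \<noteq> 0) (at z)" for z
    using non_zero_neighbour_alt[OF hol(2) open_UNIV connected_UNIV UNIV_I UNIV_I zh, of z] by simp
  \<comment> \<open>The zeros of \<open>g\<close> and of \<open>h\<close> are counted in the same discs, so the centre must avoid both.\<close>
  have "eventually (\<lambda>w. h w \<noteq> 0 \<and> w \<in> V) (at z0)"
    using h_ev[of z0] eventually_at_in_open'[OF V(1) z0] by (rule eventually_conj)
  then obtain c where c: "c \<in> V" "h c \<noteq> 0"
    using eventually_happens' at_neq_bot by blast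
  hence gc: "g c \<noteq> 0" using fg(5)[of c] nz[of c] by auto
  have g_ev: "eventually (\<lambda>w. g w \<noteq> 0) (at z)" for z
    using non_zero_neighbour_alt[OF hol(1) open_UNIV connected_UNIV UNIV_I UNIV_I gc, of z] by simp
  have ana: "g analytic_on {z}" "h analytic_on {z}" for z
    using hol by (auto simp: analytic_on_open holomorphic_on_imp_analytic_at)
  have zo: "zorder f z = zorder g z - zorder h z" for z
  proof -
    have "zorder f z = zorder (\<lambda>z. g z / h z) z"
      by (rule zorder_cong) (use h_ev[of z] fg(5) in \<open>auto elim!: eventually_mono\<close>)
    also have "\<dots> = zorder g z - zorder h z"
      using ana g_ev h_ev at_neq_bot
      by (intro zorder_divide eventually_frequently analytic_on_imp_meromorphic_on) auto
    finally show ?thesis .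
  qed
  have zo0: "zorder g z = 0" if "g z \<noteq> 0" for z using zorder_eq_0I[OF ana(1) that] .
  have zo0': "zorder h z = 0" if "h z \<noteq> 0" for z using zorder_eq_0I[OF ana(2) that] .
  have zge: "zorder g z \<ge> 0" "zorder h z \<ge> 0" for z
    using ana g_ev h_ev at_neq_bot by (auto intro!: zorder_ge_0 eventually_frequently)
  define Z where "Z = (\<lambda>R::real. {a. a \<in> cball c R \<and> g a = 0} \<union> {a. a \<in> cball c R \<and> h a = 0})"
  have finZ: "finite (Z R)" for R
    using finite_zeros_cball[OF hol(1) gc, of c R] finite_zeros_cball[OF hol(2) c(2), of c R] by (auto simp: Z_def)
  define S where "S = (\<lambda>R::real. divisor_support f \<inter> cball c R)"
  have SZ: "S R \<subseteq> Z R" for R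
    using zo zo0 zo0' by (force simp: S_def Z_def divisor_support_def)
  have finS: "finite (S R)" for R using finite_subset[OF SZ finZ] .
  have SV: "S R \<inter> V = {}" for R
    using V nz zorder_eq_0I[of f] holomorphic_on_imp_analytic_at[of f V]
    by (auto simp: S_def divisor_support_def)
  have sum_g: "(\<Sum>a\<in>Z R. F a (zorder g a)) = (\<Sum>a | a \<in> cball c R \<and> g a = 0. F a (zorder g a))"
    if "\<And>a. F a 0 = 0" for R and F :: "complex \<Rightarrow> int \<Rightarrow> 'x::comm_monoid_add"
    using finZ[of R] by (intro sum.mono_neutral_right) (use zo0 that in \<open>force simp: Z_def\<close>)+
  have sum_h: "(\<Sum>a\<in>Z R. F a (zorder h a)) = (\<Sum>a | a \<in> cball c R \<and> h a = 0. F a (zorder h a))"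
    if "\<And>a. F a 0 = 0" for R and F :: "complex \<Rightarrow> int \<Rightarrow> 'x::comm_monoid_add"
    using finZ[of R] by (intro sum.mono_neutral_right) (use zo0' that in \<open>force simp: Z_def\<close>)+
  have sum_f: "(\<Sum>a\<in>Z R. F a (zorder f a)) = (\<Sum>a\<in>S R. F a (zorder f a))"
    if "\<And>a. F a 0 = 0" for R and F :: "complex \<Rightarrow> int \<Rightarrow> 'x::comm_monoid_add"
    using finZ[of R] SZ that by (intro sum.mono_neutral_right) (auto simp: S_def Z_def divisor_support_def)
  obtain B1 p1 where gr1: "B1 \<ge> 0" "exp_power_growth g c B1 p1"
    using entire_finite_order_imp_growth[OF fg(2)] by blast
  obtain B2 p2 where gr2: "B2 \<ge> 0" "exp_power_growth h c B2 p2"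
    using entire_finite_order_imp_growth[OF fg(3)] by blast
  define B where "B = max B1 B2"
  define p where "p = max p1 p2"
  have B: "B \<ge> 0" using gr1 by (simp add: B_def)
  have gr: "exp_power_growth g c B p" "exp_power_growth h c B p"
    using exp_power_growth_mono[OF gr1(2)] exp_power_growth_mono[OF gr2(2)] gr1(1) gr2(1)
    by (auto simp: B_def p_def)
  show ?thesis
  proof (rule that[of c p])
    show "finite (divisor_support f \<inter> cball c R)" for R using finS[of R] by (simp add: S_def)
  next
    obtain C1 where C1: "C1 \<ge> 0"
      "\<And>R. R \<ge> 1 \<Longrightarrow> (\<Sum>a | a \<in> cball c R \<and> g a = 0. real (nat (zorder g a))) \<le> C1 * R ^ p"
      using zero_counting_bound[OF hol(1) gc gr(1)] by blast
    obtain C2 where C2: "C2 \<ge> 0"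
      "\<And>R. R \<ge> 1 \<Longrightarrow> (\<Sum>a | a \<in> cball c R \<and> h a = 0. real (nat (zorder h a))) \<le> C2 * R ^ p"
      using zero_counting_bound[OF hol(2) c(2) gr(2)] by blast
    have "(\<Sum>\<rho>\<in>divisor_support f \<inter> cball c R. \<bar>real_of_int (zorder f \<rho>)\<bar>) \<le> (C1 + C2) * R ^ p" if R: "R \<ge> 1" for R
    proof -
      have "(\<Sum>\<rho>\<in>divisor_support f \<inter> cball c R. \<bar>real_of_int (zorder f \<rho>)\<bar>) = (\<Sum>\<rho>\<in>Z R. \<bar>real_of_int (zorder f \<rho>)\<bar>)"
        using sum_f[of "\<lambda>a n. \<bar>real_of_int n\<bar>" R] by (simp add: S_def)
      also have "\<dots> \<le> (\<Sum>\<rho>\<in>Z R. real (nat (zorder g \<rho>)) + real (nat (zorder h \<rho>)))"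
        using zo zge by (intro sum_mono) (simp add: abs_if)
      also have "\<dots> = (\<Sum>a | a \<in> cball c R \<and> g a = 0. real (nat (zorder g a))) +
                       (\<Sum>a | a \<in> cball c R \<and> h a = 0. real (nat (zorder h a)))"
        using sum_g[of "\<lambda>a n. real (nat n)" R] sum_h[of "\<lambda>a n. real (nat n)" R]
        by (simp add: sum.distrib)
      also have "\<dots> \<le> C1 * R ^ p + C2 * R ^ p" using C1(2)[OF R] C2(2)[OF R] by simp
      finally show ?thesis by (simp add: distrib_right)
    qed
    thus "\<exists>C\<ge>0. \<forall>R\<ge>1. (\<Sum>\<rho>\<in>divisor_support f \<inter> cball c R. \<bar>real_of_int (zorder f \<rho>)\<bar>) \<le> C * R ^ p"
      using C1(1) C2(1) by (intro exI[of _ "C1 + C2"]) auto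
  next
    fix m z assume m: "m \<ge> p" and z: "z \<in> V"
    obtain E1 where E1: "\<And>n. n \<ge> 1 \<Longrightarrow> E1 n holomorphic_on ball c (real n)"
      "\<And>n w. n \<ge> 1 \<Longrightarrow> w \<in> ball c (real n) \<Longrightarrow> g w \<noteq> 0 \<Longrightarrow>
        deriv g w / g w = E1 n w + (\<Sum>a | a \<in> cball c (real n) \<and> g a = 0. of_int (zorder g a) / (w - a))"
      "\<And>m z. m \<ge> p \<Longrightarrow> (\<lambda>n. (deriv ^^ m) (E1 n) z) \<longlonglongrightarrow> 0"
      using entire_logderiv_partial_fractions[OF hol(1) gc gr(1) B] by blast
    obtain E2 where E2: "\<And>n. n \<ge> 1 \<Longrightarrow> E2 n holomorphic_on ball c (real n)"
      "\<And>n w. n \<ge> 1 \<Longrightarrow> w \<in> ball c (real n) \<Longrightarrow> h w \<noteq> 0 \<Longrightarrow>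
        deriv h w / h w = E2 n w + (\<Sum>a | a \<in> cball c (real n) \<and> h a = 0. of_int (zorder h a) / (w - a))"
      "\<And>m z. m \<ge> p \<Longrightarrow> (\<lambda>n. (deriv ^^ m) (E2 n) z) \<longlonglongrightarrow> 0"
      using entire_logderiv_partial_fractions[OF hol(2) c(2) gr(2) B] by blast
    let ?sum = "\<lambda>n. \<Sum>\<rho>\<in>divisor_support f \<inter> cball c (real n).
          of_int (zorder f \<rho>) * ((-1) ^ m * fact m / (z - \<rho>) ^ Suc m)"
    let ?lim = "(deriv ^^ m) (logderiv f) z"
    have ev: "eventually (\<lambda>n. n \<ge> 1 \<and> real n > norm (z - c)) sequentially"
      by (intro eventually_conj eventually_ge_at_top eventually_compose_filterlim[OF eventually_gt_at_top filterlim_real_sequentially])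
    have eq: "?lim - ((deriv ^^ m) (E1 n) z - (deriv ^^ m) (E2 n) z) = ?sum n"
      if n: "n \<ge> 1 \<and> real n > norm (z - c)" for n
    proof -
      define W where "W = V \<inter> ball c (real n)"
      define P where "P = (\<lambda>w. \<Sum>a\<in>S n. of_int (zorder f a) / (w - a))"
      define G where "G = (\<lambda>w. (E1 n w - E2 n w) + P w)"
      have W: "open W" "z \<in> W" using V z n by (auto simp: W_def dist_norm norm_minus_commute)
      have hE: "E1 n holomorphic_on W" "E2 n holomorphic_on W"
        using E1(1)[of n] E2(1)[of n] n by (auto simp: W_def intro: holomorphic_on_subset)
      have hP: "P holomorphic_on W" unfolding P_def
        using SV[of n] by (intro holomorphic_intros) (auto simp: W_def)
      have hG: "G holomorphic_on W" unfolding G_def using hE hP by (intro holomorphic_intros)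
      have hf: "f holomorphic_on W" using V by (auto simp: W_def intro: holomorphic_on_subset)
      have hL: "(logderiv f) holomorphic_on W"
        using hf W nz by (intro holomorphic_intros) (auto simp: W_def)
      have eq1: "deriv f w / f w = G w" if w: "w \<in> W" "g w \<noteq> 0" "h w \<noteq> 0" for w
      proof -
        have op: "eventually (\<lambda>u. u \<in> h -` (- {0})) (nhds w)"
          using w by (intro eventually_nhds_in_open open_vimage holomorphic_on_imp_continuous_on hol) auto
        have "deriv f w = deriv (\<lambda>u. g u / h u) w"
          by (rule deriv_cong_ev[OF _ refl]) (use op fg(5) in \<open>auto elim!: eventually_mono\<close>)
        also have "\<dots> = (deriv g w * h w - g w * deriv h w) / (h w)\<^sup>2"
          using ana[of w] w by (intro deriv_divide) (auto simp: analytic_on_imp_differentiable_at)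
        finally have "deriv f w / f w = (deriv g w * h w - g w * deriv h w) / (h w)\<^sup>2 / (g w / h w)"
          using fg(5)[of w] w by simp
        also have "\<dots> = deriv g w / g w - deriv h w / h w"
          using w by (simp add: divide_simps power2_eq_square)
        also have "\<dots> = E1 n w - E2 n w + ((\<Sum>a\<in>Z n. of_int (zorder g a) / (w - a)) - (\<Sum>a\<in>Z n. of_int (zorder h a) / (w - a)))"
          using E1(2)[of n w] E2(2)[of n w] w n sum_g[of "\<lambda>a n. of_int n / (w - a)" n] sum_h[of "\<lambda>a n. of_int n / (w - a)" n]
          by (simp add: W_def)
        also have "(\<Sum>a\<in>Z n. of_int (zorder g a) / (w - a)) - (\<Sum>a\<in>Z n. of_int (zorder h a) / (w - a)) = P w"
          using sum_f[of "\<lambda>a n. of_int n / (w - a)" n] unfolding P_def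
          by (simp add: zo sum_subtractf diff_divide_distrib)
        finally show ?thesis by (simp add: G_def)
      qed
      have eq2: "deriv f w / f w = G w" if w: "w \<in> W" for w
      proof (rule tendsto_unique[OF at_neq_bot])
        show "(logderiv f) \<midarrow>w\<rightarrow> deriv f w / f w"
          using hL W w by (meson continuous_on_eq_continuous_at holomorphic_on_imp_continuous_on isContD)
        have "G \<midarrow>w\<rightarrow> G w"
          using hG W w by (meson continuous_on_eq_continuous_at holomorphic_on_imp_continuous_on isContD)
        thus "(logderiv f) \<midarrow>w\<rightarrow> G w"
        proof (rule Lim_transform_eventually)
          show "eventually (\<lambda>u. G u = deriv f u / f u) (at w)"
            using g_ev[of w] h_ev[of w] eventually_at_in_open'[OF W(1) w]
            by eventually_elim (use eq1 in auto)
        qed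
      qed
      have "?lim = (deriv ^^ m) G z"
        by (rule higher_deriv_transform_within_open[OF hL hG W eq2])
      also have "\<dots> = (deriv ^^ m) (\<lambda>w. E1 n w - E2 n w) z + (deriv ^^ m) P z"
        unfolding G_def using hE hP W by (intro higher_deriv_add) (auto intro!: holomorphic_intros)
      also have "(deriv ^^ m) (\<lambda>w. E1 n w - E2 n w) z = (deriv ^^ m) (E1 n) z - (deriv ^^ m) (E2 n) z"
        using hE W by (intro higher_deriv_diff) auto
      also have "(deriv ^^ m) P z = ?sum n"
      proof -
        have "z \<notin> S n" using SV[of n] z by auto
        from higher_deriv_partial_fractions[OF finS this] show ?thesis unfolding P_def S_def .
      qed
      finally show ?thesis by simp
    qed
    have "(\<lambda>n. ?lim - ((deriv ^^ m) (E1 n) z - (deriv ^^ m) (E2 n) z)) \<longlonglongrightarrow> ?lim - (0 - 0)"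
      by (intro tendsto_intros E1(3) E2(3) m)
    hence "(\<lambda>n. ?lim - ((deriv ^^ m) (E1 n) z - (deriv ^^ m) (E2 n) z)) \<longlonglongrightarrow> ?lim" by simp
    thus "?sum \<longlonglongrightarrow> ?lim"
      by (rule Lim_transform_eventually) (rule eventually_mono[OF ev eq])
  qed
qed

section \<open>Existence of the convergence exponent\<close>

text \<open>
  The annulus between the radii \<open>j\<close> and \<open>j + 1\<close> has weight at most \<open>C (j + 1)\<^sup>p\<close>, hence contributes at most
  \<open>C / (j + 1)\<^sup>2\<close>.
\<close>

lemma summable_weights_of_counting_bound:
  fixes w :: "complex \<Rightarrow> real"
  assumes w: "\<And>x. w x \<ge> 0" and fin: "\<And>R. finite (S \<inter> cball c R)"
    and cnt: "\<And>R. R \<ge> 1 \<Longrightarrow> (\<Sum>x\<in>S \<inter> cball c R. w x) \<le> C * R ^ p"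
  shows "(\<lambda>x. w x / (1 + norm (x - c)) ^ (p + 2)) summable_on S"
proof (rule nonneg_bdd_above_summable_on)
  define v where "v = (\<lambda>x. w x / (1 + norm (x - c)) ^ (p + 2))"
  define k where "k = (\<lambda>x::complex. nat \<lfloor>norm (x - c)\<rfloor>)"
  have C: "C \<ge> 0"
    using cnt[of 1] sum_nonneg[of "S \<inter> cball c 1" w] w by simp
  have sm: "summable (\<lambda>j. C * inverse (real (Suc j) ^ 2))"
    by (intro summable_mult summable_Suc_iff[THEN iffD2] inverse_power_summable) auto
  have shell: "(\<Sum>x\<in>{x\<in>F. k x = j}. v x) \<le> C * inverse (real (Suc j) ^ 2)"
    if F: "finite F" "F \<subseteq> S" for F j
  proof -
    have k_le: "real (k x) \<le> norm (x - c)" "norm (x - c) \<le> 1 + real (k x)" for x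
      unfolding k_def by (auto simp: add.commute[of 1])
    have "(\<Sum>x\<in>{x\<in>F. k x = j}. v x) \<le> (\<Sum>x\<in>{x\<in>F. k x = j}. w x / real (Suc j) ^ (p + 2))"
      unfolding v_def using k_le w
      by (intro sum_mono frac_le power_mono order_refl zero_less_power) auto
    also have "\<dots> = (\<Sum>x\<in>{x\<in>F. k x = j}. w x) / real (Suc j) ^ (p + 2)"
      by (simp add: sum_divide_distrib)
    also have "(\<Sum>x\<in>{x\<in>F. k x = j}. w x) \<le> (\<Sum>x\<in>S \<inter> cball c (real (Suc j)). w x)"
      using F fin w k_le by (intro sum_mono2) (auto simp: dist_norm norm_minus_commute)
    also have "\<dots> \<le> C * real (Suc j) ^ p" by (rule cnt) simp
    also have "C * real (Suc j) ^ p / real (Suc j) ^ (p + 2) = C * inverse (real (Suc j) ^ 2)"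
      by (simp add: power_add field_simps power2_eq_square del: of_nat_Suc)
    finally show ?thesis by (simp add: divide_right_mono del: of_nat_Suc)
  qed
  show "bdd_above (sum (\<lambda>x. w x / (1 + norm (x - c)) ^ (p + 2)) ` {F. F \<subseteq> S \<and> finite F})"
  proof (rule bdd_aboveI2)
    fix F assume F: "F \<in> {F. F \<subseteq> S \<and> finite F}"
    have "sum v F = (\<Sum>j\<in>k ` F. \<Sum>x\<in>{x\<in>F. k x = j}. v x)"
      using F by (intro sum.image_gen) auto
    also have "\<dots> \<le> (\<Sum>j\<in>k ` F. C * inverse (real (Suc j) ^ 2))"
      using F by (intro sum_mono shell) auto
    also have "\<dots> \<le> (\<Sum>j. C * inverse (real (Suc j) ^ 2))"
      using F sm C by (intro sum_le_suminf) auto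
    finally show "sum (\<lambda>x. w x / (1 + norm (x - c)) ^ (p + 2)) F \<le> (\<Sum>j. C * inverse (real (Suc j) ^ 2))"
      by (simp add: v_def)
  qed
qed (use w in auto)

text \<open>
  Far from \<open>b\<close> and \<open>c\<close> the quantities \<open>|x - b|\<close> and \<open>K + |x - c|\<close> are comparable, and only finitely many
  points are not far. The lemma serves both to replace \<open>1 + |\<rho> - c|\<close> by \<open>|\<rho>|\<close> and to move the origin to
  \<open>\<sigma>\<^sub>1\<close>.
\<close>

lemma summable_weights_change_centre:
  fixes w :: "complex \<Rightarrow> real"
  assumes w: "\<And>x. w x \<ge> 0" and fin: "\<And>R. finite (S \<inter> cball c R)"
    and sm: "(\<lambda>x. w x / u x) summable_on S - T"
    and T: "finite T" and u: "\<And>x. x \<in> S - T \<Longrightarrow> 0 < u x" "\<And>x. u x \<le> (K + norm (x - c)) ^ d" and K: "K \<ge> 0"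
  shows "(\<lambda>x. w x / norm (x - b) ^ d) summable_on S - {b}"
proof -
  define R where "R = K + 2 * norm (c - b)"
  define B where "B = (S \<inter> cball c R) \<union> T"
  have finB: "finite B" using fin T by (simp add: B_def)
  have "(\<lambda>x. 2 ^ d * (w x / u x)) summable_on S - T"
    using sm by (rule summable_on_cmult_right)
  hence "(\<lambda>x. 2 ^ d * (w x / u x)) summable_on S - {b} - B"
    by (rule summable_on_subset_banach) (auto simp: B_def)
  hence "(\<lambda>x. w x / norm (x - b) ^ d) summable_on S - {b} - B"
  proof (rule summable_on_comparison_test)
    fix x assume x: "x \<in> S - {b} - B"
    have xR: "norm (x - c) > R" using x by (auto simp: B_def dist_norm norm_minus_commute)
    have "norm (x - c) \<le> norm (x - b) + norm (c - b)"
      using norm_triangle_ineq4[of "x - b" "c - b"] by simp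
    hence "K + norm (x - c) \<le> 2 * norm (x - b)" using xR by (simp add: R_def)
    hence "(K + norm (x - c)) ^ d \<le> (2 * norm (x - b)) ^ d" using K by (intro power_mono) auto
    hence "u x \<le> 2 ^ d * norm (x - b) ^ d" using u(2)[of x] by (simp add: power_mult_distrib)
    moreover have "u x > 0" using u(1) x by (auto simp: B_def)
    moreover have "norm (x - b) > 0" using x by auto
    ultimately show "w x / norm (x - b) ^ d \<le> 2 ^ d * (w x / u x)"
      using mult_right_mono[of "u x" "2 ^ d * norm (x - b) ^ d" "w x"] w[of x] by (simp add: field_simps)
  qed (use w in auto)
  moreover have "(\<lambda>x. w x / norm (x - b) ^ d) summable_on (S - {b}) \<inter> B"
    using finB by (intro summable_on_finite) auto
  ultimately have "(\<lambda>x. w x / norm (x - b) ^ d) summable_on (S - {b} - B) \<union> ((S - {b}) \<inter> B)"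
    by (intro summable_on_Un_disjoint) auto
  moreover have "(S - {b} - B) \<union> ((S - {b}) \<inter> B) = S - {b}" by auto
  ultimately show ?thesis by simp
qed

text \<open>
  The counting bound shows that some exponent works at the origin, so the least one does. Moving
  the centre to \<open>b\<close> keeps the exponent.
\<close>

lemma divisor_summable_convergence_exponent:
  assumes fin: "\<And>R. finite (divisor_support f \<inter> cball c R)"
    and cnt: "\<exists>C\<ge>0. \<forall>R\<ge>1. (\<Sum>\<rho>\<in>divisor_support f \<inter> cball c R. \<bar>real_of_int (zorder f \<rho>)\<bar>) \<le> C * R ^ p"
  shows "(\<lambda>\<rho>. \<bar>real_of_int (zorder f \<rho>)\<bar> / norm (\<rho> - b) ^ convergence_exponent f)
           summable_on (divisor_support f - {b})"
proof -
  define w where "w = (\<lambda>\<rho>. \<bar>real_of_int (zorder f \<rho>)\<bar>)"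
  define S where "S = divisor_support f"
  define d where "d = convergence_exponent f"
  have fin': "finite (S \<inter> cball c R)" for R using fin by (simp add: S_def)
  obtain C where C: "\<And>R. R \<ge> 1 \<Longrightarrow> (\<Sum>\<rho>\<in>S \<inter> cball c R. w \<rho>) \<le> C * R ^ p"
    using cnt unfolding w_def S_def by blast
  have w0: "w x \<ge> 0" for x by (simp add: w_def)
  have "(\<lambda>x. w x / (1 + norm (x - c)) ^ (p + 2)) summable_on S - {}"
    using summable_weights_of_counting_bound[OF w0 fin' C] by simp
  hence "(\<lambda>x. w x / norm (x - 0) ^ (p + 2)) summable_on S - {0}"
    by (rule summable_weights_change_centre[OF w0 fin', where K = 1])
       (auto intro!: zero_less_power add_pos_nonneg simp del: power_Suc)
  hence "(\<lambda>\<rho>. w \<rho> / norm \<rho> ^ d) summable_on S - {0}"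
    using LeastI[of "\<lambda>d. (\<lambda>\<rho>. w \<rho> / norm \<rho> ^ d) summable_on S - {0}" "p + 2"]
    unfolding d_def convergence_exponent_def w_def S_def by simp
  hence "(\<lambda>x. w x / norm (x - b) ^ d) summable_on S - {b}"
  proof (rule summable_weights_change_centre[OF w0 fin', where K = "norm c"])
    show "norm x ^ d \<le> (norm c + norm (x - c)) ^ d" for x
      using norm_triangle_ineq[of c "x - c"] by (intro power_mono) auto
  qed auto
  thus ?thesis by (simp add: w_def S_def d_def)
qed

section \<open>The multinomial theorem for infinite families\<close>

definition multinomial_term :: "(nat \<Rightarrow> 'a::real_normed_field) \<Rightarrow> (nat \<Rightarrow> nat) \<Rightarrow> 'a" where
  "multinomial_term y k = fact (weight k) / (\<Prod>n\<in>supp k. fact (k n)) * (\<Prod>n\<in>supp k. y n ^ k n)"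

definition multi_indices :: "nat set \<Rightarrow> nat \<Rightarrow> (nat \<Rightarrow> nat) set" where
  "multi_indices I j = {k. finite (supp k) \<and> supp k \<subseteq> I \<and> weight k = j}"

lemma weight_superset: "finite A \<Longrightarrow> supp k \<subseteq> A \<Longrightarrow> weight k = (\<Sum>n\<in>A. k n)"
  unfolding weight_def supp_def by (intro sum.mono_neutral_left) auto

lemma multinomial_term_superset:
  assumes "finite A" "supp k \<subseteq> A"
  shows "multinomial_term y k = fact (\<Sum>n\<in>A. k n) / (\<Prod>n\<in>A. fact (k n)) * (\<Prod>n\<in>A. y n ^ k n)"
proof -
  have "(\<Prod>n\<in>supp k. fact (k n)) = (\<Prod>n\<in>A. fact (k n) :: 'a)"
    using assms by (intro prod.mono_neutral_left) (auto simp: supp_def)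
  moreover have "(\<Prod>n\<in>supp k. y n ^ k n) = (\<Prod>n\<in>A. y n ^ k n)"
    using assms by (intro prod.mono_neutral_left) (auto simp: supp_def)
  ultimately show ?thesis
    unfolding multinomial_term_def using weight_superset[OF assms] by simp
qed

text \<open>
  The recursion behind the multinomial theorem, read from the smaller multi-index to the larger one.
\<close>

lemma multinomial_term_incr:
  assumes "finite (supp k)"
  shows "of_nat (Suc (k n)) * multinomial_term y (k(n := Suc (k n)))
           = of_nat (Suc (weight k)) * y n * multinomial_term y k"
proof -
  define A where "A = insert n (supp k)"
  have A: "finite A" "supp k \<subseteq> A" "supp (k(n := Suc (k n))) \<subseteq> A" "n \<in> A"
    using assms by (auto simp: A_def supp_def)
  have s0: "(\<Sum>i\<in>A - {n}. (k(n := Suc (k n))) i) = (\<Sum>i\<in>A - {n}. k i)" by (intro sum.cong) auto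
  have s: "(\<Sum>i\<in>A. (k(n := Suc (k n))) i) = Suc (\<Sum>i\<in>A. k i)"
    by (simp only: sum.remove[OF A(1,4)] s0 fun_upd_same add_Suc)
  have pf0: "(\<Prod>i\<in>A - {n}. fact ((k(n := Suc (k n))) i)) = (\<Prod>i\<in>A - {n}. fact (k i) :: 'a)"
    by (intro prod.cong) auto
  have pf: "(\<Prod>i\<in>A. fact ((k(n := Suc (k n))) i)) = of_nat (Suc (k n)) * (\<Prod>i\<in>A. fact (k i) :: 'a)"
    by (simp only: prod.remove[OF A(1,4)] pf0 fun_upd_same) (simp add: mult_ac)
  have py0: "(\<Prod>i\<in>A - {n}. y i ^ (k(n := Suc (k n))) i) = (\<Prod>i\<in>A - {n}. y i ^ k i)"
    by (intro prod.cong) auto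
  have py: "(\<Prod>i\<in>A. y i ^ (k(n := Suc (k n))) i) = y n * (\<Prod>i\<in>A. y i ^ k i)"
    by (simp only: prod.remove[OF A(1,4)] py0 fun_upd_same power_Suc mult_ac)
  have w: "weight k = (\<Sum>i\<in>A. k i)" by (rule weight_superset[OF A(1,2)])
  have ne: "(of_nat (Suc (k n)) :: 'a) \<noteq> 0" by (simp del: of_nat_Suc)
  show ?thesis
    unfolding multinomial_term_superset[OF A(1,2)] multinomial_term_superset[OF A(1,3)] s pf py w
    using ne by (simp add: fact_Suc divide_simps del: of_nat_Suc)
qed

lemma norm_multinomial_term:
  "norm (multinomial_term y k) = multinomial_term (\<lambda>n. norm (y n)) k"
  unfolding multinomial_term_def
  by (simp add: norm_mult norm_divide norm_power prod_norm[symmetric])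

lemma weight_incr: "finite (supp k) \<Longrightarrow> weight (k(n := Suc (k n))) = Suc (weight k)"
proof -
  assume f: "finite (supp k)"
  have A: "finite (insert n (supp k))" "supp k \<subseteq> insert n (supp k)"
     "supp (k(n := Suc (k n))) \<subseteq> insert n (supp k)" "n \<in> insert n (supp k)" using f by (auto simp: supp_def)
  have "(\<Sum>i\<in>insert n (supp k) - {n}. (k(n := Suc (k n))) i) = (\<Sum>i\<in>insert n (supp k) - {n}. k i)"
    by (intro sum.cong) auto
  thus ?thesis unfolding weight_superset[OF A(1,2)] weight_superset[OF A(1,3)] sum.remove[OF A(1,4)]
    by simp
qed

text \<open>
  Adding 1 at the position \<open>n\<close> produces a multi-index with a marked point of its support, from which the
  original multi-index can be recovered; marking turns the recursion into a regrouping of a double sum.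
\<close>

lemma multi_indices_Suc_bij:
  "bij_betw (\<lambda>(n, k). (k(n := Suc (k n)), n)) (I \<times> multi_indices I j) (Sigma (multi_indices I (Suc j)) supp)"
proof (rule bij_betw_byWitness[where f' = "\<lambda>(k, n). (n, k(n := k n - 1))"])
  show "(\<lambda>(n, k). (k(n := Suc (k n)), n)) ` (I \<times> multi_indices I j) \<subseteq> Sigma (multi_indices I (Suc j)) supp"
  proof safe
    fix n k assume *: "n \<in> I" "k \<in> multi_indices I j"
    have "supp (k(n := Suc (k n))) = insert n (supp k)" by (auto simp: supp_def)
    thus "k(n := Suc (k n)) \<in> multi_indices I (Suc j)" "n \<in> supp (k(n := Suc (k n)))"
      using * by (auto simp: multi_indices_def weight_incr)
  qed
  show "(\<lambda>(k, n). (n, k(n := k n - 1))) ` Sigma (multi_indices I (Suc j)) supp \<subseteq> I \<times> multi_indices I j"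
  proof safe
    fix k n assume *: "k \<in> multi_indices I (Suc j)" "n \<in> supp k"
    thus "n \<in> I" by (auto simp: multi_indices_def)
    define k' where "k' = k(n := k n - 1)"
    have sub: "supp k' \<subseteq> supp k" by (auto simp: k'_def supp_def)
    have fin: "finite (supp k')" using * sub finite_subset by (auto simp: multi_indices_def)
    have "k = k'(n := Suc (k' n))" using * by (auto simp: k'_def supp_def)
    hence "weight k = Suc (weight k')" using weight_incr[OF fin, of n] by simp
    hence "k' \<in> multi_indices I j"
      using * sub fin by (auto simp: multi_indices_def)
    thus "k(n := k n - 1) \<in> multi_indices I j" by (simp only: k'_def)
  qed
qed (auto simp: supp_def)

lemma multi_indices_0: "multi_indices I 0 = {\<lambda>_. 0}"
  by (auto simp: multi_indices_def supp_def weight_def)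

text \<open>
  Expand \<open>Z \<cdot> Z\<^sup>j\<close> as a double sum and regroup it along \<open>multi_indices_Suc_bij\<close>. The fibre over \<open>k\<close> is
  finite, and its terms are the fractions \<open>k n / (j + 1)\<close> of the term of index \<open>k\<close>, which add up to it.
\<close>

lemma has_sum_multinomial_Suc:
  fixes z :: "nat \<Rightarrow> 'b::{real_normed_field,banach}"
  assumes z: "(z has_sum Z) I" and IH: "(multinomial_term z has_sum Z ^ j) (multi_indices I j)"
    and sm: "(\<lambda>(n, k). z n * multinomial_term z k) summable_on I \<times> multi_indices I j"
  shows "(multinomial_term z has_sum Z ^ Suc j) (multi_indices I (Suc j))"
proof -
  have "((\<lambda>(n, k). z n * multinomial_term z k) has_sum (Z * Z ^ j)) (I \<times> multi_indices I j)"
  proof (rule has_sum_SigmaI[where g = "\<lambda>n. z n * Z ^ j"])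
    show "((\<lambda>k. case (n, k) of (n, k) \<Rightarrow> z n * multinomial_term z k) has_sum z n * Z ^ j) (multi_indices I j)" for n
      using has_sum_cmult_right[OF IH] by simp
    show "((\<lambda>n. z n * Z ^ j) has_sum Z * Z ^ j) I"
      using has_sum_cmult_left[OF z] by simp
  qed (use sm in simp)
  moreover have "z n * multinomial_term z k
      = multinomial_term z (k(n := Suc (k n))) * (of_nat ((k(n := Suc (k n))) n) / of_nat (Suc j))"
    if "k \<in> multi_indices I j" for n k
    using multinomial_term_incr[of k n z] that
    by (simp add: multi_indices_def field_simps del: of_nat_Suc)
  ultimately have "((\<lambda>(n, k). (\<lambda>(k', n). multinomial_term z k' * (of_nat (k' n) / of_nat (Suc j)))
       (k(n := Suc (k n)), n)) has_sum (Z * Z ^ j)) (I \<times> multi_indices I j)"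
    by (subst has_sum_cong[where g = "\<lambda>(n, k). z n * multinomial_term z k"]) auto
  hence "((\<lambda>(k', n). multinomial_term z k' * (of_nat (k' n) / of_nat (Suc j))) has_sum (Z * Z ^ j))
           (Sigma (multi_indices I (Suc j)) supp)"
    using has_sum_reindex_bij_betw[OF multi_indices_Suc_bij[of I j],
       of "\<lambda>(k', n). multinomial_term z k' * (of_nat (k' n) / of_nat (Suc j))"] by (simp add: case_prod_unfold)
  hence "(multinomial_term z has_sum (Z * Z ^ j)) (multi_indices I (Suc j))"
  proof (rule has_sum_SigmaD)
    fix k assume k: "k \<in> multi_indices I (Suc j)"
    have "(\<Sum>n\<in>supp k. multinomial_term z k * (of_nat (k n) / of_nat (Suc j))) =
           multinomial_term z k * (of_nat (weight k) / of_nat (Suc j))"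
      by (simp add: weight_def sum_distrib_left sum_divide_distrib del: of_nat_Suc)
    also have "\<dots> = multinomial_term z k"
      using k by (simp add: multi_indices_def del: of_nat_Suc)
    finally show "((\<lambda>n. case (k, n) of (k', n) \<Rightarrow> multinomial_term z k' * (of_nat (k' n) / of_nat (Suc j)))
        has_sum multinomial_term z k) (supp k)"
      using k by (intro has_sum_finiteI) (auto simp: multi_indices_def)
  qed
  thus ?thesis by simp
qed

lemma has_sum_multinomial_0: "(multinomial_term z has_sum Z ^ 0) (multi_indices I 0)"
  by (rule has_sum_finiteI) (auto simp: multi_indices_0 multinomial_term_def supp_def weight_def)

text \<open>
  The sum over the norms is carried along in the induction, since it gives the absolute convergence
  that the regrouping of the double sum requires.
\<close>

lemma has_sum_multinomial:
  fixes y :: "nat \<Rightarrow> complex"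
  assumes y: "(y has_sum Y) I" and ny: "((\<lambda>n. norm (y n)) has_sum Y') I"
  shows "(multinomial_term y has_sum Y ^ j) (multi_indices I j)"
    and "(multinomial_term (\<lambda>n. norm (y n)) has_sum Y' ^ j) (multi_indices I j)"
proof -
  have "(multinomial_term y has_sum Y ^ j) (multi_indices I j) \<and>
        (multinomial_term (\<lambda>n. norm (y n)) has_sum Y' ^ j) (multi_indices I j)"
  proof (induction j)
    case 0
    show ?case by (intro conjI has_sum_multinomial_0)
  next
    case (Suc j)
    have nn: "multinomial_term (\<lambda>n. norm (y n)) k \<ge> 0" for k
      by (simp flip: norm_multinomial_term)
    have sm: "(\<lambda>(n, k). norm (y n) * multinomial_term (\<lambda>n. norm (y n)) k) summable_on I \<times> multi_indices I j"
    proof (rule summable_on_SigmaI[where g = "\<lambda>n. norm (y n) * Y' ^ j"])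
      show "((\<lambda>k. case (n, k) of (n, k) \<Rightarrow> norm (y n) * multinomial_term (\<lambda>n. norm (y n)) k) has_sum
              norm (y n) * Y' ^ j) (multi_indices I j)" for n
        using has_sum_cmult_right[OF conjunct2[OF Suc.IH]] by simp
      show "(\<lambda>n. norm (y n) * Y' ^ j) summable_on I"
        using has_sum_cmult_left[OF ny] by (auto simp: summable_on_def)
    qed (use nn in auto)
    hence "(\<lambda>x. norm (case x of (n, k) \<Rightarrow> y n * multinomial_term y k)) summable_on I \<times> multi_indices I j"
      by (simp add: case_prod_unfold norm_mult norm_multinomial_term)
    hence "(\<lambda>(n, k). y n * multinomial_term y k) summable_on I \<times> multi_indices I j"
      by (rule abs_summable_summable)
    with sm show ?case using has_sum_multinomial_Suc[OF y] has_sum_multinomial_Suc[OF ny] Suc.IH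
      by (intro conjI) auto
  qed
  thus "(multinomial_term y has_sum Y ^ j) (multi_indices I j)"
    "(multinomial_term (\<lambda>n. norm (y n)) has_sum Y' ^ j) (multi_indices I j)" by auto
qed

section \<open>Expansion of the logarithm and general Dirichlet series\<close>

lemma Lambda_eq: "Lambda N = (\<Union>j\<in>{1..}. multi_indices (indices N) j)"
proof -
  have "weight k = 0 \<longleftrightarrow> supp k = {}" if "finite (supp k)" for k
    unfolding weight_def sum_eq_0_iff[OF that] by (auto simp: supp_def)
  hence "weight k \<ge> 1 \<longleftrightarrow> supp k \<noteq> {}" if "finite (supp k)" for k
    using that by (metis One_nat_def Suc_le_eq neq0_conv)
  thus ?thesis by (auto simp: Lambda_def multi_indices_def)
qed

text \<open>
  Group the multi-indices by weight: those of weight \<open>j\<close> contribute \<open>(-Y)\<^sup>j / j\<close>.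
\<close>

lemma log_multinomial_expansion:
  fixes y :: "nat \<Rightarrow> complex"
  assumes y: "(y has_sum Y) (indices N)" and ny: "((\<lambda>n. norm (y n)) has_sum Y') (indices N)" and Y': "Y' < 1"
  shows "((\<lambda>k. (-1) ^ weight k / of_nat (weight k) * multinomial_term y k) has_sum - ln (1 + Y)) (Lambda N)"
    and "(\<lambda>k. norm ((-1) ^ weight k / of_nat (weight k) * multinomial_term y k)) summable_on Lambda N"
proof -
  define M where "M = multi_indices (indices N)"
  have wM: "weight k = j" if "k \<in> M j" for k j using that by (simp add: M_def multi_indices_def)
  define h where "h = (\<lambda>k. (-1) ^ weight k / of_nat (weight k) * multinomial_term y k)"
  have bij: "bij_betw snd (Sigma {1..} M) (Lambda N)"
    unfolding Lambda_eq M_def[symmetric] by (auto simp: bij_betw_def inj_on_def image_iff dest: wM)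
  have Y'0: "Y' \<ge> 0" using ny by (rule has_sum_nonneg) auto
  have nY: "norm Y \<le> Y'" using norm_has_sum_bound[OF ny y] .
  have sm: "(\<lambda>p. norm (h (snd p))) summable_on Sigma {1..} M"
  proof (rule summable_on_SigmaI[where g = "\<lambda>j. Y' ^ j / real j"])
    fix j :: nat assume j: "j \<in> {1..}"
    have "((\<lambda>k. 1 / real j * multinomial_term (\<lambda>n. norm (y n)) k) has_sum (1 / real j * Y' ^ j)) (M j)"
      unfolding M_def by (intro has_sum_cmult_right has_sum_multinomial(2)[OF y ny])
    thus "((\<lambda>k. norm (h (snd (j, k)))) has_sum Y' ^ j / real j) (M j)"
      by (subst has_sum_cong[where g = "\<lambda>k. 1 / real j * multinomial_term (\<lambda>n. norm (y n)) k"])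
         (auto simp: h_def norm_mult norm_divide norm_power norm_multinomial_term dest: wM)
  next
    have "summable (\<lambda>j. Y' ^ j)" using Y' Y'0 by (intro summable_geometric) auto
    hence "(\<lambda>j. Y' ^ j) summable_on UNIV"
      using Y'0 by (intro norm_summable_imp_summable_on) auto
    hence "(\<lambda>j. Y' ^ j) summable_on {1..}" by (rule summable_on_subset_banach) auto
    thus "(\<lambda>j. Y' ^ j / real j) summable_on {1..}"
      by (rule summable_on_comparison_test) (use Y'0 in \<open>auto simp: divide_le_eq mult_le_cancel_left1\<close>)
  qed auto
  show "(\<lambda>k. norm ((-1) ^ weight k / of_nat (weight k) * multinomial_term y k)) summable_on Lambda N"
    using summable_on_reindex_bij_betw[OF bij, of "\<lambda>k. norm (h k)"] sm by (simp add: h_def)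
  have "((\<lambda>p. h (snd p)) has_sum - ln (1 + Y)) (Sigma {1..} M)"
  proof (rule has_sum_SigmaI[where g = "\<lambda>j. (-Y) ^ j / of_nat j"])
    fix j :: nat
    have "((\<lambda>k. (-1) ^ j / of_nat j * multinomial_term y k) has_sum ((-1) ^ j / of_nat j * Y ^ j)) (M j)"
      unfolding M_def by (intro has_sum_cmult_right has_sum_multinomial(1)[OF y ny])
    moreover have "(-1) ^ j / of_nat j * Y ^ j = (-Y) ^ j / of_nat j"
      by (simp add: power_minus[of Y])
    ultimately show "((\<lambda>k. h (snd (j, k))) has_sum (-Y) ^ j / of_nat j) (M j)"
      by (subst has_sum_cong[where g = "\<lambda>k. (-1) ^ j / of_nat j * multinomial_term y k"])
         (auto simp: h_def dest: wM)
  next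
    have nY1: "norm Y < 1" using nY Y' by simp
    have "(\<lambda>j. - (- ((-Y) ^ j) / of_nat j)) sums - ln (1 + Y)"
      by (intro sums_minus Ln_series' nY1)
    hence s: "(\<lambda>j. (-Y) ^ j / of_nat j) sums - ln (1 + Y)" by simp
    have "summable (\<lambda>j. norm ((-Y) ^ j / of_nat j))"
    proof (rule summable_comparison_test')
      show "summable (\<lambda>j. norm Y ^ j)" using nY1 by (intro summable_geometric) auto
      show "norm (norm ((-Y) ^ j / of_nat j)) \<le> norm Y ^ j" if "j \<ge> 1" for j
        using that by (simp add: norm_divide norm_power divide_le_eq mult_le_cancel_left1)
    qed
    hence "((\<lambda>j. (-Y) ^ j / of_nat j) has_sum - ln (1 + Y)) UNIV"
      using s by (rule norm_summable_imp_has_sum)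
    thus "((\<lambda>j. (-Y) ^ j / of_nat j) has_sum - ln (1 + Y)) {1..}"
      by (subst has_sum_cong_neutral[where T = UNIV and g = "\<lambda>j. (-Y) ^ j / of_nat j"])
         (auto simp: not_le)
  next
    show "(\<lambda>p. h (snd p)) summable_on Sigma {1..} M"
      using sm by (rule abs_summable_summable)
  qed
  thus "((\<lambda>k. (-1) ^ weight k / of_nat (weight k) * multinomial_term y k) has_sum - ln (1 + Y)) (Lambda N)"
    using has_sum_reindex_bij_betw[OF bij, of h "- ln (1 + Y)"] by (simp add: h_def)
qed

lemma log_coeff_mult_exp:
  "log_coeff a k * exp (- (of_real (pairing l k) * s)) =
     (-1) ^ weight k / of_nat (weight k) * multinomial_term (\<lambda>n. a n * exp (- (of_real (l n) * s))) k"
proof -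
  have "exp (- (of_real (pairing l k) * s)) = (\<Prod>n\<in>supp k. exp (- (of_real (l n) * s)) ^ k n)"
  proof (cases "finite (supp k)")
    case True
    have "- (of_real (pairing l k) * s) = (\<Sum>n\<in>supp k. of_nat (k n) * (- (of_real (l n) * s)))"
      by (simp add: pairing_def sum_distrib_left sum_negf mult_ac)
    thus ?thesis using True by (simp only: exp_sum exp_of_nat_mult)
  qed (simp add: pairing_def)
  thus ?thesis
    by (simp add: log_coeff_def multinomial_term_def power_mult_distrib prod.distrib mult_ac)
qed

text \<open>
  A single term of the exponential series is at most its sum.
\<close>

lemma power_mult_exp_neg_bound:
  fixes x \<delta> :: real
  assumes "x \<ge> 0" "\<delta> > 0"
  shows "x ^ m * exp (- \<delta> * x) \<le> fact m / \<delta> ^ m"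
proof -
  have "(\<delta> * x) ^ m / fact m \<le> exp (\<delta> * x)"
  proof -
    have s: "(\<lambda>n. (\<delta> * x) ^ n /\<^sub>R fact n) sums exp (\<delta> * x)" by (rule exp_converges)
    have "(\<Sum>n\<in>{m}. (\<delta> * x) ^ n /\<^sub>R fact n) \<le> (\<Sum>n. (\<delta> * x) ^ n /\<^sub>R fact n)"
      using assms s by (intro sum_le_suminf) (auto simp: sums_iff)
    thus ?thesis using s by (simp add: sums_iff field_simps)
  qed
  thus ?thesis using assms by (simp add: exp_minus field_simps power_mult_distrib)
qed

lemma general_dirichlet_summable_power:
  fixes x :: "'k \<Rightarrow> real" and \<beta> :: "'k \<Rightarrow> complex"
  assumes x: "\<And>k. k \<in> A \<Longrightarrow> x k \<ge> 0" and sm: "(\<lambda>k. norm (\<beta> k) * exp (- x k * s1)) summable_on A" and s: "s > s1"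
  shows "(\<lambda>k. norm (\<beta> k) * x k ^ m * exp (- x k * s)) summable_on A"
proof -
  have "(\<lambda>k. fact m / (s - s1) ^ m * (norm (\<beta> k) * exp (- x k * s1))) summable_on A"
    using sm by (rule summable_on_cmult_right)
  thus ?thesis
  proof (rule summable_on_comparison_test)
    fix k assume k: "k \<in> A"
    have "x k ^ m * exp (- (s - s1) * x k) \<le> fact m / (s - s1) ^ m"
      using x[OF k] s by (intro power_mult_exp_neg_bound) auto
    hence "x k ^ m * exp (- (s - s1) * x k) * (norm (\<beta> k) * exp (- x k * s1)) \<le>
            fact m / (s - s1) ^ m * (norm (\<beta> k) * exp (- x k * s1))"
      by (rule mult_right_mono) auto
    also have "x k ^ m * exp (- (s - s1) * x k) * (norm (\<beta> k) * exp (- x k * s1)) =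
       norm (\<beta> k) * x k ^ m * (exp (- (s - s1) * x k) * exp (- x k * s1))" by (simp only: mult_ac)
    also have "exp (- (s - s1) * x k) * exp (- x k * s1) = exp (- x k * s)"
      by (simp add: exp_add[symmetric] algebra_simps)
    finally show "norm (\<beta> k) * x k ^ m * exp (- x k * s) \<le> fact m / (s - s1) ^ m * (norm (\<beta> k) * exp (- x k * s1))" .
  qed (use x in auto)
qed

text \<open>
  The partial sums over finite sets converge uniformly on the half-plane, so their derivatives
  converge to the derivatives of the sum; for finite sums the derivatives are explicit.
\<close>

lemma general_dirichlet_higher_deriv:
  fixes x :: "'k \<Rightarrow> real" and \<beta> :: "'k \<Rightarrow> complex"
  assumes x: "\<And>k. k \<in> A \<Longrightarrow> x k \<ge> 0" and sm: "(\<lambda>k. norm (\<beta> k) * exp (- x k * s1)) summable_on A"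
    and H: "\<And>s. Re s > s1 \<Longrightarrow> ((\<lambda>k. \<beta> k * exp (- (of_real (x k) * s))) has_sum H s) A"
  shows "H holomorphic_on {s. Re s > s1}"
    and "Re s > s1 \<Longrightarrow> ((\<lambda>k. \<beta> k * (- of_real (x k)) ^ m * exp (- (of_real (x k) * s))) has_sum (deriv ^^ m) H s) A"
proof -
  define V where "V = {s. Re s > s1}"
  have V: "open V" by (simp add: V_def open_halfspace_Re_gt)
  have ul: "uniform_limit V (\<lambda>X s. \<Sum>k\<in>X. \<beta> k * exp (- (of_real (x k) * s))) H (finite_subsets_at_top A)"
  proof (rule Weierstrass_m_test_general'[OF _ _ sm])
    fix k s assume *: "k \<in> A" "s \<in> V"
    have "x k * s1 \<le> x k * Re s" using x[OF *(1)] * by (intro mult_left_mono) (auto simp: V_def)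
    thus "norm (\<beta> k * exp (- (of_real (x k) * s))) \<le> norm (\<beta> k) * exp (- x k * s1)"
      by (simp add: norm_mult mult_left_mono)
  qed (use H in \<open>auto simp: V_def\<close>)
  have hol: "(\<lambda>s. \<Sum>k\<in>X. \<beta> k * exp (- (of_real (x k) * s))) holomorphic_on W" for X W
    by (intro holomorphic_intros)
  show "H holomorphic_on {s. Re s > s1}"
    unfolding V_def[symmetric]
  proof (subst holomorphic_on_open[OF V], safe)
    fix z assume "z \<in> V"
    then obtain r where r: "r > 0" "cball z r \<subseteq> V" using V by (meson open_contains_cball)
    have "H holomorphic_on ball z r"
    proof (rule holomorphic_uniform_limit)
      show "uniform_limit (cball z r) (\<lambda>X s. \<Sum>k\<in>X. \<beta> k * exp (- (of_real (x k) * s))) H (finite_subsets_at_top A)"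
        by (rule uniform_limit_on_subset[OF ul r(2)])
      show "\<forall>\<^sub>F X in finite_subsets_at_top A. continuous_on (cball z r) (\<lambda>s. \<Sum>k\<in>X. \<beta> k * exp (- (of_real (x k) * s)))
            \<and> (\<lambda>s. \<Sum>k\<in>X. \<beta> k * exp (- (of_real (x k) * s))) holomorphic_on ball z r"
        using hol by (intro always_eventually allI conjI holomorphic_on_imp_continuous_on)
    qed auto
    thus "\<exists>f'. (H has_field_derivative f') (at z)"
      using r(1) by (auto simp: holomorphic_on_open)
  qed
  have mono: "(deriv ^^ m) (\<lambda>s. \<Sum>k\<in>X. \<beta> k * exp (- (of_real (x k) * s)))
      = (\<lambda>s. \<Sum>k\<in>X. \<beta> k * (- of_real (x k)) ^ m * exp (- (of_real (x k) * s)))" for X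
  proof (induction m)
    case (Suc m)
    show ?case unfolding funpow.simps o_def Suc.IH
      by (rule ext, rule DERIV_imp_deriv) (rule derivative_eq_intros refl | simp add: mult_ac)+
  qed simp
  assume s: "Re s > s1"
  have "((\<lambda>X. (deriv ^^ m) (\<lambda>s. \<Sum>k\<in>X. \<beta> k * exp (- (of_real (x k) * s))) s) \<longlongrightarrow> (deriv ^^ m) H s)
          (finite_subsets_at_top A)"
    by (rule higher_deriv_complex_uniform_limit[OF ul]) (use V s hol in \<open>auto simp: V_def\<close>)
  thus "((\<lambda>k. \<beta> k * (- of_real (x k)) ^ m * exp (- (of_real (x k) * s))) has_sum (deriv ^^ m) H s) A"
    unfolding mono has_sum_def by simp
qed

section \<open>The logarithmic derivative as a Dirichlet series\<close>

lemma pairing_nonneg: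
  assumes "frequencies N l" "k \<in> Lambda N"
  shows "pairing l k \<ge> 0"
  using assms unfolding pairing_def frequencies_def Lambda_def
  by (intro sum_nonneg mult_nonneg_nonneg) (auto intro: less_imp_le)

lemma frequencies_lower_bound:
  assumes "frequencies N l"
  obtains \<delta> where "\<delta> > 0" "\<And>n. n \<in> indices N \<Longrightarrow> l n \<ge> \<delta>"
proof (cases "indices N = {}")
  case True
  thus ?thesis using that[of 1] by auto
next
  case False
  hence 1: "1 \<in> indices N"
    unfolding indices_def by (auto simp: one_enat_def) (meson enat_ord_simps(1) order_trans)
  show ?thesis
  proof (rule that[of "l 1"])
    show "l 1 > 0" using assms 1 by (auto simp: frequencies_def)
    fix n assume n: "n \<in> indices N"
    show "l n \<ge> l 1"
    proof (cases "n = 1")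
      case False
      hence "1 < n" using n by (auto simp: indices_def)
      moreover have "strict_mono_on (indices N) l" using assms by (simp add: frequencies_def)
      ultimately have "l 1 < l n" using 1 n by (auto simp: strict_mono_on_def)
      thus ?thesis by simp
    qed simp
  qed
qed

lemma pairing_lower_bound:
  assumes fr: "frequencies N l" and k: "k \<in> Lambda N" and \<delta>: "\<And>n. n \<in> indices N \<Longrightarrow> l n \<ge> \<delta>"
  shows "pairing l k \<ge> \<delta>"
proof -
  obtain n where n: "n \<in> supp k" "n \<in> indices N" "finite (supp k)" "supp k \<subseteq> indices N"
    using k by (auto simp: Lambda_def)
  have ln: "l i > 0" if "i \<in> indices N" for i using fr that by (auto simp: frequencies_def)
  have "1 \<le> real (k n)" using n by (auto simp: supp_def)
  hence "l n * 1 \<le> l n * real (k n)" using ln[OF n(2)] by (intro mult_left_mono) auto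
  also have "l n * real (k n) \<le> pairing l k"
    unfolding pairing_def
  proof (rule member_le_sum)
    show "0 \<le> l i * real (k i)" if "i \<in> supp k - {n}" for i
      using that n ln[of i] by (intro mult_nonneg_nonneg) auto
  qed (use n in auto)
  finally show ?thesis using \<delta>[OF n(2)] by simp
qed

text \<open>
  The abscissa \<open>s1\<close> is chosen so far to the right that \<open>\<Sum> |a n| e\<^bsup>-\<lambda>\<^sub>n s\<^esup> < 1\<close> from there on; a shift by \<open>s1 - \<sigma>\<close>
  gains at least the factor \<open>exp (- \<delta> (s1 - \<sigma>))\<close>, where \<open>\<delta>\<close> is a lower bound of the frequencies.
\<close>

lemma dirichlet_logderiv_expansion:
  assumes fr: "frequencies N l"
    and sm: "(\<lambda>n. norm (a n) * exp (- l n * \<sigma>)) summable_on indices N"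
    and f: "\<And>s. Re s > \<sigma> \<Longrightarrow> f s = dirichlet_series N l a s"
  obtains s1 where "f holomorphic_on {s. Re s > s1}" "\<And>s. Re s > s1 \<Longrightarrow> f s \<noteq> 0"
    "\<And>m s. Re s > s1 \<Longrightarrow>
       ((\<lambda>k. of_real (pairing l k) * log_coeff a k * (of_real (pairing l k) ^ m * exp (- (of_real (pairing l k) * s))))
          has_sum (-1) ^ m * (deriv ^^ m) (logderiv f) s) (Lambda N)"
    "\<And>m s. s > s1 \<Longrightarrow> (\<lambda>k. norm (log_coeff a k) * pairing l k ^ m * exp (- pairing l k * s)) summable_on Lambda N"
proof -
  obtain \<delta> where \<delta>: "\<delta> > 0" "\<And>n. n \<in> indices N \<Longrightarrow> l n \<ge> \<delta>"
    using frequencies_lower_bound[OF fr] by blast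
  define S0 where "S0 = (\<Sum>\<^sub>\<infinity>n\<in>indices N. norm (a n) * exp (- l n * \<sigma>))"
  have S0: "S0 \<ge> 0" unfolding S0_def by (intro infsum_nonneg) auto
  \<comment> \<open>The shift by \<open>(1 + S0) / \<delta>\<close> gains the factor \<open>q = exp (- (1 + S0))\<close>, which is less than \<open>1 / S0\<close>.\<close>
  define s1 where "s1 = \<sigma> + (1 + S0) / \<delta>"
  have s1: "s1 > \<sigma>" using \<delta>(1) S0 by (simp add: s1_def)
  define q where "q = exp (- (1 + S0))"
  have "S0 < exp (1 + S0)" using exp_ge_add_one_self[of "1 + S0"] by linarith
  hence q: "q * S0 < 1" unfolding q_def exp_minus by (simp add: field_simps)
  define y where "y = (\<lambda>s n. a n * exp (- (of_real (l n) * s)))"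
  have y_le: "norm (y s n) \<le> q * (norm (a n) * exp (- l n * \<sigma>))"
    if "Re s \<ge> s1" "n \<in> indices N" for s n
  proof -
    have "1 + S0 = \<delta> * (s1 - \<sigma>)" using \<delta>(1) by (simp add: s1_def)
    also have "\<dots> \<le> l n * (Re s - \<sigma>)"
      using \<delta>(1) \<delta>(2)[OF that(2)] that s1 by (intro mult_mono) auto
    finally have "exp (- l n * Re s) \<le> exp (- (1 + S0) + - l n * \<sigma>)"
      by (simp add: algebra_simps)
    also have "\<dots> = q * exp (- l n * \<sigma>)" by (simp only: exp_add q_def)
    finally have "norm (a n) * exp (- l n * Re s) \<le> norm (a n) * (q * exp (- l n * \<sigma>))"
      by (intro mult_left_mono) auto
    thus ?thesis by (simp add: y_def norm_mult mult_ac)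
  qed
  have hs0: "((\<lambda>n. q * (norm (a n) * exp (- l n * \<sigma>))) has_sum q * S0) (indices N)"
    unfolding S0_def using sm by (intro has_sum_cmult_right has_sum_infsum)
  define H where "H = (\<lambda>s. - ln (f s))"
  have main: "f s \<noteq> 0 \<and> ((\<lambda>k. log_coeff a k * exp (- (of_real (pairing l k) * s))) has_sum H s) (Lambda N) \<and>
       (\<lambda>k. norm (log_coeff a k * exp (- (of_real (pairing l k) * s)))) summable_on Lambda N"
    if s: "Re s \<ge> s1" for s
  proof -
    have sn: "(\<lambda>n. norm (y s n)) summable_on indices N"
      using has_sum_imp_summable[OF hs0] by (rule summable_on_comparison_test) (use y_le[OF s] in auto)
    then obtain Y' where Y': "((\<lambda>n. norm (y s n)) has_sum Y') (indices N)" by (auto simp: summable_on_def)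
    have "Y' \<le> q * S0" using Y' hs0 by (rule has_sum_mono) (use y_le[OF s] in auto)
    hence Y'1: "Y' < 1" using q by simp
    define Y where "Y = (\<Sum>\<^sub>\<infinity>n\<in>indices N. y s n)"
    have Y: "(y s has_sum Y) (indices N)" unfolding Y_def
      using abs_summable_summable[OF sn] by (rule has_sum_infsum)
    have fY: "f s = 1 + Y" using f[of s] s s1 by (simp add: dirichlet_series_def Y_def y_def)
    have "norm Y < 1" using norm_has_sum_bound[OF Y' Y] Y'1 by simp
    hence "f s \<noteq> 0" unfolding fY by (metis add_eq_0_iff norm_minus_cancel norm_one less_irrefl)
    thus ?thesis
      using log_multinomial_expansion[OF Y Y' Y'1] unfolding log_coeff_mult_exp H_def fY y_def by simp
  qed
  have x: "pairing l k \<ge> 0" if "k \<in> Lambda N" for k using pairing_nonneg[OF fr that] .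
  have nexp: "norm (exp (- (of_real (pairing l k) * of_real s1 :: complex))) = exp (- pairing l k * s1)" for k
    by simp
  have sm1: "(\<lambda>k. norm (log_coeff a k) * exp (- pairing l k * s1)) summable_on Lambda N"
    using conjunct2[OF conjunct2[OF main[of "of_real s1"]]] unfolding norm_mult nexp by simp
  have hH: "((\<lambda>k. log_coeff a k * exp (- (of_real (pairing l k) * s))) has_sum H s) (Lambda N)"
    if "Re s > s1" for s using main[of s] that by auto
  note H = general_dirichlet_higher_deriv[OF x sm1 hH]
  define V where "V = {s. Re s > s1}"
  have V: "open V" by (simp add: V_def open_halfspace_Re_gt)
  have H_hol: "H holomorphic_on V" unfolding V_def by (rule H(1))
  have fH: "f s = exp (- H s)" if "s \<in> V" for s
    using main[of s] that by (simp add: H_def V_def)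
  have f_hol: "f holomorphic_on V"
  proof (rule holomorphic_transform)
    show "(\<lambda>s. exp (- H s)) holomorphic_on V" using H_hol by (intro holomorphic_intros)
  qed (use fH in auto)
  have ld: "deriv f s / f s = - deriv H s" if "s \<in> V" for s
  proof -
    have "(H has_field_derivative deriv H s) (at s)" using H_hol V that by (auto intro: holomorphic_derivI)
    hence "((\<lambda>s. exp (- H s)) has_field_derivative exp (- H s) * - deriv H s) (at s)"
      by (auto intro!: derivative_eq_intros)
    hence "(f has_field_derivative exp (- H s) * - deriv H s) (at s)"
      by (rule has_field_derivative_transform_within_open[OF _ V that]) (use fH in auto)
    hence "deriv f s = exp (- H s) * - deriv H s" by (rule DERIV_imp_deriv)
    thus ?thesis using fH[OF that] by simp
  qed
  show ?thesis
  proof (rule that[of s1])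
    show "f holomorphic_on {s. Re s > s1}" using f_hol by (simp add: V_def)
    show "f s \<noteq> 0" if "Re s > s1" for s using main[of s] that by auto
    show "(\<lambda>k. norm (log_coeff a k) * pairing l k ^ m * exp (- pairing l k * s)) summable_on Lambda N"
      if "s > s1" for m s using general_dirichlet_summable_power[OF x sm1 that] .
    fix m s assume s: "Re s > s1"
    hence sV: "s \<in> V" by (simp add: V_def)
    have "(deriv ^^ m) (logderiv f) s = (deriv ^^ m) (\<lambda>w. - deriv H w) s"
      by (rule higher_deriv_cong_ev[OF _ refl])
         (use ld eventually_nhds_in_open[OF V sV] in \<open>auto elim!: eventually_mono\<close>)
    also have "\<dots> = - (deriv ^^ m) (deriv H) s"
      using H_hol V sV by (intro higher_deriv_uminus[of _ V]) (auto intro: holomorphic_intros)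
    also have "(deriv ^^ m) (deriv H) s = (deriv ^^ Suc m) H s" by (simp add: funpow_swap1)
    finally have e: "(-1) ^ m * (deriv ^^ m) (logderiv f) s = (-1) ^ Suc m * (deriv ^^ Suc m) H s"
      by simp
    have "((\<lambda>k. (-1) ^ Suc m * (log_coeff a k * (- of_real (pairing l k)) ^ Suc m * exp (- (of_real (pairing l k) * s))))
             has_sum (-1) ^ Suc m * (deriv ^^ Suc m) H s) (Lambda N)"
      by (intro has_sum_cmult_right H(2) s)
    also have "(\<lambda>k. (-1) ^ Suc m * (log_coeff a k * (- of_real (pairing l k)) ^ Suc m * exp (- (of_real (pairing l k) * s))))
       = (\<lambda>k. of_real (pairing l k) * log_coeff a k * (of_real (pairing l k) ^ m * exp (- (of_real (pairing l k) * s))))"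
    proof
      fix k
      have P: "(-1) ^ Suc m * (- of_real (pairing l k)) ^ Suc m = (of_real (pairing l k) ^ Suc m :: complex)"
        by (metis mult_minus1 minus_minus power_mult_distrib)
      have "(-1) ^ Suc m * (log_coeff a k * (- of_real (pairing l k)) ^ Suc m * exp (- (of_real (pairing l k) * s)))
        = ((-1) ^ Suc m * (- of_real (pairing l k)) ^ Suc m) * (log_coeff a k * exp (- (of_real (pairing l k) * s)))"
        by (simp only: mult_ac)
      also have "\<dots> = of_real (pairing l k) * log_coeff a k * (of_real (pairing l k) ^ m * exp (- (of_real (pairing l k) * s)))"
        unfolding P by (simp only: power_Suc mult_ac)
      finally show "(-1) ^ Suc m * (log_coeff a k * (- of_real (pairing l k)) ^ Suc m * exp (- (of_real (pairing l k) * s)))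
        = of_real (pairing l k) * log_coeff a k * (of_real (pairing l k) ^ m * exp (- (of_real (pairing l k) * s)))" .
    qed
    finally show "((\<lambda>k. of_real (pairing l k) * log_coeff a k * (of_real (pairing l k) ^ m * exp (- (of_real (pairing l k) * s))))
          has_sum (-1) ^ m * (deriv ^^ m) (logderiv f) s) (Lambda N)"
      unfolding e .
  qed
qed

section \<open>Smooth functions on the real line\<close>

lemma tderiv_eqI: "(\<And>t. (u has_vector_derivative u' t) (at t)) \<Longrightarrow> tderiv u = u'"
  unfolding tderiv_def by (rule ext, rule vector_derivative_at)

lemma smooth_fun_has_vector_derivative:
  assumes "smooth_fun u"
  shows "((tderiv ^^ n) u has_vector_derivative (tderiv ^^ Suc n) u t) (at t)"
  using assms vector_derivative_works[of "(tderiv ^^ n) u" "at t"]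
  by (simp add: smooth_fun_def tderiv_def)

lemma smooth_fun_derivatives:
  assumes "\<And>n t. (D n has_vector_derivative D (Suc n) t) (at t)"
  shows "smooth_fun (D 0)" "(tderiv ^^ n) (D 0) = D n"
proof -
  have *: "(tderiv ^^ n) (D 0) = D n" for n
    by (induction n) (simp_all add: tderiv_eqI[OF assms])
  show "(tderiv ^^ n) (D 0) = D n" by (rule *)
  show "smooth_fun (D 0)"
    unfolding smooth_fun_def * using assms by (blast intro: differentiableI_vector)
qed

lemma smooth_fun_tderiv: "smooth_fun u \<Longrightarrow> smooth_fun (tderiv u)"
  unfolding smooth_fun_def by (metis funpow_Suc_right o_apply)

lemma smooth_fun_continuous: "smooth_fun u \<Longrightarrow> continuous_on A ((tderiv ^^ n) u)"
  unfolding smooth_fun_def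
  by (meson continuous_at_imp_continuous_on differentiable_imp_continuous_within)

text \<open>
  Smoothness without formulas for the derivatives: the function lies in a class of differentiable
  functions that is closed under differentiation.
\<close>

lemma smooth_fun_invariantI:
  assumes "P u" "\<And>v t. P v \<Longrightarrow> v differentiable (at t)" "\<And>v. P v \<Longrightarrow> P (tderiv v)"
  shows "smooth_fun u"
proof -
  have "P ((tderiv ^^ n) u)" for n by (induction n) (simp_all add: assms)
  thus ?thesis using assms(2) by (simp add: smooth_fun_def)
qed

lemma smooth_fun_add:
  assumes "smooth_fun u" "smooth_fun v"
  shows "smooth_fun (\<lambda>t. u t + v t)"
    "(tderiv ^^ n) (\<lambda>t. u t + v t) = (\<lambda>t. (tderiv ^^ n) u t + (tderiv ^^ n) v t)"
  using smooth_fun_derivatives[of "\<lambda>n t. (tderiv ^^ n) u t + (tderiv ^^ n) v t", OF has_vector_derivative_add[OF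
      smooth_fun_has_vector_derivative[OF assms(1)] smooth_fun_has_vector_derivative[OF assms(2)]]]
  by simp_all

lemma smooth_fun_cmult:
  assumes "smooth_fun u"
  shows "smooth_fun (\<lambda>t. c * u t)" "(tderiv ^^ n) (\<lambda>t. c * u t) = (\<lambda>t. c * (tderiv ^^ n) u t)"
  using smooth_fun_derivatives[of "\<lambda>n t. c * (tderiv ^^ n) u t",
      OF has_vector_derivative_mult_right[OF smooth_fun_has_vector_derivative[OF assms]]]
  by simp_all

lemma smooth_fun_diff:
  assumes "smooth_fun u" "smooth_fun v"
  shows "smooth_fun (\<lambda>t. u t - v t)"
    "(tderiv ^^ n) (\<lambda>t. u t - v t) = (\<lambda>t. (tderiv ^^ n) u t - (tderiv ^^ n) v t)"
  using smooth_fun_derivatives[of "\<lambda>n t. (tderiv ^^ n) u t - (tderiv ^^ n) v t", OF has_vector_derivative_diff[OF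
      smooth_fun_has_vector_derivative[OF assms(1)] smooth_fun_has_vector_derivative[OF assms(2)]]]
  by simp_all

lemma smooth_fun_sum:
  assumes "\<And>i. i \<in> A \<Longrightarrow> smooth_fun (u i)"
  shows "smooth_fun (\<lambda>t. \<Sum>i\<in>A. u i t)"
    "(tderiv ^^ n) (\<lambda>t. \<Sum>i\<in>A. u i t) = (\<lambda>t. \<Sum>i\<in>A. (tderiv ^^ n) (u i) t)"
  using smooth_fun_derivatives[of "\<lambda>n t. \<Sum>i\<in>A. (tderiv ^^ n) (u i) t",
      OF has_vector_derivative_sum[OF smooth_fun_has_vector_derivative[OF assms]]]
  by simp_all

lemma has_vector_derivative_exp_linear:
  "((\<lambda>t. exp (z * of_real t)) has_vector_derivative z * exp (z * of_real t)) (at t)" for z :: complex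
proof -
  have "((\<lambda>w. exp (z * w)) has_field_derivative z * exp (z * of_real t)) (at (of_real t))"
    by (auto intro!: derivative_eq_intros)
  thus ?thesis by (rule has_vector_derivative_real_field)
qed

lemma smooth_fun_exp:
  shows "smooth_fun (\<lambda>t. exp (z * of_real t))"
    "(tderiv ^^ n) (\<lambda>t. exp (z * of_real t)) = (\<lambda>t. z ^ n * exp (z * of_real t))"
proof -
  have "((\<lambda>t. z ^ n * exp (z * of_real t)) has_vector_derivative z ^ Suc n * exp (z * of_real t)) (at t)" for n t
    using has_vector_derivative_mult_right[OF has_vector_derivative_exp_linear, of "z ^ n" z t] by (simp add: mult_ac)
  from smooth_fun_derivatives[of "\<lambda>n t. z ^ n * exp (z * of_real t)", OF this]
  show "smooth_fun (\<lambda>t. exp (z * of_real t))"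
    "(tderiv ^^ n) (\<lambda>t. exp (z * of_real t)) = (\<lambda>t. z ^ n * exp (z * of_real t))" by simp_all
qed

lemma smooth_fun_times_ident:
  assumes "smooth_fun v"
  shows "smooth_fun (\<lambda>t. of_real t * v t)"
    "(tderiv ^^ n) (\<lambda>t. of_real t * v t) =
       (\<lambda>t. of_real t * (tderiv ^^ n) v t + of_nat n * (tderiv ^^ (n - 1)) v t)"
proof -
  define D where "D = (\<lambda>n t. of_real t * (tderiv ^^ n) v t + of_nat n * (tderiv ^^ (n - 1)) v t)"
  have "(D n has_vector_derivative D (Suc n) t) (at t)" for n t
  proof -
    have of: "(of_real has_vector_derivative (1::complex)) (at t)"
      using has_vector_derivative_of_real[OF DERIV_ident] by simp
    have 1: "((\<lambda>t. of_real t * (tderiv ^^ n) v t) has_vector_derivative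
             of_real t * (tderiv ^^ Suc n) v t + 1 * (tderiv ^^ n) v t) (at t)"
      by (rule has_vector_derivative_mult[OF of smooth_fun_has_vector_derivative[OF assms]])
    have 2: "((\<lambda>t. of_nat n * (tderiv ^^ (n - 1)) v t) has_vector_derivative of_nat n * (tderiv ^^ n) v t) (at t)"
      using has_vector_derivative_mult_right[OF smooth_fun_has_vector_derivative[OF assms, of "n - 1"], of "of_nat n"]
      by (cases n) auto
    show ?thesis using has_vector_derivative_add[OF 1 2] unfolding D_def by (simp add: algebra_simps)
  qed
  from smooth_fun_derivatives[of D, OF this]
  show "smooth_fun (\<lambda>t. of_real t * v t)"
    "(tderiv ^^ n) (\<lambda>t. of_real t * v t) =
       (\<lambda>t. of_real t * (tderiv ^^ n) v t + of_nat n * (tderiv ^^ (n - 1)) v t)" by (simp_all add: D_def)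
qed

text \<open>
  The class to which \<open>smooth_fun_invariantI\<close> is applied for products: sums of products of smooth functions.
\<close>

inductive product_span :: "(real \<Rightarrow> complex) \<Rightarrow> bool" where
  product: "smooth_fun u \<Longrightarrow> smooth_fun v \<Longrightarrow> product_span (\<lambda>t. u t * v t)"
| sum: "product_span u \<Longrightarrow> product_span v \<Longrightarrow> product_span (\<lambda>t. u t + v t)"

lemma smooth_fun_mult:
  assumes "smooth_fun u" "smooth_fun v"
  shows "smooth_fun (\<lambda>t. u t * v t)"
proof -
  have *: "(\<forall>t. w differentiable (at t)) \<and> product_span (tderiv w)" if "product_span w" for w
    using that
  proof induction
    case (product u v)
    have D: "((\<lambda>t. u t * v t) has_vector_derivative u t * tderiv v t + tderiv u t * v t) (at t)" for t
      using has_vector_derivative_mult[OF smooth_fun_has_vector_derivative[OF product(1), of 0 t]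
          smooth_fun_has_vector_derivative[OF product(2), of 0 t]] by simp
    show ?case unfolding tderiv_eqI[OF D]
      using D product by (auto intro!: product_span.intros smooth_fun_tderiv intro: differentiableI_vector)
  next
    case (sum u v)
    have D: "((\<lambda>t. u t + v t) has_vector_derivative tderiv u t + tderiv v t) (at t)" for t
      using sum.IH vector_derivative_works unfolding tderiv_def by (intro has_vector_derivative_add) blast+
    show ?case unfolding tderiv_eqI[OF D]
      using D sum by (auto intro!: product_span.intros intro: differentiableI_vector)
  qed
  show ?thesis
    by (rule smooth_fun_invariantI[where P = product_span]) (use * assms in \<open>auto intro: product_span.intros\<close>)
qed

text \<open>
  The class to which \<open>smooth_fun_invariantI\<close> is applied for quotients by powers of \<open>t\<close>. The numerators vanish
  on a neighbourhood of 0, so that the singularity there is harmless.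
\<close>

inductive quotient_span :: "real \<Rightarrow> (real \<Rightarrow> complex) \<Rightarrow> bool" for a :: real where
  quotient: "smooth_fun u \<Longrightarrow> (\<And>t. t < a \<Longrightarrow> u t = 0) \<Longrightarrow> quotient_span a (\<lambda>t. c * u t / of_real t ^ j)"
| sum: "quotient_span a u \<Longrightarrow> quotient_span a v \<Longrightarrow> quotient_span a (\<lambda>t. u t + v t)"

lemma has_vector_derivative_zero_left:
  assumes "\<And>t. t < a \<Longrightarrow> u t = (0::complex)" "t < a"
  shows "(u has_vector_derivative 0) (at t)"
  by (rule has_vector_derivative_transform_within_open[of "\<lambda>_. 0" _ _ "{..<a}"]) (use assms in auto)

lemma smooth_fun_divide_power:
  assumes u: "smooth_fun u" "\<And>t. t < a \<Longrightarrow> u t = 0" and a: "a > 0"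
  shows "smooth_fun (\<lambda>t. u t / of_real t ^ j)"
proof -
  have *: "(\<forall>t. w differentiable (at t)) \<and> quotient_span a (tderiv w)" if "quotient_span a w" for w
    using that
  proof induction
    case (quotient u c j)
    have u'0: "tderiv u t = 0" if "t < a" for t
      unfolding tderiv_def
      by (rule vector_derivative_at[OF has_vector_derivative_zero_left]) (use quotient that in auto)
    have D: "((\<lambda>t. c * u t / of_real t ^ j) has_vector_derivative
       c * tderiv u t / of_real t ^ j + (- c * of_nat j) * u t / of_real t ^ Suc j) (at t)" for t
    proof (cases "t < a")
      case True
      have "((\<lambda>t. c * u t / of_real t ^ j) has_vector_derivative 0) (at t)"
        by (rule has_vector_derivative_zero_left[OF _ True]) (simp add: quotient)
      thus ?thesis using True quotient u'0[OF True] by simp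
    next
      case False
      hence t: "t \<noteq> 0" using a by auto
      have "((\<lambda>w. inverse (w ^ j)) has_field_derivative
            - (inverse (of_real t ^ j) * (of_nat j * of_real t ^ (j - 1)) * inverse (of_real t ^ j))) (at (complex_of_real t))"
        using t by (auto intro!: derivative_eq_intros)
      from has_vector_derivative_real_field[OF this]
      have i: "((\<lambda>t. inverse (of_real t ^ j)) has_vector_derivative
         - (inverse (of_real t ^ j) * (of_nat j * of_real t ^ (j - 1)) * inverse (complex_of_real t ^ j))) (at t)" by simp
      have u: "((\<lambda>t. c * u t) has_vector_derivative c * tderiv u t) (at t)"
        using has_vector_derivative_mult_right[OF smooth_fun_has_vector_derivative[OF quotient(1), of 0 t], of c] by simp
      have e: "inverse (of_real t ^ j) * (of_nat j * of_real t ^ (j - 1)) * inverse (complex_of_real t ^ j)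
            = of_nat j * inverse (of_real t ^ Suc j)"
        using t by (cases j) (simp_all add: divide_simps)
      show ?thesis
        using has_vector_derivative_mult[OF u i] unfolding e by (simp add: divide_inverse algebra_simps)
    qed
    show ?case unfolding tderiv_eqI[OF D]
    proof (intro conjI allI quotient_span.intros smooth_fun_tderiv)
      show "(\<lambda>t. c * u t / of_real t ^ j) differentiable at t" for t using D by (rule differentiableI_vector)
    qed (use quotient u'0 in auto)
  next
    case (sum u v)
    have D: "((\<lambda>t. u t + v t) has_vector_derivative tderiv u t + tderiv v t) (at t)" for t
      using sum.IH vector_derivative_works unfolding tderiv_def by (intro has_vector_derivative_add) blast+
    show ?case unfolding tderiv_eqI[OF D]
      using D sum by (auto intro!: quotient_span.intros intro: differentiableI_vector)
  qed
  show ?thesis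
  proof (rule smooth_fun_invariantI[where P = "quotient_span a"])
    show "quotient_span a (\<lambda>t. u t / of_real t ^ j)"
      using quotient_span.quotient[of u a 1 j] u by simp
  qed (use * in auto)
qed

lemma smooth_fun_power_mult:
  assumes "smooth_fun v"
  shows "smooth_fun (\<lambda>t. of_real t ^ M * v t)"
  using assms
proof (induction M)
  case (Suc M)
  show ?case using smooth_fun_times_ident(1)[OF Suc.IH[OF Suc.prems]] by (simp add: mult_ac)
qed simp

text \<open>
  Each factor \<open>t\<close> costs a factor \<open>t + d\<close>, since \<open>(t w)\<^bsup>(i)\<^esup> = t w\<^bsup>(i)\<^esup> + i w\<^bsup>(i-1)\<^esup>\<close> with \<open>i \<le> d\<close>.
\<close>

lemma tderiv_power_mult_bound:
  assumes v: "smooth_fun v" and bd: "\<And>i. i \<le> d \<Longrightarrow> norm ((tderiv ^^ i) v t) \<le> B" and t: "t \<ge> 0" and i: "i \<le> d"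
  shows "norm ((tderiv ^^ i) (\<lambda>t. of_real t ^ M * v t) t) \<le> B * (t + real d) ^ M"
  using i
proof (induction M arbitrary: i)
  case 0
  thus ?case using bd by simp
next
  case (Suc M)
  define w where "w = (\<lambda>t. of_real t ^ M * v t)"
  have w: "smooth_fun w" unfolding w_def by (rule smooth_fun_power_mult[OF v])
  have eq: "(\<lambda>t. of_real t ^ Suc M * v t) = (\<lambda>t. of_real t * w t)" by (simp add: w_def mult_ac)
  have "norm ((tderiv ^^ i) (\<lambda>t. of_real t ^ Suc M * v t) t) \<le>
          norm (of_real t * (tderiv ^^ i) w t) + norm (of_nat i * (tderiv ^^ (i - 1)) w t)"
    unfolding eq smooth_fun_times_ident(2)[OF w] by (rule norm_triangle_ineq)
  also have "\<dots> \<le> t * (B * (t + real d) ^ M) + real d * (B * (t + real d) ^ M)"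
    unfolding norm_mult using Suc.prems t Suc.IH[of i] Suc.IH[of "i - 1"]
    by (intro add_mono mult_mono) (auto simp: w_def)
  finally show ?case by (simp add: algebra_simps)
qed

lemma tderiv_power_mult_at_0:
  assumes v: "smooth_fun v" and i: "i < M"
  shows "(tderiv ^^ i) (\<lambda>t. of_real t ^ M * v t) 0 = 0"
  using i
proof (induction M arbitrary: i)
  case (Suc M)
  define w where "w = (\<lambda>t. of_real t ^ M * v t)"
  have w: "smooth_fun w" unfolding w_def by (rule smooth_fun_power_mult[OF v])
  have eq: "(\<lambda>t. of_real t ^ Suc M * v t) = (\<lambda>t. of_real t * w t)" by (simp add: w_def mult_ac)
  show ?case unfolding eq smooth_fun_times_ident(2)[OF w]
    using Suc by (cases i) (auto simp: w_def)
qed simp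

section \<open>Integration by parts on the half-line\<close>

text \<open>
  The rate \<open>c\<close> may be 0, in which case this is polynomial growth; it is additive under products.
\<close>

definition poly_exp_bounded :: "real \<Rightarrow> (real \<Rightarrow> complex) \<Rightarrow> bool" where
  "poly_exp_bounded c f \<longleftrightarrow> (\<exists>C p. \<forall>t\<ge>0. norm (f t) \<le> C * (1 + t) ^ p * exp (- c * t))"

lemma poly_exp_boundedI:
  "(\<And>t. t \<ge> 0 \<Longrightarrow> norm (f t) \<le> C * (1 + t) ^ p * exp (- c * t)) \<Longrightarrow> poly_exp_bounded c f"
  unfolding poly_exp_bounded_def by blast

lemma poly_exp_bounded_mult:
  assumes "poly_exp_bounded c f" "poly_exp_bounded c' g"
  shows "poly_exp_bounded (c + c') (\<lambda>t. f t * g t)"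
proof -
  obtain C p where f: "\<And>t. t \<ge> 0 \<Longrightarrow> norm (f t) \<le> C * (1 + t) ^ p * exp (- c * t)"
    using assms(1) unfolding poly_exp_bounded_def by blast
  obtain C' p' where g: "\<And>t. t \<ge> 0 \<Longrightarrow> norm (g t) \<le> C' * (1 + t) ^ p' * exp (- c' * t)"
    using assms(2) unfolding poly_exp_bounded_def by blast
  show ?thesis
  proof (rule poly_exp_boundedI)
    fix t :: real assume t: "t \<ge> 0"
    have "norm (f t * g t) \<le> (C * (1 + t) ^ p * exp (- c * t)) * (C' * (1 + t) ^ p' * exp (- c' * t))"
      unfolding norm_mult using f[OF t] g[OF t] by (intro mult_mono) (auto intro: order_trans[OF norm_ge_zero])
    also have "\<dots> = (C * C') * (1 + t) ^ (p + p') * (exp (- c * t) * exp (- c' * t))"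
      by (simp only: power_add mult_ac)
    also have "exp (- c * t) * exp (- c' * t) = exp (- (c + c') * t)"
      by (simp add: exp_add[symmetric] algebra_simps)
    finally show "norm (f t * g t) \<le> (C * C') * (1 + t) ^ (p + p') * exp (- (c + c') * t)" .
  qed
qed

lemma poly_exp_bounded_cmult: "poly_exp_bounded c f \<Longrightarrow> poly_exp_bounded c (\<lambda>t. k * f t)"
  using poly_exp_bounded_mult[of 0 "\<lambda>_. k" c f] poly_exp_boundedI[of "\<lambda>_. k" "norm k" 0 0] by simp

lemma poly_exp_bounded_exp: "Re z \<le> - c \<Longrightarrow> poly_exp_bounded c (\<lambda>t. exp (z * of_real t))"
  using mult_right_mono[of "Re z" "- c"] by (intro poly_exp_boundedI[where C = 1 and p = 0]) auto

lemma poly_exp_bounded_power: "poly_exp_bounded 0 (\<lambda>t. of_real t ^ p)"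
  by (rule poly_exp_boundedI[where C = 1 and p = p]) (auto simp: norm_power intro!: power_mono)

lemma poly_exp_bound_le_exp:
  fixes t :: real
  assumes c: "c > 0" and t: "t \<ge> 0"
  shows "(1 + t) ^ p * exp (- c * t) \<le> fact p / (c / 2) ^ p * exp (c / 2) * exp (- (c / 2) * t)"
proof -
  have "(1 + t) ^ p * exp (- (c / 2) * (1 + t)) \<le> fact p / (c / 2) ^ p"
    using c t by (intro power_mult_exp_neg_bound) auto
  hence "(1 + t) ^ p * exp (- (c / 2) * (1 + t)) * (exp (c / 2) * exp (- (c / 2) * t)) \<le>
          fact p / (c / 2) ^ p * (exp (c / 2) * exp (- (c / 2) * t))"
    by (rule mult_right_mono) auto
  also have "(1 + t) ^ p * exp (- (c / 2) * (1 + t)) * (exp (c / 2) * exp (- (c / 2) * t)) =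
      (1 + t) ^ p * exp (- (c / 2) * (1 + t) + (c / 2 + - (c / 2) * t))"
    by (simp only: exp_add mult.assoc)
  also have "- (c / 2) * (1 + t) + (c / 2 + - (c / 2) * t) = - c * t" by (simp add: field_simps)
  finally show ?thesis by (simp only: mult.assoc)
qed

lemma set_integrable_exp_neg:
  fixes c :: real
  assumes "c > 0"
  shows "set_integrable lborel {0..} (\<lambda>t. exp (- c * t))"
  unfolding set_integrable_def
proof (rule integrableI_bounded)
  have "(\<integral>\<^sup>+x. ennreal (norm (indicator {0..} x *\<^sub>R exp (- c * x))) \<partial>lborel)
       = (\<integral>\<^sup>+x. ennreal (exp (- c * x)) * indicator {0..} x \<partial>lborel)"
    by (intro nn_integral_cong) (auto simp: indicator_def)
  also have "\<dots> = 0 - (- exp (- c * 0) / c)"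
  proof (rule nn_integral_FTC_atLeast)
    show "((\<lambda>x. - exp (- c * x) / c) has_real_derivative exp (- c * x)) (at x)" for x
      using assms by (auto intro!: derivative_eq_intros)
    show "((\<lambda>x. - exp (- c * x) / c) \<longlongrightarrow> 0) at_top"
      using assms by real_asymp
  qed auto
  also have "\<dots> < \<infinity>" by simp
  finally show "(\<integral>\<^sup>+x. ennreal (norm (indicator {0..} x *\<^sub>R exp (- c * x))) \<partial>lborel) < \<infinity>" .
qed simp

lemma set_integrable_poly_exp:
  fixes c :: real
  assumes "c > 0"
  shows "set_integrable lborel {0..} (\<lambda>t. (1 + t) ^ p * exp (- c * t))"
proof (rule set_integrable_bound)
  show "set_integrable lborel {0..} (\<lambda>t. fact p / (c / 2) ^ p * exp (c / 2) * exp (- (c / 2) * t))"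
    using set_integrable_exp_neg[of "c / 2"] assms by (intro set_integrable_mult_right) auto
  show "set_borel_measurable lborel {0..} (\<lambda>t. (1 + t) ^ p * exp (- c * t))"
    unfolding set_borel_measurable_def by simp
  show "AE t in lborel. t \<in> {0..} \<longrightarrow> norm ((1 + t) ^ p * exp (- c * t)) \<le>
          norm (fact p / (c / 2) ^ p * exp (c / 2) * exp (- (c / 2) * t))"
    using poly_exp_bound_le_exp[OF assms] assms by (auto intro!: AE_I2 simp: abs_mult)
qed

lemma set_integrable_poly_exp_bounded:
  assumes f: "poly_exp_bounded c f" and m: "f \<in> borel_measurable borel" and c: "c > 0"
  shows "set_integrable lborel {0..} f"
proof -
  obtain C p where f: "\<And>t. t \<ge> 0 \<Longrightarrow> norm (f t) \<le> C * (1 + t) ^ p * exp (- c * t)"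
    using f unfolding poly_exp_bounded_def by blast
  show ?thesis
  proof (rule set_integrable_bound)
    show "set_integrable lborel {0..} (\<lambda>t. C * ((1 + t) ^ p * exp (- c * t)))"
      using set_integrable_poly_exp[OF c] by (rule set_integrable_mult_right)
    show "set_borel_measurable lborel {0..} f"
      unfolding set_borel_measurable_def using m by simp
    show "AE t in lborel. t \<in> {0..} \<longrightarrow> norm (f t) \<le> norm (C * ((1 + t) ^ p * exp (- c * t)))"
      using f by (auto intro!: AE_I2 order_trans[OF _ abs_ge_self] simp: mult.assoc)
  qed
qed

lemma poly_exp_bounded_tendsto_0:
  assumes f: "poly_exp_bounded c f" and c: "c > 0"
  shows "(f \<longlongrightarrow> 0) at_top"
proof -
  obtain C p where f: "\<And>t. t \<ge> 0 \<Longrightarrow> norm (f t) \<le> C * (1 + t) ^ p * exp (- c * t)"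
    using f unfolding poly_exp_bounded_def by blast
  show ?thesis
  proof (rule Lim_null_comparison)
    show "((\<lambda>t. \<bar>C\<bar> * (fact p / (c / 2) ^ p * exp (c / 2) * exp (- (c / 2) * t))) \<longlongrightarrow> 0) at_top"
      using c by real_asymp
    show "eventually (\<lambda>t. norm (f t) \<le> \<bar>C\<bar> * (fact p / (c / 2) ^ p * exp (c / 2) * exp (- (c / 2) * t))) at_top"
      using eventually_ge_at_top[of 0]
    proof eventually_elim
      case (elim t)
      have "norm (f t) \<le> C * ((1 + t) ^ p * exp (- c * t))" using f[OF elim] by (simp only: mult.assoc)
      also have "\<dots> \<le> \<bar>C\<bar> * ((1 + t) ^ p * exp (- c * t))" using elim by (intro mult_right_mono) auto
      also have "\<dots> \<le> \<bar>C\<bar> * (fact p / (c / 2) ^ p * exp (c / 2) * exp (- (c / 2) * t))"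
        using poly_exp_bound_le_exp[OF c elim] by (intro mult_left_mono) auto
      finally show ?case .
    qed
  qed
qed

lemma integral_FTC_Ici_decay:
  assumes D: "\<And>t. (U has_vector_derivative U' t) (at t)" and cont: "continuous_on UNIV U'"
    and U: "poly_exp_bounded c U" and int: "set_integrable lborel {0..} U'" and c: "c > 0"
  shows "(LINT t:{0..}|lborel. U' t) = - U 0"
proof (rule tendsto_unique)
  let ?I = "\<lambda>y. \<integral>x. indicator {..y} x *\<^sub>R (indicator {0..} x *\<^sub>R U' x) \<partial>lborel"
  show "(?I \<longlongrightarrow> (LINT t:{0..}|lborel. U' t)) at_top"
    unfolding set_lebesgue_integral_def
    using int by (intro tendsto_integral_at_top) (auto simp: set_integrable_def)
  have "((\<lambda>y. U y - U 0) \<longlongrightarrow> 0 - U 0) at_top"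
    by (intro tendsto_intros poly_exp_bounded_tendsto_0[OF U c])
  moreover have "eventually (\<lambda>y. U y - U 0 = ?I y) at_top"
    using eventually_ge_at_top[of 0]
  proof eventually_elim
    case (elim y)
    have "?I y = (\<integral>x. indicator {0..y} x *\<^sub>R U' x \<partial>lborel)"
      by (intro Bochner_Integration.integral_cong) (auto simp: indicator_def)
    also have "\<dots> = U y - U 0"
      by (rule integral_FTC_atLeastAtMost[OF elim])
         (use D cont in \<open>auto intro: has_vector_derivative_at_within continuous_on_subset\<close>)
    finally show ?case by simp
  qed
  ultimately show "(?I \<longlongrightarrow> - U 0) at_top"
    by (auto intro: Lim_transform_eventually)
qed simp

lemma integral_by_parts_Ici:
  assumes h: "\<And>t. (h has_vector_derivative h' t) (at t)" "continuous_on UNIV h'"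
      "poly_exp_bounded 0 h" "poly_exp_bounded 0 h'"
    and w: "\<And>t. (w has_vector_derivative w' t) (at t)" "continuous_on UNIV w'"
      "poly_exp_bounded c w" "poly_exp_bounded c w'" and w0: "w 0 = 0" and c: "c > 0"
  shows "(LINT t:{0..}|lborel. h t * w' t) = - (LINT t:{0..}|lborel. h' t * w t)"
proof -
  have ch: "continuous_on UNIV h" "continuous_on UNIV w"
    using h(1) w(1) by (meson continuous_at_imp_continuous_on has_vector_derivative_continuous)+
  have i1: "set_integrable lborel {0..} (\<lambda>t. h t * w' t)"
    using poly_exp_bounded_mult[OF h(3) w(4)] ch w(2) c
    by (intro set_integrable_poly_exp_bounded[of c] borel_measurable_continuous_onI continuous_intros) auto
  have i2: "set_integrable lborel {0..} (\<lambda>t. h' t * w t)"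
    using poly_exp_bounded_mult[OF h(4) w(3)] ch h(2) c
    by (intro set_integrable_poly_exp_bounded[of c] borel_measurable_continuous_onI continuous_intros) auto
  have "(LINT t:{0..}|lborel. h t * w' t + h' t * w t) = - (h 0 * w 0)"
  proof (rule integral_FTC_Ici_decay[where c = c])
    show "((\<lambda>t. h t * w t) has_vector_derivative h t * w' t + h' t * w t) (at t)" for t
      by (rule has_vector_derivative_mult[OF h(1) w(1)])
    show "continuous_on UNIV (\<lambda>t. h t * w' t + h' t * w t)"
      using ch h(2) w(2) by (intro continuous_intros)
    show "poly_exp_bounded c (\<lambda>t. h t * w t)" using poly_exp_bounded_mult[OF h(3) w(3)] by simp
    show "set_integrable lborel {0..} (\<lambda>t. h t * w' t + h' t * w t)" using i1 i2 by (rule set_integral_add(1))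
  qed (rule c)
  thus ?thesis using set_integral_add(2)[OF i1 i2] w0 by (simp add: add_eq_0_iff2)
qed

text \<open>
  The sequence \<open>h\<close> consists of a function and its derivatives of order up to \<open>d\<close>. All boundary terms
  vanish: at infinity by decay, at 0 because \<open>w\<close> vanishes there to order \<open>d\<close>.
\<close>

lemma integral_by_parts_Ici_iterated:
  fixes h :: "nat \<Rightarrow> real \<Rightarrow> complex"
  assumes h: "\<And>i t. i < d \<Longrightarrow> (h i has_vector_derivative h (Suc i) t) (at t)"
      "\<And>i. i \<le> d \<Longrightarrow> continuous_on UNIV (h i)" "\<And>i. i \<le> d \<Longrightarrow> poly_exp_bounded 0 (h i)"
    and w: "smooth_fun w" "\<And>i. i \<le> d \<Longrightarrow> poly_exp_bounded c ((tderiv ^^ i) w)"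
      "\<And>i. i < d \<Longrightarrow> (tderiv ^^ i) w 0 = 0" and c: "c > 0"
  shows "(-1) ^ d * (LINT t:{0..}|lborel. h 0 t * (tderiv ^^ d) w t) = (LINT t:{0..}|lborel. h d t * w t)"
proof -
  have "(LINT t:{0..}|lborel. h 0 t * (tderiv ^^ d) w t) =
        (-1) ^ j * (LINT t:{0..}|lborel. h j t * (tderiv ^^ (d - j)) w t)" if "j \<le> d" for j
    using that
  proof (induction j)
    case (Suc j)
    define e where "e = d - Suc j"
    have e: "d - j = Suc e" "e < d" using Suc.prems by (auto simp: e_def)
    have "(LINT t:{0..}|lborel. h j t * (tderiv ^^ Suc e) w t) = - (LINT t:{0..}|lborel. h (Suc j) t * (tderiv ^^ e) w t)"
      by (rule integral_by_parts_Ici[where c = c])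
         (use Suc.prems e h w c smooth_fun_has_vector_derivative[OF w(1)] smooth_fun_continuous[OF w(1)]
          in \<open>auto simp del: funpow.simps\<close>)
    thus ?case using Suc e by (simp add: e_def del: funpow.simps)
  qed simp
  from this[of d] show ?thesis by (simp add: power_mult_distrib[symmetric])
qed

lemma integral_power_exp_Ici:
  assumes z: "Re z > 0"
  shows "(LINT t:{0..}|lborel. of_real t ^ M * exp (- z * of_real t)) = fact M / z ^ Suc M"
proof (induction M)
  have dE: "((\<lambda>t. exp (- z * of_real t)) has_vector_derivative - z * exp (- z * of_real t)) (at t)" for t
    by (rule has_vector_derivative_exp_linear)
  have pb: "poly_exp_bounded (Re z) (\<lambda>t. of_real t ^ M * exp (- z * of_real t))" for M
    using poly_exp_bounded_mult[OF poly_exp_bounded_power poly_exp_bounded_exp[of "- z" "Re z"], of M] by simp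
  have int: "set_integrable lborel {0..} (\<lambda>t. of_real t ^ M * exp (- z * of_real t))" for M
    using pb z by (intro set_integrable_poly_exp_bounded[of "Re z"] borel_measurable_continuous_onI continuous_intros) auto
  have z0: "z \<noteq> 0" using z by auto
  {
    case 0
    have "(LINT t:{0..}|lborel. - z * exp (- z * of_real t)) = - exp (- z * of_real 0)"
      using int[of 0] pb[of 0] z
      by (intro integral_FTC_Ici_decay[OF dE, where c = "Re z"] continuous_intros set_integrable_mult_right) auto
    hence "- z * (LINT t:{0..}|lborel. exp (- z * of_real t)) = - 1"
      unfolding set_integral_mult_right by simp
    thus ?case using z0 by (simp add: field_simps)
  next
    case (Suc M)
    have "(LINT t:{0..}|lborel. of_nat (Suc M) * (of_real t ^ M * exp (- z * of_real t))
             - z * (of_real t ^ Suc M * exp (- z * of_real t))) = - (of_real 0 ^ Suc M * exp (- z * of_real 0))"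
    proof (rule integral_FTC_Ici_decay[where c = "Re z"])
      fix t
      have "((\<lambda>w. w ^ Suc M * exp (- z * w)) has_field_derivative
             of_nat (Suc M) * (of_real t ^ M * exp (- z * of_real t)) - z * (of_real t ^ Suc M * exp (- z * of_real t))) (at (of_real t))"
        by (rule derivative_eq_intros refl | simp add: algebra_simps)+
      from has_vector_derivative_real_field[OF this]
      show "((\<lambda>t. of_real t ^ Suc M * exp (- z * of_real t)) has_vector_derivative
         of_nat (Suc M) * (of_real t ^ M * exp (- z * of_real t)) - z * (of_real t ^ Suc M * exp (- z * of_real t))) (at t)" .
    next
      show "continuous_on UNIV (\<lambda>t. of_nat (Suc M) * (of_real t ^ M * exp (- z * of_real t))
             - z * (of_real t ^ Suc M * exp (- z * of_real t)))" by (intro continuous_intros)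
      show "set_integrable lborel {0..} (\<lambda>t. of_nat (Suc M) * (of_real t ^ M * exp (- z * of_real t))
             - z * (of_real t ^ Suc M * exp (- z * of_real t)))"
        by (intro set_integral_diff set_integrable_mult_right int)
    qed (rule pb z)+
    moreover have "(LINT t:{0..}|lborel. of_nat (Suc M) * (of_real t ^ M * exp (- z * of_real t))
             - z * (of_real t ^ Suc M * exp (- z * of_real t))) =
         (LINT t:{0..}|lborel. of_nat (Suc M) * (of_real t ^ M * exp (- z * of_real t))) -
         (LINT t:{0..}|lborel. z * (of_real t ^ Suc M * exp (- z * of_real t)))"
      by (intro set_integral_diff(2) set_integrable_mult_right int)
    ultimately have "of_nat (Suc M) * (LINT t:{0..}|lborel. of_real t ^ M * exp (- z * of_real t)) =
            z * (LINT t:{0..}|lborel. of_real t ^ Suc M * exp (- z * of_real t))"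
      unfolding set_integral_mult_right by simp
    thus ?case unfolding Suc.IH using z0 by (simp add: field_simps del: of_nat_Suc)
  }
qed

section \<open>Approximation by exponential sums\<close>

lemma tderiv_eq_0_on_open:
  assumes "open S" "\<And>t. t \<in> S \<Longrightarrow> u t = 0" "t \<in> S"
  shows "(tderiv ^^ n) u t = 0"
  using assms(3)
proof (induction n arbitrary: t)
  case (Suc n)
  have "((tderiv ^^ n) u has_vector_derivative 0) (at t)"
    by (rule has_vector_derivative_transform_within_open[of "\<lambda>_. 0" _ _ S]) (use Suc assms in auto)
  thus ?case by (simp add: tderiv_def[of "(tderiv ^^ n) u"] vector_derivative_at)
qed (use assms in auto)

text \<open>
  Integrate the bound on the derivative from infinity; since \<open>c \<ge> 1\<close> the constant does not grow.
\<close>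

lemma norm_le_exp_of_derivative:
  fixes v v' :: "real \<Rightarrow> complex"
  assumes v: "\<And>t. (v has_vector_derivative v' t) (at t)" and bd: "\<And>t. t \<ge> 0 \<Longrightarrow> norm (v' t) \<le> \<epsilon> * exp (- c * t)"
    and lim: "(v \<longlongrightarrow> 0) at_top" and c: "c \<ge> 1" and t: "t \<ge> 0" and \<epsilon>: "\<epsilon> \<ge> 0"
  shows "norm (v t) \<le> \<epsilon> * exp (- c * t)"
proof (rule tendsto_upperbound)
  show "((\<lambda>T. norm (v T - v t)) \<longlongrightarrow> norm (v t)) at_top"
    using tendsto_norm[OF tendsto_diff[OF lim tendsto_const[of "v t"]]] by simp
  show "eventually (\<lambda>T. norm (v T - v t) \<le> \<epsilon> * exp (- c * t)) at_top"
    using eventually_gt_at_top[of t]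
  proof eventually_elim
    case (elim T)
    define \<phi> where "\<phi> = (\<lambda>s. - (\<epsilon> / c) * exp (- c * s))"
    have \<phi>: "(\<phi> has_vector_derivative \<epsilon> * exp (- c * s)) (at s)" for s
      unfolding \<phi>_def has_real_derivative_iff_has_vector_derivative[symmetric]
      using c by (auto intro!: derivative_eq_intros)
    have "norm (v T - v t) \<le> \<phi> T - \<phi> t"
    proof (rule differentiable_bound_general[OF elim])
      show "continuous_on {t..T} v" "continuous_on {t..T} \<phi>"
        using v \<phi> by (meson continuous_at_imp_continuous_on has_vector_derivative_continuous)+
    qed (use v \<phi> bd t in auto)
    also have "\<dots> \<le> \<epsilon> / c * exp (- c * t)" using \<epsilon> c by (simp add: \<phi>_def)
    also have "\<dots> \<le> \<epsilon> * exp (- c * t)" using \<epsilon> c by (intro mult_right_mono) (auto simp: field_simps mult_le_cancel_left1)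
    finally show ?case .
  qed
qed simp

lemma complex_polynomial_approximation:
  fixes \<theta> :: "real \<Rightarrow> complex"
  assumes "continuous_on {0..1} \<theta>" "\<epsilon> > 0"
  obtains n :: nat and Q :: "nat \<Rightarrow> complex" where "\<And>x. x \<in> {0..1} \<Longrightarrow> norm (\<theta> x - (\<Sum>j\<le>n. Q j * of_real x ^ j)) < \<epsilon>"
proof -
  obtain g where g: "polynomial_function g" "\<And>x. x \<in> {0..1} \<Longrightarrow> norm (\<theta> x - g x) < \<epsilon>"
    using Stone_Weierstrass_polynomial_function[OF compact_Icc assms] by blast
  have rp: "real_polynomial_function (\<lambda>x. Re (g x))" "real_polynomial_function (\<lambda>x. Im (g x))"
    using g(1) bounded_linear_Re bounded_linear_Im unfolding polynomial_function_def o_def by blast+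
  obtain A n where A: "(\<lambda>x. Re (g x)) = (\<lambda>x. \<Sum>i\<le>n. A i * x ^ i)"
    using rp(1) unfolding real_polynomial_function_iff_sum by blast
  obtain B m where B: "(\<lambda>x. Im (g x)) = (\<lambda>x. \<Sum>i\<le>m. B i * x ^ i)"
    using rp(2) unfolding real_polynomial_function_iff_sum by blast
  note * = fun_cong[OF A] fun_cong[OF B]
  define A' where "A' = (\<lambda>i. if i \<le> n then A i else (0::real))"
  define B' where "B' = (\<lambda>i. if i \<le> m then B i else (0::real))"
  have "Re (g x) = (\<Sum>i\<le>max n m. A' i * x ^ i)" "Im (g x) = (\<Sum>i\<le>max n m. B' i * x ^ i)" for x
    unfolding * by (intro sum.mono_neutral_cong_left; simp add: A'_def B'_def)+
  hence "g x = (\<Sum>j\<le>max n m. Complex (A' j) (B' j) * of_real x ^ j)" for x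
    by (auto simp: complex_eq_iff simp flip: of_real_power)
  thus ?thesis using g(2) that[where n = "max n m" and Q = "\<lambda>j. Complex (A' j) (B' j)"] by simp
qed

text \<open>
  Approximate the top derivative: in the variable \<open>x = e\<^bsup>-t\<^esup>\<close> the function \<open>e\<^bsup>ct\<^esup> \<eta>\<^bsup>(d)\<^esup>(t)\<close> is continuous on \<open>[0, 1]\<close>
  and close to a polynomial. The resulting exponential sum is integrated \<open>d\<close> times explicitly, which
  keeps it an exponential sum, and the errors of the lower derivatives are recovered by integrating
  from infinity.
\<close>

lemma exponential_sum_approximation:
  assumes \<eta>: "smooth_fun \<eta>" "\<And>t. t > b \<Longrightarrow> \<eta> t = 0" and c: "c \<ge> 1" and \<epsilon>: "\<epsilon> > 0"
  obtains n q where "\<And>i t. i \<le> d \<Longrightarrow> t \<ge> 0 \<Longrightarrow>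
     norm ((tderiv ^^ i) (\<lambda>t. \<eta> t - (\<Sum>j\<le>(n::nat). q j * exp (- of_real (c + real j) * of_real t))) t) \<le> \<epsilon> * exp (- c * t)"
proof -
  define \<theta> where "\<theta> = (\<lambda>x. if x \<le> 0 then 0 else of_real (exp (- c * ln x)) * (tderiv ^^ d) \<eta> (- ln x))"
  have \<eta>0: "(tderiv ^^ i) \<eta> t = 0" if "t > b" for i t
    by (rule tderiv_eq_0_on_open[of "{b<..}"]) (use that \<eta> in auto)
  have "isCont \<theta> x" for x
  proof (cases "x > 0")
    case True
    have "continuous_on {0<..} (\<lambda>x. of_real (exp (- c * ln x)) * (tderiv ^^ d) \<eta> (- ln x))"
      by (intro continuous_intros continuous_on_compose2[OF smooth_fun_continuous[OF \<eta>(1), of UNIV]]) auto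
    hence "isCont (\<lambda>x. of_real (exp (- c * ln x)) * (tderiv ^^ d) \<eta> (- ln x)) x"
      using True by (simp add: continuous_on_eq_continuous_at)
    moreover have "eventually (\<lambda>x. \<theta> x = of_real (exp (- c * ln x)) * (tderiv ^^ d) \<eta> (- ln x)) (nhds x)"
      using eventually_nhds_in_open[of "{0<..}" x] True by (auto elim!: eventually_mono simp: \<theta>_def)
    ultimately show ?thesis using isCont_cong by metis
  next
    case False
    have "\<theta> y = 0" if y: "y < exp (- b)" for y
    proof (cases "y \<le> 0")
      case False
      hence "ln y < - b" using y by (metis exp_less_cancel_iff exp_ln not_le)
      thus ?thesis using \<eta>0 by (simp add: \<theta>_def)
    qed (simp add: \<theta>_def)
    moreover have "x \<in> {..<exp (- b)}" using False le_less_trans[OF _ exp_gt_zero[of "- b"], of x] by simp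
    ultimately have "eventually (\<lambda>x. \<theta> x = 0) (nhds x)"
      using eventually_nhds_in_open[of "{..<exp (- b)}" x] by (auto elim!: eventually_mono)
    thus ?thesis using isCont_cong[of \<theta> "\<lambda>_. 0" x] by auto
  qed
  hence "continuous_on {0..1} \<theta>" by (simp add: continuous_at_imp_continuous_on)
  then obtain n Q where Q: "\<And>x. x \<in> {0..1} \<Longrightarrow> norm (\<theta> x - (\<Sum>j\<le>(n::nat). Q j * of_real x ^ j)) < \<epsilon>"
    using complex_polynomial_approximation[OF _ \<epsilon>] by blast
  define z where "z = (\<lambda>j. - complex_of_real (c + real j))"
  have z0: "z j \<noteq> 0" for j
  proof -
    have "c + real j \<noteq> 0" using c by simp
    thus ?thesis unfolding z_def neg_equal_0_iff_equal of_real_eq_0_iff .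
  qed
  define q where "q = (\<lambda>j. Q j / z j ^ d)"
  define g where "g = (\<lambda>t. \<Sum>j\<le>n. q j * exp (z j * of_real t))"
  have sg: "smooth_fun g" unfolding g_def by (intro smooth_fun_sum(1) smooth_fun_cmult(1) smooth_fun_exp(1))
  have dg: "(tderiv ^^ i) g = (\<lambda>t. \<Sum>j\<le>n. q j * (z j ^ i * exp (z j * of_real t)))" for i
    unfolding g_def
    by (subst smooth_fun_sum(2)) (auto intro!: smooth_fun_cmult(1) smooth_fun_exp(1) simp: smooth_fun_cmult(2) smooth_fun_exp)
  define \<delta> where "\<delta> = (\<lambda>t. \<eta> t - g t)"
  have s\<delta>: "smooth_fun \<delta>" unfolding \<delta>_def by (rule smooth_fun_diff(1)[OF \<eta>(1) sg])
  have d\<delta>: "(tderiv ^^ i) \<delta> = (\<lambda>t. (tderiv ^^ i) \<eta> t - (tderiv ^^ i) g t)" for i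
    unfolding \<delta>_def by (rule smooth_fun_diff(2)[OF \<eta>(1) sg])
  have lim: "((tderiv ^^ i) \<delta> \<longlongrightarrow> 0) at_top" for i
  proof -
    have "((\<lambda>t. exp (z j * of_real t)) \<longlongrightarrow> 0) at_top" for j
      by (rule poly_exp_bounded_tendsto_0[where c = c]) (use c in \<open>auto intro!: poly_exp_bounded_exp simp: z_def\<close>)
    hence "((tderiv ^^ i) g \<longlongrightarrow> (\<Sum>j\<le>n. q j * (z j ^ i * 0))) at_top"
      unfolding dg by (intro tendsto_intros)
    hence g: "((tderiv ^^ i) g \<longlongrightarrow> 0) at_top" by simp
    have "((tderiv ^^ i) \<eta> \<longlongrightarrow> 0) at_top"
      by (rule tendsto_eventually, rule eventually_mono[OF eventually_gt_at_top[of b]]) (rule \<eta>0)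
    from tendsto_diff[OF this g] show ?thesis unfolding d\<delta> by simp
  qed
  have top: "norm ((tderiv ^^ d) \<delta> t) \<le> \<epsilon> * exp (- c * t)" if t: "t \<ge> 0" for t
  proof -
    define x where "x = exp (- t)"
    have x: "x \<in> {0..1}" "x > 0" "ln x = - t" using t by (auto simp: x_def)
    have "exp (z j * of_real t) = of_real (exp (- c * t)) * of_real x ^ j" for j
    proof -
      have "z j * of_real t = of_real (- c * t) + of_nat j * of_real (- t)"
        by (simp add: z_def algebra_simps)
      thus ?thesis by (simp only: exp_add exp_of_nat_mult x_def exp_of_real)
    qed
    hence "(tderiv ^^ d) g t = of_real (exp (- c * t)) * (\<Sum>j\<le>n. Q j * of_real x ^ j)"
      unfolding dg q_def sum_distrib_left using z0 by (intro sum.cong) auto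
    moreover have "of_real (exp (- c * t)) * \<theta> x = (tderiv ^^ d) \<eta> t"
    proof -
      have "exp (- c * t) * exp (- c * ln x) = 1" unfolding x(3) exp_add[symmetric] by simp
      hence "of_real (exp (- c * t)) * complex_of_real (exp (- c * ln x)) = 1"
        by (metis of_real_1 of_real_mult)
      thus ?thesis using x(2,3) unfolding \<theta>_def by (simp add: mult.assoc[symmetric])
    qed
    ultimately have "(tderiv ^^ d) \<delta> t = of_real (exp (- c * t)) * (\<theta> x - (\<Sum>j\<le>n. Q j * of_real x ^ j))"
      unfolding d\<delta> by (simp only: right_diff_distrib)
    hence "norm ((tderiv ^^ d) \<delta> t) = exp (- c * t) * norm (\<theta> x - (\<Sum>j\<le>n. Q j * of_real x ^ j))"
      by (simp add: norm_mult)
    also have "\<dots> \<le> exp (- c * t) * \<epsilon>" using Q[OF x(1)] by (intro mult_left_mono) auto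
    finally show ?thesis by (simp add: mult.commute)
  qed
  \<comment> \<open>The order of the derivative decreases with \<open>k\<close>; each step is an integration from infinity.\<close>
  have all: "\<forall>t\<ge>0. norm ((tderiv ^^ (d - k)) \<delta> t) \<le> \<epsilon> * exp (- c * t)" for k
  proof (induction k)
    case (Suc k)
    show ?case
    proof (cases "k < d")
      case True
      hence e: "d - k = Suc (d - Suc k)" by simp
      have bd: "norm ((tderiv ^^ Suc (d - Suc k)) \<delta> t) \<le> \<epsilon> * exp (- c * t)" if "t \<ge> 0" for t
        using Suc.IH that unfolding e by blast
      show ?thesis
        using norm_le_exp_of_derivative[OF smooth_fun_has_vector_derivative[OF s\<delta>] bd lim c] \<epsilon> by auto
    qed (use Suc.IH in auto)
  qed (use top in auto)
  have "norm ((tderiv ^^ i) \<delta> t) \<le> \<epsilon> * exp (- c * t)" if "i \<le> d" "t \<ge> 0" for i t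
    using all[of "d - i"] that by simp
  thus ?thesis using that[where n = n and q = q] unfolding \<delta>_def g_def z_def by simp
qed

section \<open>Density of power exponentials\<close>

abbreviation power_exp :: "nat \<Rightarrow> real \<Rightarrow> real \<Rightarrow> complex" where
  "power_exp M s \<equiv> \<lambda>t. of_real t ^ M * exp (- of_real s * of_real t)"

lemma set_integral_sum_cmult:
  fixes g :: "'j \<Rightarrow> real \<Rightarrow> complex"
  assumes "\<And>j. j \<in> J \<Longrightarrow> set_integrable lborel A (g j)"
  shows "(LINT t:A|lborel. (\<Sum>j\<in>J. q j * g j t)) = (\<Sum>j\<in>J. q j * (LINT t:A|lborel. g j t))"
proof -
  have "integrable lborel (\<lambda>t. indicator A t *\<^sub>R (q j * g j t))" if "j \<in> J" for j
    using set_integrable_mult_right[OF assms[OF that], of "q j"] by (simp add: set_integrable_def)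
  hence "(LINT t:A|lborel. (\<Sum>j\<in>J. q j * g j t)) = (\<Sum>j\<in>J. (LINT t:A|lborel. q j * g j t))"
    unfolding set_lebesgue_integral_def scaleR_sum_right by (rule Bochner_Integration.integral_sum)
  thus ?thesis by (simp add: set_integral_mult_right)
qed

lemma has_sum_finite_sum:
  fixes F :: "'j \<Rightarrow> 'k \<Rightarrow> complex"
  assumes "finite J" "\<And>j. j \<in> J \<Longrightarrow> (F j has_sum S j) A"
  shows "((\<lambda>k. \<Sum>j\<in>J. F j k) has_sum (\<Sum>j\<in>J. S j)) A"
  using assms by (induction J rule: finite_induct) (auto intro!: has_sum_add)

lemma poly_exp_bounded_tderiv_power_exp:
  assumes "s \<ge> c"
  shows "poly_exp_bounded c ((tderiv ^^ i) (power_exp M s))"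
proof -
  define B where "B = (\<Sum>j\<le>i. \<bar>s\<bar> ^ j)"
  have B0: "B \<ge> 0" unfolding B_def by (intro sum_nonneg) auto
  show ?thesis
  proof (rule poly_exp_boundedI)
    fix t :: real assume t: "t \<ge> 0"
    have "norm ((tderiv ^^ i) (power_exp M s) t) \<le>
          (B * exp (- c * t)) * (t + real i) ^ M"
    proof (rule tderiv_power_mult_bound[where d = i])
      show "smooth_fun (\<lambda>t. exp (- of_real s * of_real t))" by (rule smooth_fun_exp(1))
      fix j assume j: "j \<le> i"
      have "\<bar>s\<bar> ^ j \<le> B" unfolding B_def using j by (intro member_le_sum) auto
      moreover have "exp (- s * t) \<le> exp (- c * t)" using assms t by (simp add: mult_right_mono)
      ultimately have "\<bar>s\<bar> ^ j * exp (- s * t) \<le> B * exp (- c * t)" using B0 by (intro mult_mono) auto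
      thus "norm ((tderiv ^^ j) (\<lambda>t. exp (- of_real s * of_real t)) t) \<le> B * exp (- c * t)"
        unfolding smooth_fun_exp(2) by (simp add: norm_mult norm_power)
    qed (use t in auto)
    also have "\<dots> \<le> (B * exp (- c * t)) * ((1 + real i) * (1 + t)) ^ M"
      using t B0 by (intro mult_left_mono power_mono) (auto simp: algebra_simps)
    finally show "norm ((tderiv ^^ i) (power_exp M s) t) \<le>
        (B * (1 + real i) ^ M) * (1 + t) ^ M * exp (- c * t)"
      by (simp only: power_mult_distrib mult_ac)
  qed
qed

text \<open>
  Divide the test function by \<open>t\<^sup>M\<close>, approximate the quotient by an exponential sum with all derivatives
  up to order \<open>d\<close>, and multiply back. Both functionals are continuous for this kind of approximation and agree on
  the approximants.
\<close>

lemma distribution_determined_by_power_exponentials: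
  fixes G :: "real \<Rightarrow> complex" and x :: "'k \<Rightarrow> real" and \<gamma> :: "'k \<Rightarrow> complex"
  assumes G: "G \<in> borel_measurable borel" "poly_exp_bounded 0 G"
    and x: "\<And>k. k \<in> A \<Longrightarrow> x k \<ge> 0" and c: "c \<ge> 1"
    and sm: "(\<lambda>k. norm (\<gamma> k) * x k ^ M * exp (- x k * c)) summable_on A"
    and eq: "\<And>s. s \<ge> c \<Longrightarrow> ((\<lambda>k. \<gamma> k * power_exp M s (x k)) has_sum
       (-1) ^ d * (LINT t:{0..}|lborel. G t * (tderiv ^^ d) (power_exp M s) t)) A"
    and u: "smooth_fun u" "\<And>t. t < a \<Longrightarrow> u t = 0" "\<And>t. t > b \<Longrightarrow> u t = 0" and a: "a > 0"
  shows "((\<lambda>k. \<gamma> k * u (x k)) has_sum (-1) ^ d * (LINT t:{0..}|lborel. G t * (tderiv ^^ d) u t)) A"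
proof -
  define T where "T = (\<lambda>v. (-1) ^ d * (LINT t:{0..}|lborel. G t * (tderiv ^^ d) v t))"
  define Sg where "Sg = (\<Sum>\<^sub>\<infinity>k\<in>A. norm (\<gamma> k) * x k ^ M * exp (- x k * c))"
  obtain C p where Gb: "\<And>t. t \<ge> 0 \<Longrightarrow> norm (G t) \<le> C * (1 + t) ^ p * exp (- 0 * t)"
    using G(2) unfolding poly_exp_bounded_def by blast
  have C: "C \<ge> 0" using order_trans[OF norm_ge_zero Gb[of 0]] by simp
  define I where "I = (LINT t:{0..}|lborel. C * (1 + real d) ^ M * ((1 + t) ^ (p + M) * exp (- c * t)))"
  have Iint: "set_integrable lborel {0..} (\<lambda>t. C * (1 + real d) ^ M * ((1 + t) ^ (p + M) * exp (- c * t)))"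
    using set_integrable_poly_exp[of c] c by (intro set_integrable_mult_right) auto
  define \<eta> where "\<eta> = (\<lambda>t. u t / of_real t ^ M)"
  have s\<eta>: "smooth_fun \<eta>" unfolding \<eta>_def by (rule smooth_fun_divide_power[OF u(1,2) a])
  have \<eta>0: "\<eta> t = 0" if "t > b" for t using u(3)[OF that] by (simp add: \<eta>_def)
  have u_eq: "u t = of_real t ^ M * \<eta> t" for t
    using u(2)[of 0] a by (cases "t = 0") (auto simp: \<eta>_def)
  have measd: "(tderiv ^^ d) v \<in> borel_measurable borel" if "smooth_fun v" for v
    using smooth_fun_continuous[OF that] by (intro borel_measurable_continuous_onI)
  \<comment> \<open>The constant \<open>I\<close> does not depend on \<open>\<delta>\<close>; this makes \<open>T\<close> continuous for the approximation below.\<close>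
  have small: "norm (T (\<lambda>t. of_real t ^ M * \<delta> t)) \<le> \<epsilon> * I \<and>
      set_integrable lborel {0..} (\<lambda>t. G t * (tderiv ^^ d) (\<lambda>t. of_real t ^ M * \<delta> t) t)"
    if \<delta>: "smooth_fun \<delta>" "\<And>i t. i \<le> d \<Longrightarrow> t \<ge> 0 \<Longrightarrow> norm ((tderiv ^^ i) \<delta> t) \<le> \<epsilon> * exp (- c * t)" "\<epsilon> \<ge> 0" for \<delta> \<epsilon>
  proof -
    define w where "w = (\<lambda>t. of_real t ^ M * \<delta> t)"
    have sw: "smooth_fun w" unfolding w_def by (rule smooth_fun_power_mult[OF \<delta>(1)])
    have bd: "norm (G t * (tderiv ^^ d) w t) \<le> \<epsilon> * (C * (1 + real d) ^ M * ((1 + t) ^ (p + M) * exp (- c * t)))"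
      if t: "t \<ge> 0" for t
    proof -
      have "norm ((tderiv ^^ d) w t) \<le> (\<epsilon> * exp (- c * t)) * (t + real d) ^ M"
        unfolding w_def using \<delta> t by (intro tderiv_power_mult_bound[where d = d]) auto
      also have "\<dots> \<le> (\<epsilon> * exp (- c * t)) * ((1 + real d) * (1 + t)) ^ M"
        using t \<delta>(3) by (intro mult_left_mono power_mono) (auto simp: algebra_simps)
      finally have "norm (G t * (tderiv ^^ d) w t) \<le> (C * (1 + t) ^ p) * ((\<epsilon> * exp (- c * t)) * ((1 + real d) * (1 + t)) ^ M)"
        unfolding norm_mult using Gb[OF t] C t by (intro mult_mono) auto
      also have "\<dots> = \<epsilon> * (C * (1 + real d) ^ M * ((1 + t) ^ (p + M) * exp (- c * t)))"
        by (simp only: power_mult_distrib power_add mult_ac)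
      finally show ?thesis .
    qed
    have \<epsilon>int: "set_integrable lborel {0..} (\<lambda>t. \<epsilon> * (C * (1 + real d) ^ M * ((1 + t) ^ (p + M) * exp (- c * t))))"
      using Iint by (rule set_integrable_mult_right)
    have int: "set_integrable lborel {0..} (\<lambda>t. G t * (tderiv ^^ d) w t)"
    proof (rule set_integrable_bound[OF \<epsilon>int])
      show "set_borel_measurable lborel {0..} (\<lambda>t. G t * (tderiv ^^ d) w t)"
        unfolding set_borel_measurable_def using G(1) measd[OF sw] by simp
      show "AE t in lborel. t \<in> {0..} \<longrightarrow> norm (G t * (tderiv ^^ d) w t)
          \<le> norm (\<epsilon> * (C * (1 + real d) ^ M * ((1 + t) ^ (p + M) * exp (- c * t))))"
        using bd by (intro AE_I2) (auto intro: order_trans[OF _ abs_ge_self])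
    qed
    have "norm (T w) = norm (LINT t:{0..}|lborel. G t * (tderiv ^^ d) w t)"
      by (simp add: T_def norm_mult norm_power)
    also have "\<dots> \<le> (LINT t:{0..}|lborel. \<epsilon> * (C * (1 + real d) ^ M * ((1 + t) ^ (p + M) * exp (- c * t))))"
      unfolding set_lebesgue_integral_def
    proof (rule order_trans[OF integral_norm_bound Bochner_Integration.integral_mono])
      show "integrable lborel (\<lambda>t. norm (indicator {0..} t *\<^sub>R (G t * (tderiv ^^ d) w t)))"
        using int unfolding set_integrable_def by (rule integrable_norm)
      show "integrable lborel (\<lambda>t. indicator {0..} t *\<^sub>R (\<epsilon> * (C * (1 + real d) ^ M * ((1 + t) ^ (p + M) * exp (- c * t)))))"
        using \<epsilon>int by (simp add: set_integrable_def)
      show "norm (indicator {0..} t *\<^sub>R (G t * (tderiv ^^ d) w t))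
        \<le> indicator {0..} t *\<^sub>R (\<epsilon> * (C * (1 + real d) ^ M * ((1 + t) ^ (p + M) * exp (- c * t))))" for t
        using bd[of t] by (cases "t \<ge> 0") auto
    qed
    also have "\<dots> = \<epsilon> * I" unfolding I_def by (rule set_integral_mult_right)
    finally show ?thesis using int by (simp add: w_def)
  qed
  have I0: "I \<ge> 0" unfolding I_def set_lebesgue_integral_def
    using C by (intro Bochner_Integration.integral_nonneg) (auto simp: indicator_def)
  have Sg0: "Sg \<ge> 0" unfolding Sg_def using x by (intro infsum_nonneg) auto
  have Sg: "((\<lambda>k. norm (\<gamma> k) * x k ^ M * exp (- x k * c)) has_sum Sg) A"
    unfolding Sg_def using sm by (rule has_sum_infsum)
  have main: "(\<lambda>k. \<gamma> k * u (x k)) summable_on A \<and> norm ((\<Sum>\<^sub>\<infinity>k\<in>A. \<gamma> k * u (x k)) - T u) \<le> \<epsilon> * (I + Sg)"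
    if \<epsilon>: "\<epsilon> > 0" for \<epsilon>
  proof -
    obtain n q where nq: "\<And>i t. i \<le> d \<Longrightarrow> t \<ge> 0 \<Longrightarrow>
     norm ((tderiv ^^ i) (\<lambda>t. \<eta> t - (\<Sum>j\<le>(n::nat). q j * exp (- of_real (c + real j) * of_real t))) t) \<le> \<epsilon> * exp (- c * t)"
      by (rule exponential_sum_approximation[OF s\<eta> _ c \<epsilon>, where b = b and d = d]) (erule \<eta>0, blast)
    define e where "e = (\<lambda>j t. exp (- complex_of_real (c + real j) * of_real t))"
    define g where "g = (\<lambda>t. \<Sum>j\<le>n. q j * e j t)"
    define \<delta> where "\<delta> = (\<lambda>t. \<eta> t - g t)"
    have se: "smooth_fun (e j)" for j unfolding e_def by (rule smooth_fun_exp(1))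
    have sg: "smooth_fun g" unfolding g_def by (intro smooth_fun_sum(1) smooth_fun_cmult(1) se)
    have s\<delta>: "smooth_fun \<delta>" unfolding \<delta>_def by (rule smooth_fun_diff(1)[OF s\<eta> sg])
    have b\<delta>: "norm ((tderiv ^^ i) \<delta> t) \<le> \<epsilon> * exp (- c * t)" if "i \<le> d" "t \<ge> 0" for i t
      using nq[OF that] unfolding \<delta>_def g_def e_def by simp
    define v where "v = (\<lambda>j t. of_real t ^ M * e j t)"
    define w where "w = (\<lambda>t. of_real t ^ M * g t)"
    have sv: "smooth_fun (v j)" for j unfolding v_def by (rule smooth_fun_power_mult[OF se])
    have w_eq: "w = (\<lambda>t. \<Sum>j\<le>n. q j * v j t)"
      by (simp add: w_def g_def v_def sum_distrib_left mult_ac)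
    have dw: "(tderiv ^^ d) w = (\<lambda>t. \<Sum>j\<le>n. q j * (tderiv ^^ d) (v j) t)"
      unfolding w_eq by (subst smooth_fun_sum(2)) (auto intro!: smooth_fun_cmult(1) sv simp: smooth_fun_cmult(2)[OF sv])
    have vint: "set_integrable lborel {0..} (\<lambda>t. G t * (tderiv ^^ d) (v j) t)" for j
    proof (rule set_integrable_poly_exp_bounded)
      show "poly_exp_bounded (0 + c) (\<lambda>t. G t * (tderiv ^^ d) (v j) t)"
        unfolding v_def e_def
        by (intro poly_exp_bounded_mult G(2) poly_exp_bounded_tderiv_power_exp) simp
      show "(\<lambda>t. G t * (tderiv ^^ d) (v j) t) \<in> borel_measurable borel"
        using G(1) measd[OF sv] by simp
    qed (use c in simp)
    have Tw: "T w = (\<Sum>j\<le>n. q j * T (v j))"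
    proof -
      have "(LINT t:{0..}|lborel. G t * (tderiv ^^ d) w t) =
        (LINT t:{0..}|lborel. (\<Sum>j\<le>n. q j * (G t * (tderiv ^^ d) (v j) t)))"
        unfolding dw by (simp add: sum_distrib_left mult_ac)
      also have "\<dots> = (\<Sum>j\<le>n. q j * (LINT t:{0..}|lborel. G t * (tderiv ^^ d) (v j) t))"
        by (rule set_integral_sum_cmult) (rule vint)
      finally show ?thesis unfolding T_def by (simp add: sum_distrib_left mult_ac)
    qed
    have "((\<lambda>k. \<gamma> k * v j (x k)) has_sum T (v j)) A" for j
      using eq[of "c + real j"] unfolding v_def e_def T_def by simp
    hence "((\<lambda>k. \<Sum>j\<le>n. q j * (\<gamma> k * v j (x k))) has_sum (\<Sum>j\<le>n. q j * T (v j))) A"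
      by (intro has_sum_finite_sum has_sum_cmult_right) auto
    moreover have "\<gamma> k * w (x k) = (\<Sum>j\<le>n. q j * (\<gamma> k * v j (x k)))" for k
      by (simp add: w_eq sum_distrib_left mult.left_commute)
    ultimately have hw: "((\<lambda>k. \<gamma> k * w (x k)) has_sum T w) A"
      by (simp only: Tw)
    have dint: "set_integrable lborel {0..} (\<lambda>t. G t * (tderiv ^^ d) w t)"
    proof -
      have "set_integrable lborel {0..} (\<lambda>t. \<Sum>j\<le>n. q j * (G t * (tderiv ^^ d) (v j) t))"
        unfolding set_integrable_def scaleR_sum_right
        by (rule Bochner_Integration.integrable_sum)
           (rule set_integrable_mult_right[OF vint, unfolded set_integrable_def])
      thus ?thesis unfolding dw by (simp add: sum_distrib_left mult.left_commute)
    qed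
    define r where "r = (\<lambda>t. of_real t ^ M * \<delta> t)"
    have r_eq: "r t = u t - w t" for t by (simp add: r_def \<delta>_def u_eq w_def right_diff_distrib)
    have sw: "smooth_fun w" unfolding w_def by (rule smooth_fun_power_mult[OF sg])
    have dr: "(tderiv ^^ d) r = (\<lambda>t. (tderiv ^^ d) u t - (tderiv ^^ d) w t)"
      unfolding r_eq[abs_def] by (rule smooth_fun_diff(2)[OF u(1) sw])
    have rs: "norm (T r) \<le> \<epsilon> * I" "set_integrable lborel {0..} (\<lambda>t. G t * (tderiv ^^ d) r t)"
      using small[OF s\<delta> b\<delta>] \<epsilon> unfolding r_def by auto
    have "(LINT t:{0..}|lborel. G t * (tderiv ^^ d) u t) =
        (LINT t:{0..}|lborel. G t * (tderiv ^^ d) r t + G t * (tderiv ^^ d) w t)"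
      unfolding dr by (simp add: algebra_simps)
    also have "\<dots> = (LINT t:{0..}|lborel. G t * (tderiv ^^ d) r t) + (LINT t:{0..}|lborel. G t * (tderiv ^^ d) w t)"
      using rs(2) dint by (rule set_integral_add(2))
    finally have Tu: "T u = T r + T w" unfolding T_def by (simp add: distrib_left)
    have hr: "norm (\<gamma> k * r (x k)) \<le> \<epsilon> * (norm (\<gamma> k) * x k ^ M * exp (- x k * c))" if k: "k \<in> A" for k
    proof -
      have "norm (\<gamma> k * r (x k)) = norm (\<gamma> k) * x k ^ M * norm (\<delta> (x k))"
        using x[OF k] by (simp add: r_def norm_mult norm_power)
      also have "\<dots> \<le> norm (\<gamma> k) * x k ^ M * (\<epsilon> * exp (- c * x k))"
        using b\<delta>[of 0 "x k"] x[OF k] by (intro mult_left_mono) auto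
      finally show ?thesis by (simp add: mult_ac)
    qed
    have esg: "((\<lambda>k. \<epsilon> * (norm (\<gamma> k) * x k ^ M * exp (- x k * c))) has_sum \<epsilon> * Sg) A"
      by (rule has_sum_cmult_right[OF Sg])
    have "(\<lambda>k. norm (\<gamma> k * r (x k))) summable_on A"
      using has_sum_imp_summable[OF esg] by (rule summable_on_comparison_test) (use hr in auto)
    hence "(\<lambda>k. \<gamma> k * r (x k)) summable_on A" by (rule abs_summable_summable)
    then obtain Z where Z: "((\<lambda>k. \<gamma> k * r (x k)) has_sum Z) A" by (auto simp: summable_on_def)
    have nZ: "norm Z \<le> \<epsilon> * Sg" by (rule norm_infsum_le[OF Z esg hr])
    have "((\<lambda>k. \<gamma> k * r (x k) + \<gamma> k * w (x k)) has_sum Z + T w) A"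
      by (rule has_sum_add[OF Z hw])
    hence hu: "((\<lambda>k. \<gamma> k * u (x k)) has_sum Z + T w) A" by (simp add: r_eq algebra_simps)
    have "norm (Z + T w - T u) \<le> norm Z + norm (T r)"
      unfolding Tu using norm_triangle_ineq4[of Z "T r"] by simp
    hence "norm (Z + T w - T u) \<le> \<epsilon> * (I + Sg)" using nZ rs(1) by (simp add: algebra_simps)
    thus ?thesis using hu by (auto simp: has_sum_iff)
  qed
  have "norm ((\<Sum>\<^sub>\<infinity>k\<in>A. \<gamma> k * u (x k)) - T u) \<le> 0"
  proof (rule field_le_epsilon)
    fix e :: real assume e: "e > 0"
    have "norm ((\<Sum>\<^sub>\<infinity>k\<in>A. \<gamma> k * u (x k)) - T u) \<le> e / (I + Sg + 1) * (I + Sg)"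
      using main[of "e / (I + Sg + 1)"] e I0 Sg0 by auto
    also have "\<dots> \<le> e" using e I0 Sg0 by (simp add: field_simps)
    finally show "norm ((\<Sum>\<^sub>\<infinity>k\<in>A. \<gamma> k * u (x k)) - T u) \<le> 0 + e" by simp
  qed
  hence "(\<Sum>\<^sub>\<infinity>k\<in>A. \<gamma> k * u (x k)) = T u" by simp
  thus ?thesis using main[of 1] unfolding T_def by (auto simp: has_sum_iff)
qed

section \<open>Pairing with power exponentials\<close>

lemma smooth_fun_power_exp: "smooth_fun (\<lambda>t. of_real t ^ M * exp (z * of_real t))"
  by (rule smooth_fun_power_mult[OF smooth_fun_exp(1)])

text \<open>
  The functions \<open>t\<^sup>M e\<^bsup>-st\<^esup>\<close> vanish at 0 to order \<open>M \<ge> d\<close>.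
\<close>

lemma integral_by_parts_power_exp:
  fixes h :: "nat \<Rightarrow> real \<Rightarrow> complex"
  assumes h: "\<And>i t. i < d \<Longrightarrow> (h i has_vector_derivative h (Suc i) t) (at t)"
      "\<And>i. continuous_on UNIV (h i)" "\<And>i. poly_exp_bounded 0 (h i)" and s: "s > 0" "d \<le> M"
  shows "(-1) ^ d * (LINT t:{0..}|lborel. h 0 t * (tderiv ^^ d) (power_exp M s) t)
    = (LINT t:{0..}|lborel. h d t * power_exp M s t)"
proof (rule integral_by_parts_Ici_iterated[where c = s and h = h])
  show "smooth_fun (power_exp M s)" by (rule smooth_fun_power_exp)
  show "poly_exp_bounded s ((tderiv ^^ i) (power_exp M s))" for i
    by (rule poly_exp_bounded_tderiv_power_exp) simp
  show "(tderiv ^^ i) (power_exp M s) 0 = 0" if "i < d" for i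
    by (rule tderiv_power_mult_at_0[OF smooth_fun_exp(1)]) (use that s in simp)
qed (use s h in auto)

text \<open>
  The reason why, for \<open>d \<ge> 1\<close>, subtracting \<open>K\<^sub>d(0)\<close> in the definition of the Newton-Cramer distribution does no harm.
\<close>

lemma integral_const_tderiv_power_exp:
  assumes "s > 0" "1 \<le> d" "d \<le> M"
  shows "(LINT t:{0..}|lborel. k * (tderiv ^^ d) (power_exp M s) t) = 0"
proof -
  let ?h = "\<lambda>(i::nat) (t::real). if i = 0 then k else 0"
  have "(-1) ^ d * (LINT t:{0..}|lborel. ?h 0 t * (tderiv ^^ d) (power_exp M s) t)
    = (LINT t:{0..}|lborel. ?h d t * power_exp M s t)"
  proof (rule integral_by_parts_power_exp[where h = ?h])
    show "poly_exp_bounded 0 (?h i)" for i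
      by (rule poly_exp_boundedI[where C = "norm k" and p = 0]) auto
  qed (use assms in auto)
  thus ?thesis using assms by simp
qed

lemma integral_power_tderiv_power_exp:
  assumes "s > 0" "d \<le> M"
  shows "(-1) ^ d * (LINT t:{0..}|lborel. of_real (t ^ d / fact d) *
           (tderiv ^^ d) (power_exp M s) t) = fact M / of_real s ^ Suc M"
proof -
  let ?h = "\<lambda>i t. complex_of_real (t ^ (d - i) / fact (d - i))"
  have "(-1) ^ d * (LINT t:{0..}|lborel. ?h 0 t * (tderiv ^^ d) (power_exp M s) t)
    = (LINT t:{0..}|lborel. ?h d t * power_exp M s t)"
  proof (rule integral_by_parts_power_exp[where h = ?h])
    show "poly_exp_bounded 0 (?h i)" for i
      using poly_exp_bounded_cmult[OF poly_exp_bounded_power, of "1 / fact (d - i)" "d - i"] by (simp add: field_simps)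
    fix i t assume i: "i < d"
    then obtain e where e: "d - i = Suc e" "d - Suc i = e" by (metis Suc_diff_Suc)
    have "((\<lambda>t. t ^ Suc e / fact (Suc e)) has_real_derivative t ^ e / fact e) (at t)"
      by (rule derivative_eq_intros refl | simp add: fact_Suc field_simps del: of_nat_Suc)+
    thus "(?h i has_vector_derivative ?h (Suc i) t) (at t)"
      unfolding e by (rule has_vector_derivative_of_real)
  next
    show "continuous_on UNIV (?h i)" for i by (intro continuous_intros) auto
  qed (use assms in auto)
  thus ?thesis using integral_power_exp_Ici[of "of_real s" M] assms by simp
qed

lemma integral_exp_tderiv_power_exp:
  fixes z :: complex
  assumes "s > 0" "d \<le> M" "z \<noteq> 0" "Re z \<le> 0"
  shows "(-1) ^ d * (LINT t:{0..}|lborel. (1 / z ^ d * exp (z * of_real t)) *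
           (tderiv ^^ d) (power_exp M s) t) = fact M / (of_real s - z) ^ Suc M"
proof -
  let ?h = "\<lambda>i t. z ^ i / z ^ d * exp (z * of_real t)"
  have "(-1) ^ d * (LINT t:{0..}|lborel. ?h 0 t * (tderiv ^^ d) (power_exp M s) t)
    = (LINT t:{0..}|lborel. ?h d t * power_exp M s t)"
  proof (rule integral_by_parts_power_exp[where h = ?h])
    show "poly_exp_bounded 0 (?h i)" for i
      using assms by (intro poly_exp_bounded_cmult poly_exp_bounded_exp) auto
    show "(?h i has_vector_derivative ?h (Suc i) t) (at t)" for i t
      using has_vector_derivative_mult_right[OF has_vector_derivative_exp_linear, of "z ^ i / z ^ d" z t] by (simp add: mult_ac)
  next
    show "continuous_on UNIV (?h i)" for i by (intro continuous_intros)
  qed (use assms in auto)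
  also have "(LINT t:{0..}|lborel. ?h d t * power_exp M s t) =
     (LINT t:{0..}|lborel. of_real t ^ M * exp (- (of_real s - z) * of_real t))"
  proof -
    have "?h d t * power_exp M s t = of_real t ^ M * exp (- (of_real s - z) * of_real t)" for t
    proof -
      have "exp (z * of_real t) * exp (- of_real s * of_real t) = exp (- (of_real s - z) * of_real t)"
        unfolding exp_add[symmetric] by (simp add: algebra_simps)
      thus ?thesis using assms(3) by (simp add: mult.left_commute)
    qed
    thus ?thesis by (simp only:)
  qed
  also have "\<dots> = fact M / (of_real s - z) ^ Suc M"
    using assms by (intro integral_power_exp_Ici) auto
  finally show ?thesis by simp
qed

text \<open>
  The sum defining \<open>K\<^sub>d\<close> converges absolutely and is dominated on the half-line by a constant multiple
  of \<open>(1 + t)\<^sup>d\<close>, since the exponents \<open>\<rho> - \<sigma>\<^sub>1\<close> have non-positive real part. Dominated convergence along an exhaustion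
  by discs reduces the pairing to single terms. The discs are centred at \<open>c\<close> to match the sums
  in \<open>meromorphic_finite_order_logderiv\<close>.
\<close>

lemma Kd_properties:
  fixes f :: "complex \<Rightarrow> complex"
  defines "d \<equiv> convergence_exponent f" and "\<sigma> \<equiv> sigma1 f" and "S \<equiv> divisor_support f"
  assumes fin: "\<And>R. finite (S \<inter> cball c R)"
    and sm: "(\<lambda>\<rho>. \<bar>real_of_int (zorder f \<rho>)\<bar> / norm (\<rho> - of_real \<sigma>) ^ d) summable_on S - {of_real \<sigma>}"
    and re: "\<And>\<rho>. \<rho> \<in> S \<Longrightarrow> Re \<rho> \<le> \<sigma>"
  shows "Kd f \<in> borel_measurable borel" "poly_exp_bounded 0 (Kd f)"
    "\<And>M s. d \<le> M \<Longrightarrow> s > 0 \<Longrightarrow>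
      (\<lambda>n. \<Sum>\<rho>\<in>S \<inter> cball c (real n). of_int (zorder f \<rho>) * (fact M / (of_real (s + \<sigma>) - \<rho>) ^ Suc M))
      \<longlonglongrightarrow> (-1) ^ d * (LINT t:{0..}|lborel. Kd f t * (tderiv ^^ d) (power_exp M s) t)"
proof -
  define w where "w = complex_of_real \<sigma>"
  define e where "e = (\<lambda>\<rho> t. if \<rho> = w then complex_of_real (t ^ d / fact d) else 1 / (\<rho> - w) ^ d * exp ((\<rho> - w) * of_real t))"
  define T where "T = (\<lambda>n. S \<inter> cball c (real n))"
  define K where "K = (\<lambda>n t. \<Sum>\<rho>\<in>T n. of_int (zorder f \<rho>) * e \<rho> t)"
  have finT: "finite (T n)" for n using fin by (simp add: T_def)
  have T_top: "filterlim (\<lambda>n. T n - {w}) (finite_subsets_at_top (S - {w})) sequentially"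
    unfolding filterlim_finite_subsets_at_top
  proof safe
    fix F assume F: "finite F" "F \<subseteq> S - {w}"
    obtain R where R: "\<And>x. x \<in> F \<Longrightarrow> dist c x \<le> R"
      using finite_imp_bounded[OF F(1)] unfolding bounded_any_center[where a = c] by auto
    have "eventually (\<lambda>n. real n \<ge> R) sequentially"
      by (rule eventually_compose_filterlim[OF eventually_ge_at_top filterlim_real_sequentially])
    thus "eventually (\<lambda>n. finite (T n - {w}) \<and> F \<subseteq> T n - {w} \<and> T n - {w} \<subseteq> S - {w}) sequentially"
      by eventually_elim (use finT F R in \<open>force simp: T_def\<close>)
  qed
  have ew: "e \<rho> t = 1 / (\<rho> - w) ^ d * exp ((\<rho> - w) * of_real t)" if "\<rho> \<in> S - {w}" for \<rho> t
    using that by (simp add: e_def)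
  have e_bd: "norm (of_int (zorder f \<rho>) * e \<rho> t) \<le> \<bar>real_of_int (zorder f \<rho>)\<bar> / norm (\<rho> - w) ^ d"
    if "\<rho> \<in> S - {w}" "t \<ge> 0" for \<rho> t
  proof -
    have "Re ((\<rho> - w) * of_real t) \<le> 0" using re[of \<rho>] that by (simp add: w_def mult_nonpos_nonneg)
    hence "norm (exp ((\<rho> - w) * of_real t)) \<le> 1" by simp
    hence "\<bar>real_of_int (zorder f \<rho>)\<bar> / norm (\<rho> - w) ^ d * norm (exp ((\<rho> - w) * of_real t)) \<le>
       \<bar>real_of_int (zorder f \<rho>)\<bar> / norm (\<rho> - w) ^ d * 1"
      by (intro mult_left_mono) auto
    thus ?thesis using that by (simp add: ew norm_mult norm_divide norm_power)
  qed
  define b where "b = (\<lambda>\<rho>. \<bar>real_of_int (zorder f \<rho>)\<bar> / norm (\<rho> - w) ^ d)"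
  define B where "B = (\<Sum>\<^sub>\<infinity>\<rho>\<in>S - {w}. b \<rho>)"
  have bsm: "b summable_on S - {w}" using sm by (simp add: b_def w_def)
  have b0: "b \<rho> \<ge> 0" for \<rho> by (simp add: b_def)
  have zw: "zorder f w = 0" if "w \<notin> S" using that by (simp add: S_def divisor_support_def)
  define n0 where "n0 = (of_int (zorder f w) :: complex)"
  have K_split: "K n t = (if w \<in> T n then n0 * of_real (t ^ d / fact d) else 0) + (\<Sum>\<rho>\<in>T n - {w}. of_int (zorder f \<rho>) * e \<rho> t)" for n t
  proof -
    have "e w t = of_real (t ^ d / fact d)" by (simp add: e_def)
    thus ?thesis using sum.remove[OF finT[of n], of w "\<lambda>\<rho>. of_int (zorder f \<rho>) * e \<rho> t"]
      by (auto simp: K_def n0_def)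
  qed
  have Kd_eq: "Kd f t = (n0 * of_real (t ^ d / fact d) + (\<Sum>\<^sub>\<infinity>\<rho>\<in>S - {w}. of_int (zorder f \<rho>) * e \<rho> t)) * indicator {0..} t" for t
  proof -
    have "(\<Sum>\<^sub>\<infinity>\<rho>\<in>S - {w}. of_int (zorder f \<rho>) * e \<rho> t) = (\<Sum>\<^sub>\<infinity>\<rho>\<in>S - {w}. of_int (zorder f \<rho>) / (\<rho> - w) ^ d * exp ((\<rho> - w) * of_real t))"
      by (rule infsum_cong) (simp add: ew)
    thus ?thesis unfolding Kd_def Let_def by (simp add: n0_def w_def d_def \<sigma>_def S_def)
  qed
  have lim: "(\<lambda>n. K n t) \<longlonglongrightarrow> Kd f t" if t: "t \<ge> 0" for t
  proof -
    have "(\<lambda>\<rho>. norm (of_int (zorder f \<rho>) * e \<rho> t)) summable_on S - {w}"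
      using bsm by (rule summable_on_comparison_test) (unfold b_def, erule e_bd[OF _ t], rule norm_ge_zero)
    hence "((\<lambda>\<rho>. of_int (zorder f \<rho>) * e \<rho> t) has_sum (\<Sum>\<^sub>\<infinity>\<rho>\<in>S - {w}. of_int (zorder f \<rho>) * e \<rho> t)) (S - {w})"
      by (rule has_sum_infsum[OF abs_summable_summable])
    hence 1: "(\<lambda>n. \<Sum>\<rho>\<in>T n - {w}. of_int (zorder f \<rho>) * e \<rho> t) \<longlonglongrightarrow> (\<Sum>\<^sub>\<infinity>\<rho>\<in>S - {w}. of_int (zorder f \<rho>) * e \<rho> t)"
      unfolding has_sum_def by (rule filterlim_compose[OF _ T_top])
    have "eventually (\<lambda>n. real n \<ge> dist c w) sequentially"
      by (rule eventually_compose_filterlim[OF eventually_ge_at_top filterlim_real_sequentially])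
    hence 2: "(\<lambda>n. if w \<in> T n then n0 * of_real (t ^ d / fact d) else 0) \<longlonglongrightarrow> n0 * of_real (t ^ d / fact d)"
      by (intro tendsto_eventually, elim eventually_mono) (use zw in \<open>auto simp: T_def n0_def\<close>)
    show ?thesis using tendsto_add[OF 2 1] t unfolding K_split Kd_eq by simp
  qed
  have K_bd: "norm (K n t) \<le> (norm n0 + B) * (1 + t) ^ d" if t: "t \<ge> 0" for n t
  proof -
    have "norm (\<Sum>\<rho>\<in>T n - {w}. of_int (zorder f \<rho>) * e \<rho> t) \<le> (\<Sum>\<rho>\<in>T n - {w}. b \<rho>)"
    proof (rule sum_norm_le)
      fix \<rho> assume "\<rho> \<in> T n - {w}"
      hence "\<rho> \<in> S - {w}" by (simp add: T_def)
      thus "norm (of_int (zorder f \<rho>) * e \<rho> t) \<le> b \<rho>" unfolding b_def by (rule e_bd[OF _ t])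
    qed
    also have "\<dots> \<le> B" unfolding B_def
      using finT bsm b0 by (intro finite_sum_le_infsum) (auto simp: T_def)
    finally have 1: "norm (\<Sum>\<rho>\<in>T n - {w}. of_int (zorder f \<rho>) * e \<rho> t) \<le> B" .
    have "t ^ d / fact d \<le> t ^ d / 1" using t by (intro divide_left_mono) (auto simp: fact_ge_1)
    also have "\<dots> \<le> (1 + t) ^ d" using t by (auto intro: power_mono)
    finally have "norm n0 * (t ^ d / fact d) \<le> norm n0 * (1 + t) ^ d" by (intro mult_left_mono) auto
    hence 2: "norm (if w \<in> T n then n0 * of_real (t ^ d / fact d) else 0) \<le> norm n0 * (1 + t) ^ d"
      using t by (auto simp: norm_mult norm_divide norm_power)
    have B0: "B \<ge> 0" unfolding B_def by (intro infsum_nonneg b0)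
    have "B * 1 \<le> B * (1 + t) ^ d" using t B0 by (intro mult_left_mono one_le_power) auto
    moreover have "norm (K n t) \<le> norm n0 * (1 + t) ^ d + B"
      unfolding K_split using norm_triangle_mono[OF 2 1] .
    ultimately show ?thesis by (simp add: algebra_simps)
  qed
  have e_cont: "continuous_on UNIV (e \<rho>)" for \<rho>
    by (cases "\<rho> = w") (auto simp: e_def intro!: continuous_intros)
  have K_cont: "continuous_on UNIV (K n)" for n
    unfolding K_def by (intro continuous_on_sum continuous_on_mult continuous_on_const e_cont)
  have K_meas: "K n \<in> borel_measurable borel" for n
    using K_cont by (rule borel_measurable_continuous_onI)
  show meas: "Kd f \<in> borel_measurable borel"
  proof (rule borel_measurable_LIMSEQ_metric)
    show "(\<lambda>t. K n t * indicator {0..} t) \<in> borel_measurable borel" for n using K_meas[of n] by simp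
    show "(\<lambda>n. K n t * indicator {0..} t) \<longlonglongrightarrow> Kd f t" for t
      using lim[of t] by (cases "t \<ge> 0") (auto simp: Kd_eq)
  qed
  show "poly_exp_bounded 0 (Kd f)"
  proof (rule poly_exp_boundedI)
    fix t :: real assume t: "t \<ge> 0"
    have "norm (Kd f t) \<le> (norm n0 + B) * (1 + t) ^ d"
      by (rule tendsto_upperbound[OF tendsto_norm[OF lim[OF t]]]) (use K_bd[OF t] in auto)
    thus "norm (Kd f t) \<le> (norm n0 + B) * (1 + t) ^ d * exp (- 0 * t)" by simp
  qed
  fix M s assume M: "d \<le> M" and s: "(s::real) > 0"
  define W where "W = (tderiv ^^ d) (power_exp M s)"
  have W_pb: "poly_exp_bounded s W" unfolding W_def by (rule poly_exp_bounded_tderiv_power_exp) simp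
  have W_meas: "W \<in> borel_measurable borel" unfolding W_def
    by (intro borel_measurable_continuous_onI smooth_fun_continuous smooth_fun_power_exp)

  have e_pb: "poly_exp_bounded 0 (e \<rho>)" if "\<rho> \<in> S" for \<rho>
  proof (cases "\<rho> = w")
    case True
    thus ?thesis using poly_exp_bounded_cmult[OF poly_exp_bounded_power, of "1 / fact d" d]
      by (simp add: e_def[abs_def] field_simps)
  next
    case False
    thus ?thesis using re[OF that] unfolding e_def
      by (simp only: if_False) (intro poly_exp_bounded_cmult poly_exp_bounded_exp, simp add: w_def)
  qed
  have e_int: "set_integrable lborel {0..} (\<lambda>t. e \<rho> t * W t)" if "\<rho> \<in> S" for \<rho>
    using poly_exp_bounded_mult[OF e_pb[OF that] W_pb] W_meas s borel_measurable_continuous_onI[OF e_cont[of \<rho>]]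
    by (intro set_integrable_poly_exp_bounded[of s]) auto
  have e_val: "(-1) ^ d * (LINT t:{0..}|lborel. e \<rho> t * W t) = fact M / (of_real (s + \<sigma>) - \<rho>) ^ Suc M"
    if "\<rho> \<in> S" for \<rho>
  proof (cases "\<rho> = w")
    case True
    thus ?thesis using integral_power_tderiv_power_exp[OF s M] unfolding W_def e_def by (simp add: w_def)
  next
    case False
    have "of_real s - (\<rho> - w) = of_real (s + \<sigma>) - \<rho>" by (simp add: w_def)
    moreover have "\<rho> - w \<noteq> 0" "Re (\<rho> - w) \<le> 0" using False re[OF that] by (auto simp: w_def)
    moreover have "e \<rho> = (\<lambda>t. 1 / (\<rho> - w) ^ d * exp ((\<rho> - w) * of_real t))"
      using False by (simp add: e_def)
    ultimately show ?thesis
      using integral_exp_tderiv_power_exp[OF s M, of "\<rho> - w", folded W_def] by (simp only: not_False_eq_True)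
  qed
  have K_val: "(-1) ^ d * (LINT t:{0..}|lborel. K n t * W t) =
       (\<Sum>\<rho>\<in>T n. of_int (zorder f \<rho>) * (fact M / (of_real (s + \<sigma>) - \<rho>) ^ Suc M))" for n
  proof -
    have "(LINT t:{0..}|lborel. K n t * W t) = (LINT t:{0..}|lborel. (\<Sum>\<rho>\<in>T n. of_int (zorder f \<rho>) * (e \<rho> t * W t)))"
      by (simp add: K_def sum_distrib_right mult.assoc)
    also have "\<dots> = (\<Sum>\<rho>\<in>T n. of_int (zorder f \<rho>) * (LINT t:{0..}|lborel. e \<rho> t * W t))"
      by (rule set_integral_sum_cmult) (use e_int in \<open>auto simp: T_def\<close>)
    finally have "(-1) ^ d * (LINT t:{0..}|lborel. K n t * W t) =
        (\<Sum>\<rho>\<in>T n. of_int (zorder f \<rho>) * ((-1) ^ d * (LINT t:{0..}|lborel. e \<rho> t * W t)))"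
      by (simp add: sum_distrib_left mult.left_commute)
    also have "\<dots> = (\<Sum>\<rho>\<in>T n. of_int (zorder f \<rho>) * (fact M / (of_real (s + \<sigma>) - \<rho>) ^ Suc M))"
      by (intro sum.cong refl arg_cong2[where f = "(*)"] e_val) (auto simp: T_def)
    finally show ?thesis .
  qed
  have "(\<lambda>n. (LINT t:{0..}|lborel. K n t * W t)) \<longlonglongrightarrow> (LINT t:{0..}|lborel. Kd f t * W t)"
    unfolding set_lebesgue_integral_def
  proof (rule integral_dominated_convergence[where w = "\<lambda>t. indicator {0..} t *\<^sub>R norm (of_real ((norm n0 + B) * (1 + t) ^ d) * W t)"])
    have "poly_exp_bounded 0 (\<lambda>t. of_real ((norm n0 + B) * (1 + t) ^ d))"
      by (rule poly_exp_boundedI[where C = "\<bar>norm n0 + B\<bar>" and p = d]) (auto simp: norm_mult norm_power simp flip: of_real_add)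
    from poly_exp_bounded_mult[OF this W_pb] have
      "set_integrable lborel {0..} (\<lambda>t. of_real ((norm n0 + B) * (1 + t) ^ d) * W t)"
      using W_meas s by (intro set_integrable_poly_exp_bounded[of s]) auto
    from set_integrable_norm[OF this]
    show "integrable lborel (\<lambda>t. indicator {0..} t *\<^sub>R norm (of_real ((norm n0 + B) * (1 + t) ^ d) * W t))"
      by (simp add: set_integrable_def)
    show "AE t in lborel. (\<lambda>n. indicator {0..} t *\<^sub>R (K n t * W t)) \<longlonglongrightarrow> indicator {0..} t *\<^sub>R (Kd f t * W t)"
      using lim by (intro AE_I2) (auto simp: indicator_def intro!: tendsto_intros)
    show "AE t in lborel. norm (indicator {0..} t *\<^sub>R (K n t * W t))
        \<le> indicator {0..} t *\<^sub>R norm (of_real ((norm n0 + B) * (1 + t) ^ d) * W t)" for n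
    proof (intro AE_I2)
      fix t :: real
      show "norm (indicator {0..} t *\<^sub>R (K n t * W t))
        \<le> indicator {0..} t *\<^sub>R norm (of_real ((norm n0 + B) * (1 + t) ^ d) * W t)"
      proof (cases "t \<ge> 0")
        case True
        have "norm (K n t) * norm (W t) \<le> \<bar>(norm n0 + B) * (1 + t) ^ d\<bar> * norm (W t)"
          using K_bd[OF True, of n] by (intro mult_right_mono) auto
        thus ?thesis using True by (simp only: norm_mult norm_of_real) (simp add: norm_mult)
      qed simp
    qed
  qed (use K_meas W_meas meas in auto)
  hence "(\<lambda>n. (-1) ^ d * (LINT t:{0..}|lborel. K n t * W t)) \<longlonglongrightarrow> (-1) ^ d * (LINT t:{0..}|lborel. Kd f t * W t)"
    by (intro tendsto_intros)
  from this[unfolded K_val] show "(\<lambda>n. \<Sum>\<rho>\<in>S \<inter> cball c (real n). of_int (zorder f \<rho>) * (fact M / (of_real (s + \<sigma>) - \<rho>) ^ Suc M))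
      \<longlonglongrightarrow> (-1) ^ d * (LINT t:{0..}|lborel. Kd f t * (tderiv ^^ d) (power_exp M s) t)"
    unfolding T_def W_def .
qed

section \<open>The Newton-Cramer distribution\<close>

lemma finite_of_summable_ge_1:
  fixes g :: "'a \<Rightarrow> real"
  assumes "g summable_on S" "\<And>x. x \<in> S \<Longrightarrow> g x \<ge> 1"
  shows "finite S"
proof (rule ccontr)
  assume inf: "infinite S"
  obtain n :: nat where n: "infsum g S < real n" using reals_Archimedean2 by blast
  obtain F where F: "F \<subseteq> S" "finite F" "card F = n" using infinite_arbitrarily_large[OF inf] by metis
  have "real n = (\<Sum>x\<in>F. 1)" using F by simp
  also have "\<dots> \<le> sum g F" using F assms(2) by (intro sum_mono) auto
  also have "\<dots> \<le> infsum g S"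
    using assms F by (intro finite_sum_le_infsum) (auto intro: order_trans[of 0 1])
  finally show False using n by simp
qed

lemma tendsto_power_times_partial_fraction:
  "((\<lambda>s::real. of_real s ^ Suc M * (1 / (of_real (s + \<sigma>) - \<rho>) ^ Suc M)) \<longlongrightarrow> (1::complex)) at_top"
proof -
  have i: "((\<lambda>s::real. inverse (complex_of_real s)) \<longlongrightarrow> 0) at_top"
    using tendsto_of_real[OF tendsto_inverse_0_at_top[OF filterlim_ident], where 'a = complex] by simp
  have "((\<lambda>s::real. 1 / (1 + (of_real \<sigma> - \<rho>) * inverse (complex_of_real s)) ^ Suc M) \<longlongrightarrow> 1 / (1 + (of_real \<sigma> - \<rho>) * 0) ^ Suc M) at_top"
    by (intro tendsto_intros i) simp
  hence "((\<lambda>s::real. 1 / (1 + (of_real \<sigma> - \<rho>) * inverse (complex_of_real s)) ^ Suc M) \<longlongrightarrow> 1) at_top" by simp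
  thus ?thesis
  proof (rule Lim_transform_eventually)
    show "eventually (\<lambda>s::real. 1 / (1 + (of_real \<sigma> - \<rho>) * inverse (complex_of_real s)) ^ Suc M =
       of_real s ^ Suc M * (1 / (of_real (s + \<sigma>) - \<rho>) ^ Suc M)) at_top"
      using eventually_gt_at_top[of 0]
    proof eventually_elim
      case (elim s)
      have "of_real (s + \<sigma>) - \<rho> = of_real s * (1 + (of_real \<sigma> - \<rho>) * inverse (complex_of_real s))"
        using elim by (simp add: field_simps)
      hence "(of_real (s + \<sigma>) - \<rho>) ^ Suc M = of_real s ^ Suc M * (1 + (of_real \<sigma> - \<rho>) * inverse (complex_of_real s)) ^ Suc M"
        by (simp only: power_mult_distrib)
      thus ?case using elim by simp
    qed
  qed
qed

text \<open>
  Multiplied by \<open>s\<^bsup>M+1\<^esup>\<close>, the sum tends to \<open>M!\<close> times the total mass as \<open>s\<close> tends to infinity, and also to 0.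
  For \<open>d = 0\<close> this shows that a finite divisor has degree 0.
\<close>

lemma sum_eq_0_of_exponential_decay:
  fixes m :: "complex \<Rightarrow> complex"
  assumes "finite S" "\<delta> > 0"
    and bd: "\<And>s. s \<ge> b \<Longrightarrow> norm (\<Sum>\<rho>\<in>S. m \<rho> * (fact M / (of_real (s + \<sigma>) - \<rho>) ^ Suc M)) \<le> exp (- \<delta> * (s - b)) * B"
  shows "(\<Sum>\<rho>\<in>S. m \<rho>) = 0"
proof -
  define I where "I = (\<lambda>s. \<Sum>\<rho>\<in>S. m \<rho> * (fact M / (complex_of_real (s + \<sigma>) - \<rho>) ^ Suc M))"
  have "((\<lambda>s. \<Sum>\<rho>\<in>S. m \<rho> * fact M * (of_real s ^ Suc M * (1 / (of_real (s + \<sigma>) - \<rho>) ^ Suc M)))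
      \<longlongrightarrow> (\<Sum>\<rho>\<in>S. m \<rho> * fact M * 1)) at_top"
    by (intro tendsto_intros tendsto_power_times_partial_fraction)
  also have "(\<lambda>s. \<Sum>\<rho>\<in>S. m \<rho> * fact M * (of_real s ^ Suc M * (1 / (of_real (s + \<sigma>) - \<rho>) ^ Suc M)))
      = (\<lambda>s. of_real s ^ Suc M * I s)"
    by (simp add: I_def sum_distrib_left mult_ac del: power_Suc)
  finally have L1: "((\<lambda>s. of_real s ^ Suc M * I s) \<longlongrightarrow> (\<Sum>\<rho>\<in>S. m \<rho> * fact M * 1)) at_top" .
  have L2: "((\<lambda>s. of_real s ^ Suc M * I s) \<longlongrightarrow> 0) at_top"
  proof (rule Lim_null_comparison)
    have "((\<lambda>s. s ^ Suc M * exp (- \<delta> * (s - b)) * B) \<longlongrightarrow> 0) at_top"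
      using assms(2) by real_asymp
    thus "((\<lambda>s. s ^ Suc M * (exp (- \<delta> * (s - b)) * B)) \<longlongrightarrow> 0) at_top" by (simp only: mult.assoc)
    show "eventually (\<lambda>s. norm (of_real s ^ Suc M * I s) \<le> s ^ Suc M * (exp (- \<delta> * (s - b)) * B)) at_top"
      using eventually_ge_at_top[of "max 0 b"]
    proof eventually_elim
      case (elim s)
      thus ?case using mult_left_mono[OF bd[of s, folded I_def], of "s ^ Suc M"]
        by (simp add: norm_mult norm_power I_def del: power_Suc)
    qed
  qed
  have "(\<Sum>\<rho>\<in>S. m \<rho> * fact M * 1) = 0" by (rule tendsto_unique[OF _ L1 L2]) simp
  thus ?thesis by (simp add: sum_distrib_right[symmetric])
qed

lemma funpow_distribution_deriv:
  "(distribution_deriv ^^ n) T \<phi> = (-1) ^ n * T ((tderiv ^^ n) \<phi>)"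
proof (induction n arbitrary: \<phi>)
  case (Suc n)
  have "(distribution_deriv ^^ Suc n) T \<phi> = - (distribution_deriv ^^ n) T (tderiv \<phi>)"
    by (simp add: distribution_deriv_def)
  also have "\<dots> = (-1) ^ Suc n * T ((tderiv ^^ n) (tderiv \<phi>))" by (simp add: Suc.IH)
  also have "(tderiv ^^ n) (tderiv \<phi>) = (tderiv ^^ Suc n) \<phi>" by (simp add: funpow_swap1)
  finally show ?case .
qed simp

lemma newton_cramer_eq:
  "newton_cramer f \<phi> = (-1) ^ convergence_exponent f *
     (LINT t:{0..}|lborel. (Kd f t - Kd f 0) * (tderiv ^^ convergence_exponent f) (\<lambda>t. of_real (exp (sigma1 f * t)) * \<phi> t) t)"
  unfolding newton_cramer_def distribution_mult_def funpow_distribution_deriv distribution_of_fun_def set_lebesgue_integral_def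
  by (intro arg_cong2[where f = "(*)"] refl Bochner_Integration.integral_cong) (auto simp: indicator_def)

lemma test_functions_support:
  assumes "\<phi> \<in> test_functions {0<..}"
  obtains a b where "smooth_fun \<phi>" "0 < a" "\<And>t. t < a \<Longrightarrow> \<phi> t = 0" "\<And>t. t > b \<Longrightarrow> \<phi> t = 0"
proof -
  define S where "S = closure {t. \<phi> t \<noteq> 0}"
  have S: "smooth_fun \<phi>" "compact S" "S \<subseteq> {0<..}"
    using assms by (simp_all add: test_functions_def S_def)
  have S0: "\<phi> t = 0" if "t \<notin> S" for t
    using that closure_subset[of "{t. \<phi> t \<noteq> 0}"] unfolding S_def by blast
  show ?thesis
  proof (cases "S = {}")
    case True
    thus ?thesis using that[of 1 0] S S0 by simp
  next
    case False
    obtain a where a: "a \<in> S" "\<And>t. t \<in> S \<Longrightarrow> a \<le> t" using compact_attains_inf[OF S(2) False] by blast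
    obtain b where b: "b \<in> S" "\<And>t. t \<in> S \<Longrightarrow> t \<le> b" using compact_attains_sup[OF S(2) False] by blast
    show ?thesis
    proof (rule that[of a b])
      show "\<phi> t = 0" if "t < a" for t using that a(2)[of t] S0[of t] by force
      show "\<phi> t = 0" if "t > b" for t using that b(2)[of t] S0[of t] by force
    qed (use S a in auto)
  qed
qed

text \<open>
  All ingredients are put together for \<open>u(t) = e\<^bsup>\<sigma>\<^sub>1 t\<^esup> \<phi>(t)\<close>; accordingly the masses \<open>x\<^sub>k b\<^sub>k\<close> are weighted by
  \<open>e\<^bsup>-\<sigma>\<^sub>1 x\<^sub>k\<^esup>\<close>. The common value \<open>I s\<close> of both functionals on \<open>t\<^sup>M e\<^bsup>-st\<^esup>\<close> is the derivative of order \<open>M\<close> of \<open>f'/f\<close>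
  at \<open>s + \<sigma>\<^sub>1\<close>, up to the sign.
\<close>

lemma newton_cramer_has_sum:
  assumes fr: "frequencies N l"
    and asm: "(\<lambda>n. norm (a n) * exp (- l n * \<tau>)) summable_on indices N"
    and f: "\<And>s. Re s > \<tau> \<Longrightarrow> f s = dirichlet_series N l a s"
    and mf: "meromorphic_finite_order f"
    and \<phi>: "smooth_fun \<phi>" "\<And>t. t < \<alpha> \<Longrightarrow> \<phi> t = 0" "\<And>t. t > \<beta> \<Longrightarrow> \<phi> t = 0" "\<alpha> > 0"
  shows "((\<lambda>k. of_real (pairing l k) * log_coeff a k * \<phi> (pairing l k)) has_sum newton_cramer f \<phi>) (Lambda N)"
proof -
  define d where "d = convergence_exponent f"
  define \<sigma> where "\<sigma> = sigma1 f"
  define S where "S = divisor_support f"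
  obtain s1 where s1: "f holomorphic_on {s. Re s > s1}" "\<And>s. Re s > s1 \<Longrightarrow> f s \<noteq> 0"
    "\<And>m s. Re s > s1 \<Longrightarrow>
       ((\<lambda>k. of_real (pairing l k) * log_coeff a k * (of_real (pairing l k) ^ m * exp (- (of_real (pairing l k) * s))))
          has_sum (-1) ^ m * (deriv ^^ m) (logderiv f) s) (Lambda N)"
    "\<And>m s. s > s1 \<Longrightarrow> (\<lambda>k. norm (log_coeff a k) * pairing l k ^ m * exp (- pairing l k * s)) summable_on Lambda N"
    using dirichlet_logderiv_expansion[OF fr asm f] by blast
  define V where "V = {s. Re s > s1}"
  have V: "open V" by (simp add: V_def open_halfspace_Re_gt)
  have "of_real (s1 + 1) \<in> V" by (simp add: V_def)
  hence Vne: "V \<noteq> {}" by blast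
  have Vf: "f holomorphic_on V" "\<And>w. w \<in> V \<Longrightarrow> f w \<noteq> 0" using s1(1,2) by (auto simp: V_def)
  obtain c p where cp: "\<And>R. finite (S \<inter> cball c R)"
    "\<exists>C\<ge>0. \<forall>R\<ge>1. (\<Sum>\<rho>\<in>S \<inter> cball c R. \<bar>real_of_int (zorder f \<rho>)\<bar>) \<le> C * R ^ p"
    "\<And>m z. m \<ge> p \<Longrightarrow> z \<in> V \<Longrightarrow>
      (\<lambda>n. \<Sum>\<rho>\<in>S \<inter> cball c (real n). of_int (zorder f \<rho>) * ((-1) ^ m * fact m / (z - \<rho>) ^ Suc m))
       \<longlonglongrightarrow> (deriv ^^ m) (logderiv f) z"
    using meromorphic_finite_order_logderiv[OF mf V Vne Vf] unfolding S_def by blast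
  have Re_le_s1: "Re \<rho> \<le> s1" if "\<rho> \<in> S" for \<rho>
  proof (rule ccontr)
    assume "\<not> Re \<rho> \<le> s1"
    hence "\<rho> \<in> V" by (simp add: V_def)
    hence "zorder f \<rho> = 0"
      using Vf V by (intro zorder_eq_0I) (auto simp: holomorphic_on_imp_analytic_at)
    thus False using that by (simp add: S_def divisor_support_def)
  qed
  have re: "Re \<rho> \<le> \<sigma>" if "\<rho> \<in> S" for \<rho>
    unfolding \<sigma>_def sigma1_def S_def[symmetric]
    using that Re_le_s1 by (intro cSup_upper) (auto intro!: bdd_aboveI2)
  have sm: "(\<lambda>\<rho>. \<bar>real_of_int (zorder f \<rho>)\<bar> / norm (\<rho> - of_real \<sigma>) ^ d) summable_on S - {of_real \<sigma>}"
    using divisor_summable_convergence_exponent[OF cp(1,2)[unfolded S_def]] by (simp add: d_def S_def)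
  note Kd = Kd_properties[OF cp(1)[unfolded S_def] sm[unfolded S_def d_def \<sigma>_def] re[unfolded S_def \<sigma>_def],
      folded S_def d_def \<sigma>_def]
  \<comment> \<open>\<open>M \<ge> p\<close> removes the polynomial part of \<open>f'/f\<close>, and \<open>M \<ge> d\<close> the boundary terms at 0.\<close>
  define M where "M = max p d"
  define W where "W = (\<lambda>s. (tderiv ^^ d) (power_exp M s))"
  define I where "I = (\<lambda>s. (-1) ^ d * (LINT t:{0..}|lborel. Kd f t * W s t))"
  define \<gamma> where "\<gamma> = (\<lambda>k. of_real (pairing l k) * log_coeff a k * exp (- of_real (pairing l k) * of_real \<sigma>))"
  define b where "b = max 1 (s1 - \<sigma> + 1)"
  have b: "b \<ge> 1" "b + \<sigma> > s1" by (auto simp: b_def)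
  have I_lim: "(\<lambda>n. \<Sum>\<rho>\<in>S \<inter> cball c (real n). of_int (zorder f \<rho>) * (fact M / (of_real (s + \<sigma>) - \<rho>) ^ Suc M)) \<longlonglongrightarrow> I s"
    if "s \<ge> b" for s
    using Kd(3)[of M s] that b unfolding I_def W_def by (simp add: M_def)
  have I_eq: "I s = (-1) ^ M * (deriv ^^ M) (logderiv f) (of_real (s + \<sigma>))" if s: "s \<ge> b" for s
  proof (rule LIMSEQ_unique[OF I_lim[OF s]])
    have zV: "of_real (s + \<sigma>) \<in> V" using s b by (simp add: V_def)
    have "(\<lambda>n. (-1) ^ M * (\<Sum>\<rho>\<in>S \<inter> cball c (real n). of_int (zorder f \<rho>) * ((-1) ^ M * fact M / (of_real (s + \<sigma>) - \<rho>) ^ Suc M)))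
       \<longlonglongrightarrow> (-1) ^ M * (deriv ^^ M) (logderiv f) (of_real (s + \<sigma>))"
      by (intro tendsto_intros cp(3) zV) (simp add: M_def)
    moreover have "(-1) ^ M * (of_int (zorder f \<rho>) * ((-1) ^ M * fact M / (of_real (s + \<sigma>) - \<rho>) ^ Suc M)) =
        (of_int (zorder f \<rho>) * (fact M / (of_real (s + \<sigma>) - \<rho>) ^ Suc M) :: complex)" for \<rho>
    proof -
      have one: "(-1) ^ M * ((-1) ^ M :: complex) = 1" by (simp flip: power_mult_distrib)
      have "(-1) ^ M * (of_int (zorder f \<rho>) * ((-1) ^ M * fact M / (of_real (s + \<sigma>) - \<rho>) ^ Suc M)) =
        ((-1) ^ M * (-1) ^ M) * (of_int (zorder f \<rho>) * (fact M / (of_real (s + \<sigma>) - \<rho>) ^ Suc M) :: complex)"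
        by (simp only: times_divide_eq_right mult_ac)
      thus ?thesis unfolding one by (simp only: mult_1_left)
    qed
    ultimately show "(\<lambda>n. \<Sum>\<rho>\<in>S \<inter> cball c (real n). of_int (zorder f \<rho>) * (fact M / (of_real (s + \<sigma>) - \<rho>) ^ Suc M))
       \<longlonglongrightarrow> (-1) ^ M * (deriv ^^ M) (logderiv f) (of_real (s + \<sigma>))"
      by (simp only: sum_distrib_left)
  qed
  have I_sum: "((\<lambda>k. \<gamma> k * power_exp M s (pairing l k)) has_sum I s) (Lambda N)"
    if s: "s \<ge> b" for s
  proof -
    have "Re (of_real (s + \<sigma>)) > s1" using s b by simp
    from s1(3)[OF this, of M] have
      "((\<lambda>k. of_real (pairing l k) * log_coeff a k * (of_real (pairing l k) ^ M * exp (- (of_real (pairing l k) * of_real (s + \<sigma>)))))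
          has_sum I s) (Lambda N)" unfolding I_eq[OF s] .
    moreover have "of_real (pairing l k) * log_coeff a k * (of_real (pairing l k) ^ M * exp (- (of_real (pairing l k) * of_real (s + \<sigma>))))
       = \<gamma> k * power_exp M s (pairing l k)" for k
    proof -
      have "- (of_real (pairing l k) * complex_of_real (s + \<sigma>)) =
          - of_real (pairing l k) * of_real \<sigma> + - of_real s * of_real (pairing l k)"
        by (simp add: algebra_simps)
      thus ?thesis unfolding \<gamma>_def by (simp only: exp_add mult_ac)
    qed
    ultimately show ?thesis by (simp only:)
  qed
  have x0: "pairing l k \<ge> 0" if "k \<in> Lambda N" for k using pairing_nonneg[OF fr that] .
  have n\<gamma>: "norm (\<gamma> k) * pairing l k ^ M * exp (- pairing l k * b) =
      norm (log_coeff a k) * pairing l k ^ Suc M * exp (- pairing l k * (b + \<sigma>))" if "k \<in> Lambda N" for k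
  proof -
    have "norm (\<gamma> k) = pairing l k * norm (log_coeff a k) * exp (- pairing l k * \<sigma>)"
      using x0[OF that] by (simp add: \<gamma>_def norm_mult)
    moreover have "exp (- pairing l k * (b + \<sigma>)) = exp (- pairing l k * \<sigma>) * exp (- pairing l k * b)"
      by (simp add: exp_add[symmetric] algebra_simps)
    ultimately show ?thesis by (simp only: power_Suc mult_ac)
  qed
  have \<gamma>sm: "(\<lambda>k. norm (\<gamma> k) * pairing l k ^ M * exp (- pairing l k * b)) summable_on Lambda N"
    using s1(4)[OF b(2), of "Suc M"] by (subst summable_on_cong[OF n\<gamma>])
  have Kd0: "(LINT t:{0..}|lborel. Kd f 0 * W s t) = 0" if s: "s > 0" for s
  proof (cases "d = 0")
    case False
    thus ?thesis unfolding W_def using s by (intro integral_const_tderiv_power_exp) (auto simp: M_def)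
  next
    case True
    have "finite (S - {of_real \<sigma>})"
      by (rule finite_of_summable_ge_1[OF sm]) (auto simp: True S_def divisor_support_def)
    hence finS: "finite S" by simp
    define Q where "Q = (\<Sum>\<rho>\<in>S. complex_of_int (zorder f \<rho>))"
    obtain R where R: "\<And>x. x \<in> S \<Longrightarrow> dist c x \<le> R"
      using finite_imp_bounded[OF finS] unfolding bounded_any_center[where a = c] by auto
    have I_fin: "I s = (\<Sum>\<rho>\<in>S. of_int (zorder f \<rho>) * (fact M / (of_real (s + \<sigma>) - \<rho>) ^ Suc M))" if s: "s \<ge> b" for s
    proof (rule LIMSEQ_unique[OF I_lim[OF s]], rule tendsto_eventually)
      have "eventually (\<lambda>n. real n \<ge> R) sequentially"
        by (rule eventually_compose_filterlim[OF eventually_ge_at_top filterlim_real_sequentially])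
      thus "eventually (\<lambda>n. (\<Sum>\<rho>\<in>S \<inter> cball c (real n). of_int (zorder f \<rho>) * (fact M / (of_real (s + \<sigma>) - \<rho>) ^ Suc M)) =
         (\<Sum>\<rho>\<in>S. of_int (zorder f \<rho>) * (fact M / (of_real (s + \<sigma>) - \<rho>) ^ Suc M))) sequentially"
      proof eventually_elim
        case (elim n)
        have "S \<inter> cball c (real n) = S" using R elim by (force simp: mem_cball)
        thus ?case by simp
      qed
    qed
    obtain \<delta> where \<delta>: "\<delta> > 0" "\<And>n. n \<in> indices N \<Longrightarrow> l n \<ge> \<delta>"
      using frequencies_lower_bound[OF fr] by blast
    define Sg where "Sg = (\<Sum>\<^sub>\<infinity>k\<in>Lambda N. norm (\<gamma> k) * pairing l k ^ M * exp (- pairing l k * b))"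
    have I_bd: "norm (I s) \<le> exp (- \<delta> * (s - b)) * Sg" if s: "s \<ge> b" for s
    proof (rule norm_infsum_le[OF I_sum[OF s]])
      show "((\<lambda>k. exp (- \<delta> * (s - b)) * (norm (\<gamma> k) * pairing l k ^ M * exp (- pairing l k * b))) has_sum
              exp (- \<delta> * (s - b)) * Sg) (Lambda N)"
        unfolding Sg_def by (intro has_sum_cmult_right has_sum_infsum \<gamma>sm)
      fix k assume k: "k \<in> Lambda N"
      have "\<delta> * (s - b) \<le> pairing l k * (s - b)"
        using pairing_lower_bound[OF fr k \<delta>(2)] s by (intro mult_right_mono) auto
      hence "exp (- s * pairing l k) \<le> exp (- \<delta> * (s - b) + - pairing l k * b)" by (simp add: algebra_simps)
      hence e: "exp (- s * pairing l k) \<le> exp (- \<delta> * (s - b)) * exp (- pairing l k * b)" by (simp only: exp_add)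
      have "norm (\<gamma> k * power_exp M s (pairing l k)) =
          norm (\<gamma> k) * pairing l k ^ M * exp (- s * pairing l k)"
        using x0[OF k] by (simp add: norm_mult norm_power)
      also have "\<dots> \<le> norm (\<gamma> k) * pairing l k ^ M * (exp (- \<delta> * (s - b)) * exp (- pairing l k * b))"
        using x0[OF k] by (intro mult_left_mono e) auto
      finally show "norm (\<gamma> k * power_exp M s (pairing l k))
         \<le> exp (- \<delta> * (s - b)) * (norm (\<gamma> k) * pairing l k ^ M * exp (- pairing l k * b))" by (simp only: mult_ac)
    qed
    have Q0: "Q = 0" unfolding Q_def
    proof (rule sum_eq_0_of_exponential_decay[OF finS \<delta>(1)])
      show "norm (\<Sum>\<rho>\<in>S. of_int (zorder f \<rho>) * (fact M / (of_real (s + \<sigma>) - \<rho>) ^ Suc M))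
          \<le> exp (- \<delta> * (s - b)) * Sg" if "s \<ge> b" for s
        using I_bd[OF that] unfolding I_fin[OF that] .
    qed
    have zw: "zorder f (of_real \<sigma>) = 0" if "of_real \<sigma> \<notin> S" using that by (simp add: S_def divisor_support_def)
    have "Kd f 0 = of_int (zorder f (of_real \<sigma>)) + (\<Sum>\<rho>\<in>S - {of_real \<sigma>}. of_int (zorder f \<rho>))"
      using finS True unfolding Kd_def Let_def d_def[symmetric] \<sigma>_def[symmetric] S_def[symmetric] by simp
    also have "\<dots> = Q"
      unfolding Q_def using finS zw
      by (cases "of_real \<sigma> \<in> S") (simp_all add: sum.remove)
    finally show ?thesis using Q0 by simp
  qed
  define G where "G = (\<lambda>t. Kd f t - Kd f 0)"
  have Gm: "G \<in> borel_measurable borel" unfolding G_def using Kd(1) by simp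
  have Gb: "poly_exp_bounded 0 G"
  proof -
    obtain C q where C: "\<And>t. t \<ge> 0 \<Longrightarrow> norm (Kd f t) \<le> C * (1 + t) ^ q * exp (- 0 * t)"
      using Kd(2) unfolding poly_exp_bounded_def by blast
    show ?thesis
    proof (rule poly_exp_boundedI)
      fix t :: real assume t: "t \<ge> 0"
      have "norm (Kd f 0) * 1 \<le> norm (Kd f 0) * (1 + t) ^ q" using t by (intro mult_left_mono one_le_power) auto
      thus "norm (G t) \<le> (C + norm (Kd f 0)) * (1 + t) ^ q * exp (- 0 * t)"
        using C[OF t] norm_triangle_ineq4[of "Kd f t" "Kd f 0"] by (simp add: G_def algebra_simps)
    qed
  qed
  have G_eq: "(-1) ^ d * (LINT t:{0..}|lborel. G t * W s t) = I s" if s: "s > 0" for s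
  proof -
    have Wm: "W s \<in> borel_measurable borel" unfolding W_def
      by (intro borel_measurable_continuous_onI smooth_fun_continuous smooth_fun_power_exp)
    have Wpb: "poly_exp_bounded s (W s)" unfolding W_def by (rule poly_exp_bounded_tderiv_power_exp) simp
    have i1: "set_integrable lborel {0..} (\<lambda>t. Kd f t * W s t)"
      using poly_exp_bounded_mult[OF Kd(2) Wpb] Kd(1) Wm s by (intro set_integrable_poly_exp_bounded[of s]) auto
    have i2: "set_integrable lborel {0..} (\<lambda>t. Kd f 0 * W s t)"
      using set_integrable_poly_exp_bounded[OF Wpb Wm s] by (rule set_integrable_mult_right)
    have "(LINT t:{0..}|lborel. G t * W s t) = (LINT t:{0..}|lborel. Kd f t * W s t) - (LINT t:{0..}|lborel. Kd f 0 * W s t)"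
      unfolding G_def left_diff_distrib by (rule set_integral_diff(2)[OF i1 i2])
    thus ?thesis unfolding Kd0[OF s] I_def by simp
  qed
  define u where "u = (\<lambda>t. of_real (exp (\<sigma> * t)) * \<phi> t)"
  have su: "smooth_fun u"
    using smooth_fun_mult[OF smooth_fun_exp(1)[of "of_real \<sigma>"] \<phi>(1)] by (simp add: u_def exp_of_real[symmetric])
  have hs: "((\<lambda>k. \<gamma> k * power_exp M s (pairing l k)) has_sum
       (-1) ^ d * (LINT t:{0..}|lborel. G t * (tderiv ^^ d) (power_exp M s) t)) (Lambda N)"
    if "s \<ge> b" for s
  proof -
    have "s > 0" using that b by simp
    from I_sum[OF that] show ?thesis unfolding G_eq[OF \<open>s > 0\<close>, symmetric] W_def .
  qed
  have u0: "u t = 0" if "t < \<alpha>" for t using \<phi>(2)[OF that] by (simp add: u_def)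
  have u0': "u t = 0" if "t > \<beta>" for t using \<phi>(3)[OF that] by (simp add: u_def)
  have "((\<lambda>k. \<gamma> k * u (pairing l k)) has_sum (-1) ^ d * (LINT t:{0..}|lborel. G t * (tderiv ^^ d) u t)) (Lambda N)"
    by (rule distribution_determined_by_power_exponentials[OF Gm Gb _ b(1) \<gamma>sm _ su _ _ \<phi>(4)])
       (erule x0 hs u0 u0')+
  moreover have "(-1) ^ d * (LINT t:{0..}|lborel. G t * (tderiv ^^ d) u t) = newton_cramer f \<phi>"
    unfolding newton_cramer_eq G_def u_def d_def \<sigma>_def ..
  moreover have "\<gamma> k * u (pairing l k) = of_real (pairing l k) * log_coeff a k * \<phi> (pairing l k)" for k
  proof -
    have "exp (- of_real (pairing l k) * of_real \<sigma>) = complex_of_real (exp (- pairing l k * \<sigma>))"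
      by (simp only: exp_of_real[symmetric] of_real_mult of_real_minus)
    moreover have "exp (- pairing l k * \<sigma>) * exp (\<sigma> * pairing l k) = 1"
      by (simp add: exp_add[symmetric])
    ultimately have one: "exp (- of_real (pairing l k) * of_real \<sigma>) * complex_of_real (exp (\<sigma> * pairing l k)) = 1"
      by (simp only: of_real_mult[symmetric] of_real_1)
    have "\<gamma> k * u (pairing l k) = of_real (pairing l k) * log_coeff a k * \<phi> (pairing l k) *
        (exp (- of_real (pairing l k) * of_real \<sigma>) * complex_of_real (exp (\<sigma> * pairing l k)))"
      unfolding \<gamma>_def u_def by (simp only: mult_ac)
    thus ?thesis unfolding one by (simp only: mult_1_right)
  qed
  ultimately show ?thesis by (simp only:)
qed

theorem corollary3p6:
  fixes N :: enat and l :: "nat \<Rightarrow> real" and a :: "nat \<Rightarrow> complex"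
    and \<sigma> :: real and f :: "complex \<Rightarrow> complex"
  assumes "frequencies N l"
    and "(\<lambda>n. norm (a n) * exp (- l n * \<sigma>)) summable_on indices N"
    and "\<And>s. Re s > \<sigma> \<Longrightarrow> f s = dirichlet_series N l a s"
    and "meromorphic_finite_order f"
    and "\<not> f constant_on UNIV"
  shows "distribution_on {0<..} (newton_cramer f) \<and>
         (\<forall>\<phi>\<in>test_functions {0<..}.
            ((\<lambda>k. of_real (pairing l k) * log_coeff a k * dirac (pairing l k) \<phi>)
               has_sum newton_cramer f \<phi>) (Lambda N))"
proof
  let ?\<beta> = "\<lambda>k. of_real (pairing l k) * log_coeff a k"
  have S: "((\<lambda>k. ?\<beta> k * \<phi> (pairing l k)) has_sum newton_cramer f \<phi>) (Lambda N)"
    if \<phi>: "\<phi> \<in> test_functions {0<..}" for \<phi>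
  proof -
    obtain \<alpha> b where "smooth_fun \<phi>" "0 < \<alpha>" "\<And>t. t < \<alpha> \<Longrightarrow> \<phi> t = 0" "\<And>t. t > b \<Longrightarrow> \<phi> t = 0"
      by (rule test_functions_support[OF \<phi>]) blast
    thus ?thesis by (intro newton_cramer_has_sum[OF assms(1-4), where \<alpha> = \<alpha> and \<beta> = b])
  qed
  show "\<forall>\<phi>\<in>test_functions {0<..}.
            ((\<lambda>k. ?\<beta> k * dirac (pairing l k) \<phi>) has_sum newton_cramer f \<phi>) (Lambda N)"
    using S by (simp add: dirac_def)
  obtain s1 where s1: "\<And>m s. s > s1 \<Longrightarrow> (\<lambda>k. norm (log_coeff a k) * pairing l k ^ m * exp (- pairing l k * s)) summable_on Lambda N"
    by (rule dirichlet_logderiv_expansion[OF assms(1,2), of f]) (erule assms(3), rule that)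
  show "distribution_on {0<..} (newton_cramer f)"
    unfolding distribution_on_def
  proof (intro conjI allI ballI impI)
    fix \<phi> \<psi> assume \<phi>: "\<phi> \<in> test_functions {0<..}" and \<psi>: "\<psi> \<in> test_functions {0<..}"
    obtain \<alpha> b where 1: "smooth_fun \<phi>" "0 < \<alpha>" "\<And>t. t < \<alpha> \<Longrightarrow> \<phi> t = 0" "\<And>t. t > b \<Longrightarrow> \<phi> t = 0"
      by (rule test_functions_support[OF \<phi>]) blast
    obtain \<alpha>' b' where 2: "smooth_fun \<psi>" "0 < \<alpha>'" "\<And>t. t < \<alpha>' \<Longrightarrow> \<psi> t = 0" "\<And>t. t > b' \<Longrightarrow> \<psi> t = 0"
      by (rule test_functions_support[OF \<psi>]) blast
    have "((\<lambda>k. ?\<beta> k * (\<phi> (pairing l k) + \<psi> (pairing l k))) has_sum newton_cramer f (\<lambda>t. \<phi> t + \<psi> t)) (Lambda N)"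
      by (rule newton_cramer_has_sum[OF assms(1-4), where \<alpha> = "min \<alpha> \<alpha>'" and \<beta> = "max b b'"])
         (use 1 2 smooth_fun_add(1)[OF 1(1) 2(1)] in auto)
    moreover have "((\<lambda>k. ?\<beta> k * (\<phi> (pairing l k) + \<psi> (pairing l k))) has_sum newton_cramer f \<phi> + newton_cramer f \<psi>) (Lambda N)"
      unfolding distrib_left by (intro has_sum_add S \<phi> \<psi>)
    ultimately show "newton_cramer f (\<lambda>t. \<phi> t + \<psi> t) = newton_cramer f \<phi> + newton_cramer f \<psi>"
      by (rule has_sum_unique)
  next
    fix c \<phi> assume \<phi>: "\<phi> \<in> test_functions {0<..}"
    obtain \<alpha> b where 1: "smooth_fun \<phi>" "0 < \<alpha>" "\<And>t. t < \<alpha> \<Longrightarrow> \<phi> t = 0" "\<And>t. t > b \<Longrightarrow> \<phi> t = 0"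
      by (rule test_functions_support[OF \<phi>]) blast
    have "((\<lambda>k. ?\<beta> k * (c * \<phi> (pairing l k))) has_sum newton_cramer f (\<lambda>t. c * \<phi> t)) (Lambda N)"
      by (rule newton_cramer_has_sum[OF assms(1-4), where \<alpha> = \<alpha> and \<beta> = b])
         (use 1 smooth_fun_cmult(1)[OF 1(1)] in auto)
    moreover have "((\<lambda>k. ?\<beta> k * (c * \<phi> (pairing l k))) has_sum c * newton_cramer f \<phi>) (Lambda N)"
      unfolding mult.left_commute[of _ c] by (intro has_sum_cmult_right S \<phi>)
    ultimately show "newton_cramer f (\<lambda>t. c * \<phi> t) = c * newton_cramer f \<phi>"
      by (rule has_sum_unique)
  next
    fix K :: "real set" assume K: "compact K \<and> K \<subseteq> {0<..}"
    then obtain r where r: "\<And>t. t \<in> K \<Longrightarrow> norm t \<le> r"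
      by (meson compact_imp_bounded bounded_iff)
    define s where "s = max 1 (s1 + 1)"
    have s: "s > s1" "s > 0" by (auto simp: s_def)
    define A where "A = (\<Sum>\<^sub>\<infinity>k\<in>Lambda N. norm (log_coeff a k) * pairing l k ^ 1 * exp (- pairing l k * s))"
    have x0: "pairing l k \<ge> 0" if "k \<in> Lambda N" for k using pairing_nonneg[OF assms(1) that] .
    have "norm (newton_cramer f \<phi>) \<le> (exp (r * s) * A) * (\<Sum>j\<le>0. SUP t. norm ((tderiv ^^ j) \<phi> t))"
      if \<phi>: "\<phi> \<in> test_functions {0<..}" and \<phi>K: "\<forall>t. t \<notin> K \<longrightarrow> \<phi> t = 0" for \<phi>
    proof -
      have cont: "continuous_on K (\<lambda>t. norm (\<phi> t))"
        using smooth_fun_continuous[of \<phi> K 0] \<phi> by (intro continuous_on_norm) (simp add: test_functions_def)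
      obtain B where B: "\<And>t. t \<in> K \<Longrightarrow> norm (\<phi> t) \<le> B" "B \<ge> 0"
      proof (cases "K = {}")
        case False
        obtain t0 where "t0 \<in> K" "\<And>t. t \<in> K \<Longrightarrow> norm (\<phi> t) \<le> norm (\<phi> t0)"
          using continuous_attains_sup[OF conjunct1[OF K] False cont] by blast
        thus ?thesis using that[of "norm (\<phi> t0)"] by simp
      qed (use that[of 0] in simp)
      have "norm (\<phi> t) \<le> B" for t using B \<phi>K by (cases "t \<in> K") auto
      hence bdd: "bdd_above (range (\<lambda>t. norm (\<phi> t)))" by (auto intro!: bdd_aboveI2)
      define p where "p = (SUP t. norm (\<phi> t))"
      have p: "norm (\<phi> t) \<le> p" for t unfolding p_def by (rule cSUP_upper[OF UNIV_I bdd])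
      have p0: "p \<ge> 0" using order_trans[OF norm_ge_zero p] .
      have "norm (newton_cramer f \<phi>) \<le> (exp (r * s) * p) * A"
      proof (rule norm_infsum_le[OF S[OF \<phi>]])
        show "((\<lambda>k. (exp (r * s) * p) * (norm (log_coeff a k) * pairing l k ^ 1 * exp (- pairing l k * s)))
           has_sum (exp (r * s) * p) * A) (Lambda N)"
          unfolding A_def by (intro has_sum_cmult_right has_sum_infsum s1 s)
        fix k assume k: "k \<in> Lambda N"
        show "norm (?\<beta> k * \<phi> (pairing l k)) \<le>
          (exp (r * s) * p) * (norm (log_coeff a k) * pairing l k ^ 1 * exp (- pairing l k * s))"
        proof (cases "pairing l k \<in> K")
          case True
          hence "pairing l k * s \<le> r * s" using r[OF True] s by (intro mult_right_mono) auto
          hence "1 \<le> exp (r * s + - pairing l k * s)" by simp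
          hence e: "1 \<le> exp (r * s) * exp (- pairing l k * s)" by (simp only: exp_add)
          have "norm (?\<beta> k * \<phi> (pairing l k)) = (pairing l k * norm (log_coeff a k) * norm (\<phi> (pairing l k))) * 1"
            using x0[OF k] by (simp add: norm_mult)
          also have "\<dots> \<le> (pairing l k * norm (log_coeff a k) * p) * (exp (r * s) * exp (- pairing l k * s))"
            using x0[OF k] p p0 by (intro mult_mono e mult_nonneg_nonneg) auto
          finally show ?thesis by (simp only: mult_ac power_one_right)
        next
          case False
          hence "\<phi> (pairing l k) = 0" using \<phi>K by simp
          thus ?thesis using p0 x0[OF k] by simp
        qed
      qed
      thus ?thesis by (simp add: p_def mult_ac)
    qed
    thus "\<exists>C m. \<forall>\<phi>\<in>test_functions {0<..}. (\<forall>t. t \<notin> K \<longrightarrow> \<phi> t = 0) \<longrightarrow>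
           norm (newton_cramer f \<phi>) \<le> C * (\<Sum>j\<le>m. SUP t. norm ((tderiv ^^ j) \<phi> t))"
      by blast
  qed
qed

end
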